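(* Let $p$ be a prime number and let $\overline{H}$ be a bad subgroup of $PSL(p,\mathbb{C})$. Then there are two cases: (1) $Z_{PSL(p,\mathbb{C})}(\overline{H})$ is isomorphic to $\mathbb{Z}/p\times\mathbb{Z}/p$. In this case $\overline{H}$ is conjugate in $PSL(p,\mathbb{C})$ to the group $\langle \overline{D(\xi)}\rangle\times\langle\overline{M_c}\rangle$, and $Z_{PSL(p,\mathbb{C})}(\overline{H})=\overline{H}$. (2) $Z_{PSL(p,\mathbb{C})}(\overline{H})$ is isomorphic to $\mathbb{Z}/p$. In this case $\overline{H}$ is conjugate in $PSL(p,\mathbb{C})$ to $\overline{K}\rtimes\langle\overline{M_c}\rangle$, where $\overline{K}$ is a non-trivial subgroup of $\overline{D}$, different from $\langle\overline{D(\xi)}\rangle$ and invariant under the conjugation action of $\langle\overline{M_c}\rangle$; in particular $Z_{PSL(p,\mathbb{C})}(\overline{H})$ is conjugate to $\langle\overline{D(\xi)}\rangle$.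
   Context: A subgroup $H$ of a complex reductive group $G$ is irreducible if it is not contained in any parabolic subgroup of $G$ (a proper subgroup $P$ is parabolic if $G/P$ is a complete variety). $Z_G(H)$ denotes the centralizer of $H$ in $G$ and $Z(G)$ the center of $G$. An irreducible subgroup $H$ is good if $Z_G(H)=Z(G)$ and bad otherwise (so a bad subgroup is in particular irreducible). The center of $PSL(p,\mathbb{C})$ is trivial. Let $\xi\in\mathbb{C}$ be a primitive $p$-th root of unity. For $M\in SL(p,\mathbb{C})$, $\overline{M}$ denotes its image in $PSL(p,\mathbb{C})$. Rows and columns are indexed by $\mathbb{Z}/p=\{0,\dots,p-1\}$, with canonical basis $(e_i)$. $D\subset SL(p,\mathbb{C})$ is the subgroup of diagonal matrices and $\overline{D}$ its image in $PSL(p,\mathbb{C})$. For $p$ odd, $D(\xi)=\mathrm{diag}(1,\xi,\dots,\xi^{p-1})$ and $M_c$ is the permutation matrix of the cycle $c=(0,1,\dots,p-1)$, i.e. $M_ce_i=e_{i+1}$. For $p=2$, $D(\xi)=\begin{pmatrix}\sqrt{-1}&0\\0&-\sqrt{-1}\end{pmatrix}$ and $M_c=\begin{pmatrix}0&\sqrt{-1}\\\sqrt{-1}&0\end{pmatrix}$. The element $\overline{M_c}$ has order $p$, normalizes $\overline{D}$ and $\overline{D}\cap\langle\overline{M_c}\rangle$ is trivial, so $\overline{D}\rtimes\langle\overline{M_c}\rangle$ is viewed as a subgroup of $PSL(p,\mathbb{C})$ (and likewise $\overline{K}\rtimes\langle\overline{M_c}\rangle$ for $\overline{K}\leq\overline{D}$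 stable under conjugation by $\overline{M_c}$). *)

theory Defs
  imports
    Complex_Main
    "HOL-Computational_Algebra.Primes"
    "HOL-Algebra.Elementary_Groups"
    "HOL-Algebra.Generated_Groups"
    "HOL-Algebra.Left_Coset"
    "Jordan_Normal_Form.Determinant"
begin

section \<open>Groups\<close>

definition group_center :: "('a, 'b) monoid_scheme \<Rightarrow> 'a set" where
  "group_center G = {z \<in> carrier G. \<forall>g \<in> carrier G. z \<otimes>\<^bsub>G\<^esub> g = g \<otimes>\<^bsub>G\<^esub> z}"

definition group_centralizer :: "('a, 'b) monoid_scheme \<Rightarrow> 'a set \<Rightarrow> 'a set" where
  "group_centralizer G H = {z \<in> carrier G. \<forall>h \<in> H. z \<otimes>\<^bsub>G\<^esub> h = h \<otimes>\<^bsub>G\<^esub> z}"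

definition conj_set :: "('a, 'b) monoid_scheme \<Rightarrow> 'a \<Rightarrow> 'a set \<Rightarrow> 'a set" where
  "conj_set G g H = (\<lambda>h. g \<otimes>\<^bsub>G\<^esub> h \<otimes>\<^bsub>G\<^esub> inv\<^bsub>G\<^esub> g) ` H"

definition conjugate_in :: "('a, 'b) monoid_scheme \<Rightarrow> 'a set \<Rightarrow> 'a set \<Rightarrow> bool" where
  "conjugate_in G H L \<longleftrightarrow> (\<exists>g \<in> carrier G. H = conj_set G g L)"

definition conj_invariant :: "('a, 'b) monoid_scheme \<Rightarrow> 'a set \<Rightarrow> 'a set \<Rightarrow> bool" where
  "conj_invariant G Q N \<longleftrightarrow> (\<forall>q \<in> Q. conj_set G q N = N)"

text \<open>The set \<open>N <#>\<^bsub>G\<^esub> Q\<close> of products is a subgroup of \<open>G\<close> which is the internal semidirect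
  product of \<open>N\<close> (normal) and \<open>Q\<close>, respectively their internal direct product.\<close>

definition internal_semidirect :: "('a, 'b) monoid_scheme \<Rightarrow> 'a set \<Rightarrow> 'a set \<Rightarrow> bool" where
  "internal_semidirect G N Q \<longleftrightarrow>
     subgroup (N <#>\<^bsub>G\<^esub> Q) G \<and>
     N \<lhd> (G\<lparr>carrier := N <#>\<^bsub>G\<^esub> Q\<rparr>) \<and>
     subgroup Q (G\<lparr>carrier := N <#>\<^bsub>G\<^esub> Q\<rparr>) \<and>
     N \<inter> Q = {\<one>\<^bsub>G\<^esub>}"

definition internal_direct :: "('a, 'b) monoid_scheme \<Rightarrow> 'a set \<Rightarrow> 'a set \<Rightarrow> bool" where
  "internal_direct G N Q \<longleftrightarrow>
     internal_semidirect G N Q \<and> Q \<lhd> (G\<lparr>carrier := N <#>\<^bsub>G\<^esub> Q\<rparr>)"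

section \<open>The groups SL and PSL over the complex numbers\<close>

definition SL :: "nat \<Rightarrow> complex mat monoid" where
  "SL n = \<lparr>carrier = {A \<in> carrier_mat n n. det A = 1}, monoid.mult = (*), one = 1\<^sub>m n\<rparr>"

definition PSL :: "nat \<Rightarrow> complex mat set monoid" where
  "PSL n = SL n Mod group_center (SL n)"

definition to_PSL :: "nat \<Rightarrow> complex mat \<Rightarrow> complex mat set" where
  "to_PSL n A = group_center (SL n) #>\<^bsub>SL n\<^esub> A"

section \<open>Zariski topology\<close>

text \<open>The algebra of functions generated by a set \<open>X\<close> of coordinate functions.\<close>

inductive_set poly_functions :: "('a \<Rightarrow> complex) set \<Rightarrow> ('a \<Rightarrow> complex) set"
  for X :: "('a \<Rightarrow> complex) set" where
  const: "(\<lambda>_. c) \<in> poly_functions X"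
| coord: "f \<in> X \<Longrightarrow> f \<in> poly_functions X"
| add: "f \<in> poly_functions X \<Longrightarrow> g \<in> poly_functions X \<Longrightarrow> (\<lambda>x. f x + g x) \<in> poly_functions X"
| mult: "f \<in> poly_functions X \<Longrightarrow> g \<in> poly_functions X \<Longrightarrow> (\<lambda>x. f x * g x) \<in> poly_functions X"

text \<open>\<open>S\<close> is a closed subset of \<open>V\<close>, where \<open>V\<close> is a subset of the affine space
  with coordinate functions \<open>X\<close>.\<close>

definition zariski_closed :: "('a \<Rightarrow> complex) set \<Rightarrow> 'a set \<Rightarrow> 'a set \<Rightarrow> bool" where
  "zariski_closed X V S \<longleftrightarrow> (\<exists>F \<subseteq> poly_functions X. S = {x \<in> V. \<forall>f \<in> F. f x = 0})"

definition mat_coords :: "nat \<Rightarrow> (complex mat \<Rightarrow> complex) set" where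
  "mat_coords n = {(\<lambda>A. A $$ (i, j)) | i j. i < n \<and> j < n}"

definition vec_coords :: "nat \<Rightarrow> (complex vec \<Rightarrow> complex) set" where
  "vec_coords m = {(\<lambda>y. y $ k) | k. k < m}"

definition mat_vec_coords :: "nat \<Rightarrow> nat \<Rightarrow> (complex mat \<times> complex vec \<Rightarrow> complex) set" where
  "mat_vec_coords n m = {f \<circ> fst | f. f \<in> mat_coords n} \<union> {f \<circ> snd | f. f \<in> vec_coords m}"

section \<open>Parabolic, irreducible and bad subgroups of PSL\<close>

text \<open>\<open>PSL n\<close> carries the quotient topology of \<open>SL n\<close>.\<close>

definition PSL_closed :: "nat \<Rightarrow> complex mat set set \<Rightarrow> bool" where
  "PSL_closed n S \<longleftrightarrow> S \<subseteq> carrier (PSL n) \<and>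
     zariski_closed (mat_coords n) (carrier (SL n)) {A \<in> carrier (SL n). to_PSL n A \<in> S}"

text \<open>Closed subsets of \<open>(PSL n)/P \<times> \<A>\<^sup>m\<close>. The quotient map \<open>SL n \<rightarrow> (PSL n)/P\<close> is an open
  surjection and stays so after taking the product with any variety, so a subset of
  \<open>(PSL n)/P \<times> \<A>\<^sup>m\<close> is Zariski closed iff its preimage in \<open>SL n \<times> \<A>\<^sup>m\<close> is.\<close>

definition quotient_times_affine_closed ::
  "nat \<Rightarrow> complex mat set set \<Rightarrow> nat \<Rightarrow> (complex mat set set \<times> complex vec) set \<Rightarrow> bool" where
  "quotient_times_affine_closed n P m W \<longleftrightarrow>
     W \<subseteq> (lcosets\<^bsub>PSL n\<^esub> P) \<times> carrier_vec m \<and>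
     zariski_closed (mat_vec_coords n m) (carrier (SL n) \<times> carrier_vec m)
       {(A, y). A \<in> carrier (SL n) \<and> y \<in> carrier_vec m \<and> (to_PSL n A <#\<^bsub>PSL n\<^esub> P, y) \<in> W}"

text \<open>A variety \<open>X\<close> is complete if for every variety \<open>Y\<close> the projection \<open>X \<times> Y \<rightarrow> Y\<close> is closed.
  Closedness can be checked on an affine open cover of \<open>Y\<close>, and for \<open>Y\<close> closed in \<open>\<A>\<^sup>m\<close> the product
  \<open>X \<times> Y\<close> is closed in \<open>X \<times> \<A>\<^sup>m\<close>; hence it suffices to let \<open>Y\<close> range over the affine spaces.\<close>

definition complete_quotient :: "nat \<Rightarrow> complex mat set set \<Rightarrow> bool" where
  "complete_quotient n P \<longleftrightarrow>
     (\<forall>m W. quotient_times_affine_closed n P m W \<longrightarrow>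
        zariski_closed (vec_coords m) (carrier_vec m) (snd ` W))"

text \<open>The quotient by \<open>P\<close> is a variety precisely when \<open>P\<close> is closed.\<close>

definition parabolic :: "nat \<Rightarrow> complex mat set set \<Rightarrow> bool" where
  "parabolic n P \<longleftrightarrow> subgroup P (PSL n) \<and> P \<noteq> carrier (PSL n) \<and> PSL_closed n P \<and>
     complete_quotient n P"

definition irreducible_subgroup :: "nat \<Rightarrow> complex mat set set \<Rightarrow> bool" where
  "irreducible_subgroup n H \<longleftrightarrow> subgroup H (PSL n) \<and> \<not> (\<exists>P. parabolic n P \<and> H \<subseteq> P)"

definition bad_subgroup :: "nat \<Rightarrow> complex mat set set \<Rightarrow> bool" where
  "bad_subgroup n H \<longleftrightarrow> irreducible_subgroup n H \<and>
     group_centralizer (PSL n) H \<noteq> group_center (PSL n)"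

section \<open>Special elements and subgroups\<close>

definition primitive_root_of_unity :: "nat \<Rightarrow> complex \<Rightarrow> bool" where
  "primitive_root_of_unity n \<xi> \<longleftrightarrow> \<xi> ^ n = 1 \<and> (\<forall>k. 0 < k \<and> k < n \<longrightarrow> \<xi> ^ k \<noteq> 1)"

text \<open>For \<open>p = 2\<close> the matrices are rescaled by \<open>\<i>\<close> so that their determinant is \<open>1\<close>.\<close>

definition D_mat :: "nat \<Rightarrow> complex \<Rightarrow> complex mat" where
  "D_mat p \<xi> =
     (if p = 2 then mat 2 2 (\<lambda>(i, j). if i \<noteq> j then 0 else if i = 0 then \<i> else - \<i>)
      else mat p p (\<lambda>(i, j). if i = j then \<xi> ^ i else 0))"

definition M_c :: "nat \<Rightarrow> complex mat" where
  "M_c p =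
     (if p = 2 then mat 2 2 (\<lambda>(i, j). if i \<noteq> j then \<i> else 0)
      else mat p p (\<lambda>(i, j). if i = (j + 1) mod p then 1 else 0))"

definition D_bar :: "nat \<Rightarrow> complex mat set set" where
  "D_bar p = to_PSL p ` {A \<in> carrier (SL p). diagonal_mat A}"

definition gen_D :: "nat \<Rightarrow> complex \<Rightarrow> complex mat set set" where
  "gen_D p \<xi> = generate (PSL p) {to_PSL p (D_mat p \<xi>)}"

definition gen_M :: "nat \<Rightarrow> complex mat set set" where
  "gen_M p = generate (PSL p) {to_PSL p (M_c p)}"

end

theory Submission
  imports Defs
    "HOL-Computational_Algebra.Fundamental_Theorem_Algebra"
    "Jordan_Normal_Form.Spectral_Radius"
    "HOL-Number_Theory.Cong"
begin

text \<open>Let \<open>z \<noteq> 1\<close> centralize the irreducible subgroup \<open>H\<close>, and let \<open>g\<close> be a matrix over \<open>z\<close>. Every matrix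
\<open>A\<close> over an element of \<open>H\<close> commutes with \<open>g\<close> up to a \<open>p\<close>-th root of unity: \<open>g A = c A g\<close>. If \<open>c\<close> were
always \<open>1\<close>, then \<open>g\<close> would be scalar by Schur's lemma (\<open>irreducible_schur\<close>), so some \<open>c\<close> is primitive
and a power of that \<open>A\<close> satisfies \<open>g A = \<xi> A g\<close>. Multiplication by \<open>A\<close> then permutes the eigenlines of
\<open>g\<close> cyclically, and in a suitable eigenbasis \<open>g\<close> and \<open>A\<close> become multiples of the diagonal matrix
\<open>D = D(\<xi>)\<close> and of \<open>M = M\<^sub>c\<close> (\<open>commuting_pair_normal_form\<close>). So, up to conjugacy, the image \<open>\<delta>\<close> of
\<open>D\<close> centralizes \<open>H\<close> and the image \<open>\<mu>\<close> of \<open>M\<close> lies in \<open>H\<close>.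

The centralizer of \<open>\<delta>\<close> consists of the products of a diagonal class and a power of \<open>\<mu>\<close>, because any
twisted commutation with \<open>D\<close> can be undone by a power of \<open>M\<close>. Hence \<open>H = K \<langle>\<mu>\<rangle>\<close>, where \<open>K\<close> is the
diagonal part of \<open>H\<close>. Schur's lemma also shows that the centralizer \<open>Z\<close> of \<open>H\<close> is abelian
(\<open>irreducible_centralizer_commutative\<close>): it embeds into the characters of the preimage of \<open>H\<close>. So \<open>Z\<close> centralizes \<open>\<delta>\<close>
too, and each of its elements is \<open>t \<mu>\<^sup>k\<close> with \<open>t\<close> diagonal. Commutation with \<open>\<mu>\<close> forces \<open>t \<in> \<langle>\<delta>\<rangle>\<close>,
and \<open>\<mu>\<^sup>k \<noteq> 1\<close> is possible only if \<open>\<mu>\<close> commutes with \<open>K\<close>, that is, if \<open>K \<subseteq> \<langle>\<delta>\<rangle>\<close>. Finally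
\<open>K \<noteq> 1\<close>, since otherwise \<open>H\<close> would be cyclic, against Schur's lemma. The two cases of the theorem are
therefore \<open>K = \<langle>\<delta>\<rangle>\<close> (\<open>self_centralizing_case\<close>) and \<open>K \<noteq> \<langle>\<delta>\<rangle>\<close> (\<open>cyclic_centralizer_case\<close>).

Irreducibility is defined by completeness of quotient varieties, so Schur's lemma rests on the fact
that the stabilizer of a proper non-zero subspace is parabolic (\<open>block_parabolic_parabolic\<close>). Its
core is completeness of the flag variety: a closed subset of \<open>SL\<^sub>n \<times> \<A>\<^sup>m\<close> that is invariant under
right multiplication by upper triangular matrices has a closed image in \<open>\<A>\<^sup>m\<close>
(\<open>flag_projection_closed\<close>). Such a set is enlarged step by step, each time by the \<open>SL\<^sub>2\<close> acting on two neighbouring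
columns. Each step projects along a projective line and keeps the set closed
(\<open>line_projection_closed\<close>, by a determinant that plays the role of a resultant), and column
reduction shows that finitely many steps reach all of \<open>SL\<^sub>n\<close>.\<close>

section \<open>Complex matrices\<close>

lemma mult_mat_index_sum:
  "A \<in> carrier_mat n n \<Longrightarrow> B \<in> carrier_mat n n \<Longrightarrow> i < n \<Longrightarrow> j < n \<Longrightarrow>
    (A * B) $$ (i, j) = (\<Sum>k = 0..<n. A $$ (i, k) * B $$ (k, j))"
  by (simp add: scalar_prod_def)

lemma smult_smult_mat: "s \<cdot>\<^sub>m (t \<cdot>\<^sub>m B) = (s * t) \<cdot>\<^sub>m (B :: complex mat)"
  by (rule eq_matI) auto

lemma one_smult_mat: "1 \<cdot>\<^sub>m B = (B :: complex mat)"
  by (rule eq_matI) auto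

lemma smult_mat_mult_vec:
  "X \<in> carrier_mat n n \<Longrightarrow> w \<in> carrier_vec n \<Longrightarrow> (c \<cdot>\<^sub>m X) *\<^sub>v w = c \<cdot>\<^sub>v (X *\<^sub>v (w :: complex vec))"
  by (rule eq_vecI) auto

text \<open>The equations \<open>X A = a A X\<close> with scalar \<open>a\<close> are what remains at the level of matrices of commutation
in \<open>PSL\<close>; the scalars multiply, so they behave like a character in \<open>A\<close>.\<close>

lemma twisted_mult:
  assumes X: "X \<in> carrier_mat n n" and A: "A \<in> carrier_mat n n" and B: "B \<in> carrier_mat n n"
    and XA: "X * A = a \<cdot>\<^sub>m (A * X)" and XB: "X * B = b \<cdot>\<^sub>m (B * X)"
  shows "X * (A * B) = (a * b) \<cdot>\<^sub>m ((A * B) * (X :: complex mat))"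
proof -
  have "X * (A * B) = (X * A) * B" by (rule assoc_mult_mat[OF X A B, symmetric])
  also have "\<dots> = a \<cdot>\<^sub>m ((A * X) * B)"
    unfolding XA by (rule mult_smult_assoc_mat[OF mult_carrier_mat[OF A X] B])
  also have "(A * X) * B = A * (X * B)" by (rule assoc_mult_mat[OF A X B])
  also have "\<dots> = b \<cdot>\<^sub>m (A * (B * X))"
    unfolding XB by (rule mult_smult_distrib[OF A mult_carrier_mat[OF B X]])
  also have "A * (B * X) = (A * B) * X" by (rule assoc_mult_mat[OF A B X, symmetric])
  finally show ?thesis by (simp only: smult_smult_mat)
qed

lemma twisted_inverse:
  assumes X: "X \<in> carrier_mat n n" and A: "A \<in> carrier_mat n n" and B: "B \<in> carrier_mat n n"
    and XA: "X * A = a \<cdot>\<^sub>m (A * X)" and inv: "A * B = 1\<^sub>m n" "B * A = 1\<^sub>m n" and a: "a \<noteq> 0"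
  shows "X * B = (1 / a) \<cdot>\<^sub>m (B * (X :: complex mat))"
proof -
  have AX: "A * X \<in> carrier_mat n n" using A X by simp
  have "B * X = B * (X * (A * B))" using inv(1) X by simp
  also have "X * (A * B) = (X * A) * B" by (rule assoc_mult_mat[OF X A B, symmetric])
  also have "B * ((X * A) * B) = a \<cdot>\<^sub>m (B * ((A * X) * B))"
    unfolding XA mult_smult_assoc_mat[OF AX B] by (rule mult_smult_distrib[OF B mult_carrier_mat[OF AX B]])
  also have "B * ((A * X) * B) = (B * A) * (X * B)"
    using A X B by (simp add: assoc_mult_mat[of _ n n _ n _ n] mult_carrier_mat[of _ n n _ n])
  finally have "B * X = a \<cdot>\<^sub>m (X * B)" using inv(2) left_mult_one_mat[OF mult_carrier_mat[OF X B]] by simp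
  then show ?thesis using a by (simp add: smult_smult_mat one_smult_mat)
qed

lemma mat_conj_mult:
  assumes "g \<in> carrier_mat n n" "h \<in> carrier_mat n n" "g * h = 1\<^sub>m n" "A \<in> carrier_mat n n" "B \<in> carrier_mat n n"
  shows "(h * A * g) * (h * B * g) = h * (A * B) * (g :: complex mat)"
proof -
  have "(h * A * g) * (h * B * g) = h * A * (g * h) * B * g"
    using assms(1,2,4,5) by (simp add: assoc_mult_mat[of _ n n _ n _ n] mult_carrier_mat[of _ n n _ n])
  then show ?thesis using assms by (simp add: assoc_mult_mat[of _ n n _ n _ n])
qed

lemma diagonal_commute:
  assumes X: "X \<in> carrier_mat n n" and Y: "Y \<in> carrier_mat n n"
    and "diagonal_mat X" "diagonal_mat Y"
  shows "X * Y = Y * (X :: complex mat)"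
proof (rule eq_matI)
  fix i j assume "i < dim_row (Y * X)" "j < dim_col (Y * X)"
  then have ij: "i < n" "j < n" using X Y by auto
  have "(X * Y) $$ (i, j) = (\<Sum>k = 0..<n. X $$ (i, k) * Y $$ (k, j))" by (rule mult_mat_index_sum[OF X Y ij])
  also have "\<dots> = (\<Sum>k = 0..<n. Y $$ (i, k) * X $$ (k, j))"
  proof (rule sum.cong)
    fix k assume "k \<in> {0..<n}"
    then show "X $$ (i, k) * Y $$ (k, j) = Y $$ (i, k) * X $$ (k, j)"
      using assms ij by (cases "i = k"; cases "k = j") (auto simp: diagonal_mat_def)
  qed simp
  also have "\<dots> = (Y * X) $$ (i, j)" using mult_mat_index_sum[OF Y X ij] by simp
  finally show "(X * Y) $$ (i, j) = (Y * X) $$ (i, j)" .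
qed (use X Y in auto)

section \<open>Projecting a closed set along the projective line\<close>

lemma poly_functions_sum:
  assumes "finite I" "\<And>i. i \<in> I \<Longrightarrow> f i \<in> poly_functions X"
  shows "(\<lambda>x. \<Sum>i\<in>I. f i x) \<in> poly_functions X"
  using assms by (induction I) (auto intro: poly_functions.intros)

lemma poly_functions_prod:
  assumes "finite I" "\<And>i. i \<in> I \<Longrightarrow> f i \<in> poly_functions X"
  shows "(\<lambda>x. \<Prod>i\<in>I. f i x) \<in> poly_functions X"
  using assms by (induction I) (auto intro: poly_functions.intros)

lemma zariski_closed_subset: "zariski_closed X V S \<Longrightarrow> S \<subseteq> V"
  by (auto simp: zariski_closed_def)

lemma zariski_closedI:
  assumes "S \<subseteq> V"
    and "\<And>x. x \<in> V \<Longrightarrow> x \<notin> S \<Longrightarrow> \<exists>f \<in> poly_functions X. (\<forall>s\<in>S. f s = 0) \<and> f x \<noteq> 0"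
  shows "zariski_closed X V S"
  unfolding zariski_closed_def
  by (rule exI[of _ "{f \<in> poly_functions X. \<forall>s\<in>S. f s = 0}"]) (use assms in blast)

text \<open>Polynomials in one extra variable whose coefficients are polynomial functions on the space. The
uniform bound on the degree makes them polynomial functions on the product with the affine line.\<close>

definition poly_families :: "('a \<Rightarrow> complex) set \<Rightarrow> ('a \<Rightarrow> complex poly) set" where
  "poly_families X = {F. (\<forall>i. (\<lambda>x. coeff (F x) i) \<in> poly_functions X) \<and> (\<exists>d. \<forall>x. degree (F x) \<le> d)}"

lemma poly_familiesI:
  assumes "\<And>i. (\<lambda>x. coeff (F x) i) \<in> poly_functions X" "\<And>x. degree (F x) \<le> d"
  shows "F \<in> poly_families X"
  using assms unfolding poly_families_def by blast

lemma poly_families_degree: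
  assumes "F \<in> poly_families X" obtains d where "\<And>x. degree (F x) \<le> d"
  using assms unfolding poly_families_def by blast

lemma poly_families_coeff:
  "F \<in> poly_families X \<Longrightarrow> (\<lambda>x. coeff (F x) i) \<in> poly_functions X"
  unfolding poly_families_def by blast

lemma poly_families_const: "(\<lambda>_. u) \<in> poly_families X"
  by (rule poly_familiesI[of _ _ "degree u"]) (auto intro: poly_functions.intros)

lemma poly_families_coord:
  assumes "f \<in> poly_functions X" shows "(\<lambda>x. [:f x:]) \<in> poly_families X"
proof (rule poly_familiesI[of _ _ 0])
  show "(\<lambda>x. coeff [:f x:] i) \<in> poly_functions X" for i
    using assms by (cases i) (auto intro: poly_functions.intros)
qed simp

lemma poly_families_add:
  assumes "F \<in> poly_families X" "G \<in> poly_families X"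
  shows "(\<lambda>x. F x + G x) \<in> poly_families X"
proof -
  obtain d where d: "\<And>x. degree (F x) \<le> d" by (rule poly_families_degree[OF assms(1)]) blast
  obtain e where e: "\<And>x. degree (G x) \<le> e" by (rule poly_families_degree[OF assms(2)]) blast
  show ?thesis
  proof (rule poly_familiesI[of _ _ "max d e"])
    show "degree (F x + G x) \<le> max d e" for x
      using d[of x] e[of x] by (intro degree_add_le) auto
  qed (auto intro!: poly_functions.add poly_families_coeff assms)
qed

lemma poly_families_mult:
  assumes "F \<in> poly_families X" "G \<in> poly_families X"
  shows "(\<lambda>x. F x * G x) \<in> poly_families X"
proof -
  obtain d where d: "\<And>x. degree (F x) \<le> d" by (rule poly_families_degree[OF assms(1)]) blast
  obtain e where e: "\<And>x. degree (G x) \<le> e" by (rule poly_families_degree[OF assms(2)]) blast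
  show ?thesis
  proof (rule poly_familiesI[of _ _ "d + e"])
    show "degree (F x * G x) \<le> d + e" for x
      using degree_mult_le[of "F x" "G x"] d[of x] e[of x] by linarith
  qed (auto simp: coeff_mult intro!: poly_functions_sum poly_functions.mult poly_families_coeff assms)
qed

lemma poly_families_sum:
  assumes "finite I" "\<And>i. i \<in> I \<Longrightarrow> F i \<in> poly_families X"
  shows "(\<lambda>x. \<Sum>i\<in>I. F i x) \<in> poly_families X"
  using assms by (induction I) (auto intro: poly_families_const[of 0, simplified] poly_families_add)

text \<open>The multipliers \<open>u\<close> do not depend on the point: a linear combination found at one point then makes sense
at all points and keeps vanishing at the common zeros.\<close>

inductive_set family_ideal :: "('a \<Rightarrow> complex poly) set \<Rightarrow> ('a \<Rightarrow> complex poly) set"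
  for P where
  zero: "(\<lambda>_. 0) \<in> family_ideal P"
| add: "F \<in> P \<Longrightarrow> G \<in> family_ideal P \<Longrightarrow> (\<lambda>x. u * F x + G x) \<in> family_ideal P"

lemma family_ideal_base: "F \<in> P \<Longrightarrow> F \<in> family_ideal P"
  using family_ideal.add[of F P "\<lambda>_. 0" 1] family_ideal.zero[of P] by simp

lemma family_ideal_closed:
  assumes "F \<in> family_ideal P" "G \<in> family_ideal P"
  shows "(\<lambda>x. u * F x + G x) \<in> family_ideal P"
  using assms(1)
proof (induction)
  case zero
  then show ?case using assms(2) by simp
next
  case (add F F' v)
  from family_ideal.add[OF add.hyps(1) add.IH, of "u * v"]
  show ?case by (simp add: algebra_simps)
qed

lemma family_ideal_vanishes:
  assumes "F \<in> family_ideal P" "\<forall>G\<in>P. poly (G x) t = 0"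
  shows "poly (F x) t = 0"
  using assms by (induction) auto

lemma family_ideal_poly_families:
  assumes "F \<in> family_ideal P" "P \<subseteq> poly_families X"
  shows "F \<in> poly_families X"
  using assms
  by (induction)
    (auto intro!: poly_families_const poly_families_add poly_families_mult)

text \<open>Bezout's identity together with the fundamental theorem of algebra: evaluated at \<open>x\<close>, the ideal is
generated by an element of least degree, and a non-constant generator would have a root, which is
excluded.\<close>

lemma family_ideal_one:
  assumes no_zero: "\<And>t. \<exists>F\<in>P. poly (F x) t \<noteq> 0"
  shows "\<exists>F \<in> family_ideal P. F x = 1"
proof -
  define A where "A = {F \<in> family_ideal P. F x \<noteq> 0}"
  obtain F1 where "F1 \<in> P" "poly (F1 x) 0 \<noteq> 0" using no_zero by blast
  then have "F1 \<in> A" unfolding A_def using family_ideal_base by auto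
  then obtain F where F: "F \<in> A" and min: "\<And>G. G \<in> A \<Longrightarrow> degree (F x) \<le> degree (G x)"
    using ex_has_least_nat[of "\<lambda>F. F \<in> A" F1 "\<lambda>F. degree (F x)"] by blast
  have dvd: "F x dvd G x" if G: "G \<in> P" for G
  proof (rule ccontr)
    assume nd: "\<not> F x dvd G x"
    define R where "R = (\<lambda>y. (- (G x div F x)) * F y + G y)"
    have R: "R \<in> family_ideal P"
      unfolding R_def using F G by (intro family_ideal_closed) (auto simp: A_def family_ideal_base)
    have Rx: "R x = G x mod F x"
      unfolding R_def by (simp add: minus_div_mult_eq_mod[symmetric])
    have "R x \<noteq> 0" using nd Rx by (simp add: mod_eq_0_iff_dvd)
    then have "R \<in> A" using R A_def by auto
    from min[OF this] \<open>R x \<noteq> 0\<close> Rx show False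
      using degree_mod_less'[of "F x" "G x"] F by (auto simp: A_def)
  qed
  have "degree (F x) = 0"
  proof (rule ccontr)
    assume "degree (F x) \<noteq> 0"
    then have "\<not> constant (poly (F x))" by (simp add: constant_degree)
    then obtain t where "poly (F x) t = 0" using fundamental_theorem_of_algebra by blast
    then have "\<forall>G\<in>P. poly (G x) t = 0" using dvd by (metis dvdE mult_zero_left poly_mult)
    then show False using no_zero by blast
  qed
  then obtain c where c: "F x = [:c:]" "c \<noteq> 0"
    using F by (auto simp: A_def elim!: degree_eq_zeroE)
  have "(\<lambda>y. [:inverse c:] * F y + 0) \<in> family_ideal P"
    by (rule family_ideal_closed[OF _ family_ideal.zero]) (use F A_def in blast)
  then show ?thesis using c by (intro bexI[of _ "\<lambda>y. [:inverse c:] * F y + 0"]) (auto simp: one_pCons)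
qed

lemma det_poly_functions:
  assumes "\<And>i j. i < N \<Longrightarrow> j < N \<Longrightarrow> (\<lambda>x. m x i j) \<in> poly_functions X"
  shows "(\<lambda>x. det (mat N N (\<lambda>(i, j). m x i j))) \<in> poly_functions X"
proof -
  have "(\<lambda>x. det (mat N N (\<lambda>(i, j). m x i j))) =
    (\<lambda>x. \<Sum>\<pi> | \<pi> permutes {0..<N}. signof \<pi> * (\<Prod>i = 0..<N. m x i (\<pi> i)))"
    by (rule ext, subst det_def'[of _ N]) (auto intro!: sum.cong prod.cong simp: permutes_in_image)
  also have "\<dots> \<in> poly_functions X"
    by (intro poly_functions_sum poly_functions.mult poly_functions.const poly_functions_prod assms)
      (auto simp: finite_permutations permutes_in_image)
  finally show ?thesis .
qed

text \<open>The families \<open>P\<close> and \<open>Q\<close> describe one closed subset of the product with the projective line in the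
two affine charts, with coordinates \<open>t\<close> and \<open>1/t\<close>; the set in question is its projection.

At a point \<open>x0\<close> outside the projection, Bezout's identity provides combinations \<open>F\<close> and \<open>G\<close> of the two
families with value \<open>1\<close> at \<open>x0\<close>. Homogenized and multiplied by the variable that vanishes at the
point missing from its chart, \<open>F\<close> and \<open>G\<close> become binary forms that vanish on the closed set, and at
\<open>x0\<close> these forms are powers of the two variables. Multiplied by monomials they yield as many forms of
one degree as there are monomials, with coefficient matrix \<open>M x\<close>. This matrix is the identity at
\<open>x0\<close>, whereas at a point of the projection a common zero of the forms gives a vector of
monomials in its kernel. So \<open>det (M x)\<close> is the separating function.\<close>

theorem line_projection_closed:
  fixes P Q :: "('a \<Rightarrow> complex poly) set"
  assumes P: "P \<subseteq> poly_families X" and Q: "Q \<subseteq> poly_families X"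
    and glue1: "\<And>x t. x \<in> V \<Longrightarrow> t \<noteq> 0 \<Longrightarrow> \<forall>F\<in>P. poly (F x) t = 0 \<Longrightarrow> \<forall>F\<in>Q. poly (F x) (1 / t) = 0"
    and glue2: "\<And>x t. x \<in> V \<Longrightarrow> t \<noteq> 0 \<Longrightarrow> \<forall>F\<in>Q. poly (F x) (1 / t) = 0 \<Longrightarrow> \<forall>F\<in>P. poly (F x) t = 0"
  shows "zariski_closed X V
    {x \<in> V. (\<exists>t. \<forall>F\<in>P. poly (F x) t = 0) \<or> (\<forall>F\<in>Q. poly (F x) 0 = 0)}" (is "zariski_closed X V ?S")
proof (rule zariski_closedI)
  fix x0 assume x0: "x0 \<in> V" "x0 \<notin> ?S"
  have noP: "\<exists>F\<in>P. poly (F x0) t \<noteq> 0" for t using x0 by blast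
  have noQ: "\<exists>F\<in>Q. poly (F x0) s \<noteq> 0" for s
  proof (cases "s = 0")
    case False
    then show ?thesis using glue2[OF x0(1), of "1 / s"] noP[of "1 / s"] by auto
  qed (use x0 in blast)
  obtain F where F: "F \<in> family_ideal P" "F x0 = 1" using family_ideal_one[OF noP] by blast
  obtain G where G: "G \<in> family_ideal Q" "G x0 = 1" using family_ideal_one[OF noQ] by blast
  have PF: "F \<in> poly_families X" "G \<in> poly_families X"
    using family_ideal_poly_families F G P Q by blast+
  obtain d where d: "\<And>x. degree (F x) \<le> d" by (rule poly_families_degree[OF PF(1)]) blast
  obtain e where e: "\<And>x. degree (G x) \<le> e" by (rule poly_families_degree[OF PF(2)]) blast
  \<comment> \<open>The forms made from \<open>F\<close> and \<open>G\<close> have degrees \<open>d + 1\<close> and \<open>e + 1\<close>; they are multiplied up to degree \<open>N - 1 = d + e + 1\<close>.\<close>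
  define N where "N = d + e + 2"
  define m where "m = (\<lambda>x i j. if i \<le> e then (if i \<le> j then coeff (F x) (j - i) else 0)
                         else (if j \<le> i then coeff (G x) (i - j) else 0))"
  define M where "M = (\<lambda>x. mat N N (\<lambda>(i, j). m x i j))"
  have Mc: "M x \<in> carrier_mat N N" for x by (simp add: M_def)
  have pol: "(\<lambda>x. det (M x)) \<in> poly_functions X"
    unfolding M_def
  proof (rule det_poly_functions)
    show "(\<lambda>x. m x i j) \<in> poly_functions X" for i j
      unfolding m_def by (cases "i \<le> e"; cases "i \<le> j"; cases "j \<le> i")
        (simp_all add: poly_families_coeff PF poly_functions.const)
  qed
  have "M x0 = 1\<^sub>m N"
    unfolding M_def by (rule eq_matI) (auto simp: m_def F G coeff_1)
  then have ne: "det (M x0) \<noteq> 0" by simp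
  have row: "row (M x) i \<bullet> vec N w = (\<Sum>j = 0..<N. m x i j * w j)" if "i < N" for x i w
    unfolding M_def using that by (simp add: scalar_prod_def)
  have kernel: "det (M x) = 0" if w: "\<And>i. i < N \<Longrightarrow> (\<Sum>j = 0..<N. m x i j * w j) = 0"
      and k: "k < N" "w k \<noteq> 0" for x w k
  proof -
    have "M x *\<^sub>v vec N w = 0\<^sub>v N"
      by (rule eq_vecI) (use Mc[of x] row w in auto)
    moreover have "vec N w \<noteq> 0\<^sub>v N" using k by (metis index_vec index_zero_vec(1))
    ultimately show ?thesis
      using det_0_iff_vec_prod_zero_field[OF Mc[of x]] by (metis vec_carrier)
  qed
  have "det (M x) = 0" if "x \<in> ?S" for x
  proof -
    from that have xV: "x \<in> V" by simp
    from that consider (t) t where "\<forall>F\<in>P. poly (F x) t = 0" | (inf) "\<forall>F\<in>Q. poly (F x) 0 = 0"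
      by blast
    then show ?thesis
    proof cases
      case (t t)
      have Ft: "poly (F x) t = 0" using family_ideal_vanishes[OF F(1)] t by blast
      have Gt: "poly (G x) (1 / t) = 0" if "t \<noteq> 0"
        using family_ideal_vanishes[OF G(1)] glue1[OF xV that] t by blast
      show ?thesis
      \<comment> \<open>the monomials of degree \<open>N - 1\<close> at the point \<open>(t, 1)\<close>\<close>
      proof (rule kernel[of _ "\<lambda>j. t ^ j" 0])
        fix i assume i: "i < N"
        show "(\<Sum>j = 0..<N. m x i j * t ^ j) = 0"
        proof (cases "i \<le> e")
          case True
          have "(\<Sum>j = 0..<N. m x i j * t ^ j) = (\<Sum>j\<in>{i..i+d}. coeff (F x) (j - i) * t ^ j)"
          proof (rule sum.mono_neutral_cong_right)
            show "\<forall>j\<in>{0..<N} - {i..i + d}. m x i j * t ^ j = 0"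
              using True d[of x] by (auto simp: m_def intro!: coeff_eq_0)
          qed (use True in \<open>auto simp: N_def m_def\<close>)
          also have "\<dots> = (\<Sum>k\<le>d. coeff (F x) k * t ^ (k + i))"
            by (rule sum.reindex_bij_witness[of _ "\<lambda>k. k + i" "\<lambda>j. j - i"]) auto
          also have "\<dots> = t ^ i * (\<Sum>k\<le>d. coeff (F x) k * t ^ k)"
            by (simp add: sum_distrib_left power_add algebra_simps)
          also have "(\<Sum>k\<le>d. coeff (F x) k * t ^ k) = poly (F x) t"
            unfolding poly_altdef using d[of x]
            by (intro sum.mono_neutral_right) (auto intro: coeff_eq_0)
          finally show ?thesis using Ft by simp
        next
          case False
          have vanish: "coeff (G x) i = 0" using False e[of x] by (auto intro!: coeff_eq_0)
          have "(\<Sum>j = 0..<N. m x i j * t ^ j) = (\<Sum>j\<in>{..i}. coeff (G x) (i - j) * t ^ j)"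
            using i False by (intro sum.mono_neutral_cong_right) (auto simp: m_def)
          also have "\<dots> = (\<Sum>k\<le>i. coeff (G x) k * t ^ (i - k))"
            by (rule sum.reindex_bij_witness[of _ "\<lambda>k. i - k" "\<lambda>j. i - j"]) auto
          also have "\<dots> = 0"
          proof (cases "t = 0")
            case True
            then show ?thesis using vanish by (auto intro!: sum.neutral simp: power_0_left)
          next
            case t0: False
            have "(\<Sum>k\<le>i. coeff (G x) k * t ^ (i - k)) = t ^ i * (\<Sum>k\<le>i. coeff (G x) k * (1 / t) ^ k)"
              using t0 by (simp add: sum_distrib_left power_diff power_divide field_simps)
            also have "(\<Sum>k\<le>i. coeff (G x) k * (1 / t) ^ k) = poly (G x) (1 / t)"
              unfolding poly_altdef using e[of x] False
              by (intro sum.mono_neutral_right) (auto intro: coeff_eq_0)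
            finally show ?thesis using Gt[OF t0] by simp
          qed
          finally show ?thesis .
        qed
      qed (auto simp: N_def)
    next
      case inf
      have G0: "coeff (G x) 0 = 0"
        using family_ideal_vanishes[OF G(1) inf] by (simp add: poly_0_coeff_0)
      show ?thesis
      \<comment> \<open>the monomials of degree \<open>N - 1\<close> at the point \<open>(1, 0)\<close>\<close>
      proof (rule kernel[of _ "\<lambda>j. if j = N - 1 then 1 else 0" "N - 1"])
        fix i assume i: "i < N"
        have "(\<Sum>j = 0..<N. m x i j * (if j = N - 1 then 1 else 0)) = m x i (N - 1)"
          by (subst sum.remove[of _ "N - 1"]) (auto simp: N_def)
        also have "\<dots> = 0"
          using i G0 d[of x] by (auto simp: m_def N_def intro!: coeff_eq_0)
        finally show "(\<Sum>j = 0..<N. m x i j * (if j = N - 1 then 1 else 0)) = 0" .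
      qed (auto simp: N_def)
    qed
  qed
  then show "\<exists>f \<in> poly_functions X. (\<forall>s\<in>?S. f s = 0) \<and> f x0 \<noteq> 0"
    using pol ne by (intro bexI[of _ "\<lambda>x. det (M x)"]) auto
qed auto

section \<open>Completeness of the flag variety\<close>

lemma SL_carrier_iff: "A \<in> carrier (SL n) \<longleftrightarrow> A \<in> carrier_mat n n \<and> det A = 1"
  by (simp add: SL_def)

lemma SL_carrier_mat: "A \<in> carrier (SL n) \<Longrightarrow> A \<in> carrier_mat n n"
  by (simp add: SL_def)

lemma SL_mult_closed: "A \<in> carrier (SL n) \<Longrightarrow> B \<in> carrier (SL n) \<Longrightarrow> A * B \<in> carrier (SL n)"
  by (auto simp: SL_def det_mult)

lemma SL_one_closed: "1\<^sub>m n \<in> carrier (SL n)"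
  by (simp add: SL_def)

lemma SL_inverse:
  assumes "A \<in> carrier (SL n)"
  obtains B where "B \<in> carrier (SL n)" "A * B = 1\<^sub>m n" "B * A = 1\<^sub>m n"
proof -
  have A: "A \<in> carrier_mat n n" "det A = 1" using assms by (auto simp: SL_def)
  note adj = adj_mat[OF A(1)]
  have one: "A * adj_mat A = 1\<^sub>m n" "adj_mat A * A = 1\<^sub>m n" using adj A(2) by auto
  have "det A * det (adj_mat A) = 1" using det_mult[OF A(1) adj(1)] one by simp
  then show thesis using that[of "adj_mat A"] A adj(1) one by (auto simp: SL_def)
qed

abbreviation SL_affine :: "nat \<Rightarrow> nat \<Rightarrow> (complex mat \<times> complex vec) set" where
  "SL_affine n m \<equiv> carrier (SL n) \<times> carrier_vec m"

abbreviation SL_affine_closed :: "nat \<Rightarrow> nat \<Rightarrow> (complex mat \<times> complex vec) set \<Rightarrow> bool" where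
  "SL_affine_closed n m \<equiv> zariski_closed (mat_vec_coords n m) (SL_affine n m)"

text \<open>Pulling a polynomial function back along a curve of right translations gives a polynomial
family in the parameter of the curve.\<close>

lemma mat_family_pullback:
  fixes K :: "nat \<Rightarrow> nat \<Rightarrow> complex poly"
  assumes "f \<in> poly_functions (mat_vec_coords n m)"
  shows "\<exists>F \<in> poly_families (mat_vec_coords n m). \<forall>A \<in> carrier_mat n n. \<forall>y t.
    poly (F (A, y)) t = f (A * mat n n (\<lambda>(r, s). poly (K r s) t), y)"
proof -
  let ?X = "mat_vec_coords n m"
  let ?pulls = "\<lambda>F f. F \<in> poly_families ?X \<and> (\<forall>A \<in> carrier_mat n n. \<forall>y t.
    poly (F (A, y)) t = f (A * mat n n (\<lambda>(r, s). poly (K r s) t), y))"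
  have "\<exists>F. ?pulls F f"
    using assms
  proof (induction)
    case (const c)
    show ?case by (intro exI[of _ "\<lambda>_. [:c:]"]) (simp add: poly_families_const)
  next
    case (coord f)
    then consider (mat) r s where "r < n" "s < n" "f = (\<lambda>A. A $$ (r, s)) \<circ> fst"
      | (vec) k where "f = (\<lambda>y. y $ k) \<circ> snd" "k < m"
      by (auto simp: mat_vec_coords_def mat_coords_def vec_coords_def)
    then show ?case
    proof cases
      case mat
      define F where "F = (\<lambda>x :: complex mat \<times> complex vec. \<Sum>l = 0..<n. [:fst x $$ (r, l):] * K l s)"
      have "(\<lambda>x. fst x $$ (r, l)) \<in> poly_functions ?X" if "l < n" for l
        using that mat by (intro poly_functions.coord)
          (auto simp: mat_vec_coords_def mat_coords_def comp_def)
      then have "F \<in> poly_families ?X"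
        unfolding F_def
        by (intro poly_families_sum poly_families_mult poly_families_const poly_families_coord) auto
      moreover have "poly (F (A, y)) t = f (A * mat n n (\<lambda>(r, s). poly (K r s) t), y)"
        if "A \<in> carrier_mat n n" for A y t
        using that mat by (simp add: F_def poly_sum scalar_prod_def)
      ultimately show ?thesis by blast
    next
      case vec
      have "(\<lambda>x. snd x $ k) \<in> poly_functions ?X"
        using vec by (intro poly_functions.coord)
          (auto simp: mat_vec_coords_def vec_coords_def comp_def)
      then show ?thesis
        using vec by (intro exI[of _ "\<lambda>x. [:snd x $ k:]"]) (simp add: poly_families_coord)
    qed
  next
    case (add f g)
    then obtain F G where "?pulls F f" "?pulls G g" by blast
    then show ?case by (intro exI[of _ "\<lambda>x. F x + G x"]) (simp add: poly_families_add)
  next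
    case (mult f g)
    then obtain F G where "?pulls F f" "?pulls G g" by blast
    then show ?case by (intro exI[of _ "\<lambda>x. F x * G x"]) (simp add: poly_families_mult)
  qed
  then show ?thesis by blast
qed

lemma closed_set_family_pullback:
  fixes K :: "nat \<Rightarrow> nat \<Rightarrow> complex poly"
  assumes W: "SL_affine_closed n m W"
    and K: "\<And>t. mat n n (\<lambda>(r, s). poly (K r s) t) \<in> carrier (SL n)"
  obtains P where "P \<subseteq> poly_families (mat_vec_coords n m)"
    "\<And>A y t. (A, y) \<in> SL_affine n m \<Longrightarrow>
       (\<forall>F\<in>P. poly (F (A, y)) t = 0) \<longleftrightarrow> (A * mat n n (\<lambda>(r, s). poly (K r s) t), y) \<in> W"
proof -
  let ?K = "\<lambda>t. mat n n (\<lambda>(r, s). poly (K r s) t)"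
  obtain E where E: "E \<subseteq> poly_functions (mat_vec_coords n m)" "W = {x \<in> SL_affine n m. \<forall>f\<in>E. f x = 0}"
    using W unfolding zariski_closed_def by blast
  define P where "P = {F \<in> poly_families (mat_vec_coords n m). \<exists>f\<in>E. \<forall>A\<in>carrier_mat n n. \<forall>y t.
      poly (F (A, y)) t = f (A * ?K t, y)}"
  have "(\<forall>F\<in>P. poly (F (A, y)) t = 0) \<longleftrightarrow> (A * ?K t, y) \<in> W"
    if x: "(A, y) \<in> SL_affine n m" for A y t
  proof -
    have A: "A \<in> carrier_mat n n" using x SL_carrier_mat by blast
    have "(A * ?K t, y) \<in> SL_affine n m" using x K SL_mult_closed by auto
    then have "(A * ?K t, y) \<in> W \<longleftrightarrow> (\<forall>f\<in>E. f (A * ?K t, y) = 0)" using E by auto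
    also have "\<dots> \<longleftrightarrow> (\<forall>F\<in>P. poly (F (A, y)) t = 0)"
    proof
      assume R: "\<forall>F\<in>P. poly (F (A, y)) t = 0"
      show "\<forall>f\<in>E. f (A * ?K t, y) = 0"
      proof
        fix f assume f: "f \<in> E"
        then obtain F where F: "F \<in> poly_families (mat_vec_coords n m)" "\<forall>A\<in>carrier_mat n n. \<forall>y t.
          poly (F (A, y)) t = f (A * ?K t, y)"
          using mat_family_pullback[of f n m K] E(1) by blast
        then have "F \<in> P" using f unfolding P_def by blast
        then show "f (A * ?K t, y) = 0" using R F A by metis
      qed
    next
      assume L: "\<forall>f\<in>E. f (A * ?K t, y) = 0"
      show "\<forall>F\<in>P. poly (F (A, y)) t = 0"
        using L A unfolding P_def by force
    qed
    finally show ?thesis by simp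
  qed
  moreover have "P \<subseteq> poly_families (mat_vec_coords n m)" unfolding P_def by blast
  ultimately show thesis using that by blast
qed

lemma right_translate_closed:
  assumes W: "SL_affine_closed n m W" and g: "g \<in> carrier (SL n)"
  shows "SL_affine_closed n m {(A, y) \<in> SL_affine n m. (A * g, y) \<in> W}"
proof -
  define K where "K = (\<lambda>r s. [:g $$ (r, s):])"
  have K: "mat n n (\<lambda>(r, s). poly (K r s) t) = g" for t
    using SL_carrier_mat[OF g] unfolding K_def by (intro eq_matI) auto
  obtain P where P: "P \<subseteq> poly_families (mat_vec_coords n m)"
    "\<And>A y t. (A, y) \<in> SL_affine n m \<Longrightarrow> (\<forall>F\<in>P. poly (F (A, y)) t = 0) \<longleftrightarrow> (A * g, y) \<in> W"
    using closed_set_family_pullback[OF W, of K] g unfolding K by metis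
  have *: "{(A, y) \<in> SL_affine n m. (A * g, y) \<in> W} =
    {x \<in> SL_affine n m. \<forall>f\<in>(\<lambda>F x. coeff (F x) 0) ` P. f x = 0}"
    using P(2)[where t = 0] by (auto simp: poly_0_coeff_0)
  have "(\<lambda>F x. coeff (F x) 0) ` P \<subseteq> poly_functions (mat_vec_coords n m)"
    using P(1) poly_families_coeff by blast
  then show ?thesis unfolding zariski_closed_def using * by blast
qed

text \<open>The embedding of 2 by 2 matrices at the positions \<open>i\<close> and \<open>i + 1\<close>.\<close>

definition block_mat :: "nat \<Rightarrow> nat \<Rightarrow> complex \<Rightarrow> complex \<Rightarrow> complex \<Rightarrow> complex \<Rightarrow> complex mat" where
  "block_mat n i a b c d = mat n n (\<lambda>(r, s).
     if r = i \<and> s = i then a else if r = i \<and> s = Suc i then b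
     else if r = Suc i \<and> s = i then c else if r = Suc i \<and> s = Suc i then d
     else if r = s then 1 else 0)"

lemma block_mat_carrier [simp]: "block_mat n i a b c d \<in> carrier_mat n n"
  by (simp add: block_mat_def)

lemma block_mat_dim [simp]: "dim_row (block_mat n i a b c d) = n" "dim_col (block_mat n i a b c d) = n"
  by (simp_all add: block_mat_def)

lemma block_mat_index:
  "r < n \<Longrightarrow> s < n \<Longrightarrow> block_mat n i a b c d $$ (r, s) =
    (if r = i \<and> s = i then a else if r = i \<and> s = Suc i then b
     else if r = Suc i \<and> s = i then c else if r = Suc i \<and> s = Suc i then d
     else if r = s then 1 else 0)"
  by (simp add: block_mat_def)

lemma mult_block_mat_index:
  assumes A: "A \<in> carrier_mat n n" and i: "Suc i < n" and r: "r < n" and s: "s < n"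
  shows "(A * block_mat n i a b c d) $$ (r, s) =
    (if s = i then A $$ (r, i) * a + A $$ (r, Suc i) * c
     else if s = Suc i then A $$ (r, i) * b + A $$ (r, Suc i) * d else A $$ (r, s))"
proof -
  have "(A * block_mat n i a b c d) $$ (r, s) = (\<Sum>l = 0..<n. A $$ (r, l) * block_mat n i a b c d $$ (l, s))"
    using A r s by (simp add: scalar_prod_def)
  also have "\<dots> = (\<Sum>l\<in>(if s = i \<or> s = Suc i then {i, Suc i} else {s}). A $$ (r, l) * block_mat n i a b c d $$ (l, s))"
    using i s by (intro sum.mono_neutral_right) (simp_all add: block_mat_index)
  finally show ?thesis using i s by (simp add: block_mat_index)
qed

lemma block_mat_mult_index:
  assumes A: "A \<in> carrier_mat n n" and i: "Suc i < n" and r: "r < n" and s: "s < n"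
  shows "(block_mat n i a b c d * A) $$ (r, s) =
    (if r = i then a * A $$ (i, s) + b * A $$ (Suc i, s)
     else if r = Suc i then c * A $$ (i, s) + d * A $$ (Suc i, s) else A $$ (r, s))"
proof -
  have "(block_mat n i a b c d * A) $$ (r, s) = (\<Sum>l = 0..<n. block_mat n i a b c d $$ (r, l) * A $$ (l, s))"
    using A r s by (simp add: scalar_prod_def)
  also have "\<dots> = (\<Sum>l\<in>(if r = i \<or> r = Suc i then {i, Suc i} else {r}). block_mat n i a b c d $$ (r, l) * A $$ (l, s))"
    using i r by (intro sum.mono_neutral_right) (simp_all add: block_mat_index)
  finally show ?thesis using i r by (simp add: block_mat_index)
qed

lemma block_mat_mult:
  assumes "Suc i < n"
  shows "block_mat n i a b c d * block_mat n i a' b' c' d' =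
    block_mat n i (a * a' + b * c') (a * b' + b * d') (c * a' + d * c') (c * b' + d * d')" (is "?L = ?R")
proof (rule eq_matI)
  fix r s assume "r < dim_row ?R" "s < dim_col ?R"
  then have rs: "r < n" "s < n" by simp_all
  show "?L $$ (r, s) = ?R $$ (r, s)"
    unfolding mult_block_mat_index[OF block_mat_carrier assms rs]
    using assms rs
    by (cases "r = i"; cases "r = Suc i"; cases "s = i"; cases "s = Suc i") (simp_all add: block_mat_index)
qed simp_all

lemma block_mat_one: "block_mat n i 1 0 0 1 = 1\<^sub>m n"
proof (rule eq_matI)
  fix r s assume "r < dim_row (1\<^sub>m n)" "s < dim_col (1\<^sub>m n)"
  then have "r < n" "s < n" by simp_all
  then show "block_mat n i 1 0 0 1 $$ (r, s) = 1\<^sub>m n $$ (r, s)"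
    by (cases "r = s") (simp_all add: block_mat_index)
qed simp_all

lemma det_block_mat_upper:
  assumes i: "Suc i < n"
  shows "det (block_mat n i a b 0 d) = a * d"
proof -
  have "det (block_mat n i a b 0 d) = prod_list (diag_mat (block_mat n i a b 0 d))"
    by (rule det_upper_triangular[of _ n]) (simp_all add: upper_triangular_def block_mat_index)
  also have "\<dots> = (\<Prod>j = 0..<n. block_mat n i a b 0 d $$ (j, j))"
    by (simp add: diag_mat_def prod.distinct_set_conv_list[symmetric])
  also have "\<dots> = (\<Prod>j\<in>{i, Suc i}. block_mat n i a b 0 d $$ (j, j))"
    using i by (intro prod.mono_neutral_right) (simp_all add: block_mat_index)
  finally show ?thesis using i by (simp add: block_mat_index)
qed

lemma det_block_mat_lower:
  assumes i: "Suc i < n"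
  shows "det (block_mat n i 1 0 c 1) = 1"
proof -
  have "block_mat n i 1 0 c 1 = transpose_mat (block_mat n i 1 c 0 1)"
    by (rule eq_matI) (simp_all add: block_mat_index)
  then show ?thesis using det_transpose[of "block_mat n i 1 c 0 1" n] det_block_mat_upper[OF i] by simp
qed

text \<open>The first columns \<open>(t, 1)\<close> of these 2 by 2 blocks run through all points of the projective line
except \<open>(1, 0)\<close>, which belongs to the identity matrix.\<close>

abbreviation line_mat :: "nat \<Rightarrow> nat \<Rightarrow> complex \<Rightarrow> complex mat" where
  "line_mat n i t \<equiv> block_mat n i t (-1) 1 0"

text \<open>A product of three unipotent blocks, whose determinants are evident.\<close>

lemma line_mat_SL:
  assumes i: "Suc i < n" shows "line_mat n i t \<in> carrier (SL n)"
proof -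
  have "line_mat n i t = block_mat n i 1 (t - 1) 0 1 * (block_mat n i 1 0 1 1 * block_mat n i 1 (-1) 0 1)"
    by (simp add: block_mat_mult[OF i])
  also have "det \<dots> = 1"
    using det_block_mat_upper[OF i] det_block_mat_lower[OF i]
    by (simp add: det_mult[of _ n] mult_carrier_mat[of _ n n])
  finally show ?thesis by (simp add: SL_carrier_iff)
qed

definition upper_SL :: "nat \<Rightarrow> complex mat set" where
  "upper_SL n = {b \<in> carrier (SL n). upper_triangular b}"

lemma upper_SL_diag_nonzero:
  assumes b: "b \<in> upper_SL n" and i: "i < n" shows "b $$ (i, i) \<noteq> 0"
proof
  assume "b $$ (i, i) = 0"
  then have "0 \<in> set (diag_mat b)" using b i by (auto simp: diag_mat_def upper_SL_def SL_carrier_iff intro!: image_eqI[of _ _ i])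
  then have "det b = 0"
    using b det_upper_triangular[of b n] prod_list_zero_iff[of "diag_mat b"]
    by (metis (no_types, lifting) SL_carrier_iff mem_Collect_eq upper_SL_def)
  then show False using b by (auto simp: upper_SL_def SL_carrier_iff)
qed

text \<open>Preimages of subsets of the flag variety.\<close>

definition upper_invariant :: "nat \<Rightarrow> (complex mat \<times> complex vec) set \<Rightarrow> bool" where
  "upper_invariant n W \<longleftrightarrow> (\<forall>A y b. (A, y) \<in> W \<longrightarrow> b \<in> upper_SL n \<longrightarrow> (A * b, y) \<in> W)"

text \<open>For an invariant \<open>W\<close> this is its saturation under the minimal parabolic subgroup generated by the upper triangular
matrices and the \<open>i\<close>-th copy of \<open>SL\<^sub>2\<close>: modulo upper triangular matrices, the elements of
that group are the matrices \<open>line_mat n i t\<close> and the identity.\<close>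

definition sweep :: "nat \<Rightarrow> nat \<Rightarrow> nat \<Rightarrow> (complex mat \<times> complex vec) set \<Rightarrow> (complex mat \<times> complex vec) set" where
  "sweep n m i W = {(A, y) \<in> SL_affine n m. (\<exists>t. (A * line_mat n i t, y) \<in> W) \<or> (A, y) \<in> W}"

text \<open>The sweep is a projection along the projective line. In the chart around the point \<open>(1, 0)\<close> the line is
parametrized by lower unipotent blocks, and the two charts differ by an upper triangular matrix, under
which \<open>W\<close> is invariant.\<close>

lemma sweep_closed:
  assumes i: "Suc i < n"
    and W: "SL_affine_closed n m W" and inv: "upper_invariant n W"
  shows "SL_affine_closed n m (sweep n m i W)"
proof -
  define K where "K = (\<lambda>r s. if r = i \<and> s = i then [:0, 1:] else if r = i \<and> s = Suc i then [:-1:]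
     else if r = Suc i \<and> s = i then 1 else if r = Suc i \<and> s = Suc i then 0
     else if r = s then 1 else (0 :: complex poly))"
  define L where "L = (\<lambda>r s. if r = Suc i \<and> s = i then [:0, 1:] else if r = s then 1 else (0 :: complex poly))"
  have K: "mat n n (\<lambda>(r, s). poly (K r s) t) = line_mat n i t" for t
    unfolding K_def by (rule eq_matI) (simp_all add: block_mat_index)
  have L: "mat n n (\<lambda>(r, s). poly (L r s) t) = block_mat n i 1 0 t 1" for t
    unfolding L_def by (rule eq_matI) (simp_all add: block_mat_index)
  have LSL: "block_mat n i 1 0 t 1 \<in> carrier (SL n)" for t
    by (simp add: SL_carrier_iff det_block_mat_lower[OF i])
  obtain P where P: "P \<subseteq> poly_families (mat_vec_coords n m)"
    "\<And>A y t. (A, y) \<in> SL_affine n m \<Longrightarrow>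
      (\<forall>F\<in>P. poly (F (A, y)) t = 0) \<longleftrightarrow> (A * line_mat n i t, y) \<in> W"
    using closed_set_family_pullback[OF W, of K] line_mat_SL[OF i] unfolding K by metis
  obtain Q where Q: "Q \<subseteq> poly_families (mat_vec_coords n m)"
    "\<And>A y t. (A, y) \<in> SL_affine n m \<Longrightarrow>
      (\<forall>F\<in>Q. poly (F (A, y)) t = 0) \<longleftrightarrow> (A * block_mat n i 1 0 t 1, y) \<in> W"
    using closed_set_family_pullback[OF W, of L] LSL unfolding L by metis
  have glue: "(A * line_mat n i t, y) \<in> W \<longleftrightarrow> (A * block_mat n i 1 0 (1 / t) 1, y) \<in> W"
    if x: "(A, y) \<in> SL_affine n m" and t: "t \<noteq> 0" for A y t
  proof -
    have A: "A \<in> carrier_mat n n" using x SL_carrier_mat by blast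
    have up: "block_mat n i a b 0 d \<in> upper_SL n" if "a * d = 1" for a b d
      using that det_block_mat_upper[OF i] by (simp add: upper_SL_def SL_carrier_iff upper_triangular_def block_mat_index)
    have "A * line_mat n i t = (A * block_mat n i 1 0 (1 / t) 1) * block_mat n i t (-1) 0 (1 / t)"
      using t A by (simp add: assoc_mult_mat[of _ n n _ n _ n] block_mat_mult[OF i])
    moreover have "A * block_mat n i 1 0 (1 / t) 1 = (A * line_mat n i t) * block_mat n i (1 / t) 1 0 t"
      using t A by (simp add: assoc_mult_mat[of _ n n _ n _ n] block_mat_mult[OF i])
    moreover have "block_mat n i t (-1) 0 (1 / t) \<in> upper_SL n" "block_mat n i (1 / t) 1 0 t \<in> upper_SL n"
      using up t by auto
    ultimately show ?thesis using inv unfolding upper_invariant_def by metis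
  qed
  have "SL_affine_closed n m
    {x \<in> SL_affine n m. (\<exists>t. \<forall>F\<in>P. poly (F x) t = 0) \<or> (\<forall>F\<in>Q. poly (F x) 0 = 0)}"
  proof (rule line_projection_closed[OF P(1) Q(1)])
    fix x t assume x: "x \<in> SL_affine n m" and t: "t \<noteq> (0 :: complex)"
    obtain A y where [simp]: "x = (A, y)" by (cases x)
    have *: "(\<forall>F\<in>P. poly (F x) t = 0) \<longleftrightarrow> (\<forall>F\<in>Q. poly (F x) (1 / t) = 0)"
      using P(2) Q(2) glue x t by simp
    show "\<forall>F\<in>P. poly (F x) t = 0 \<Longrightarrow> \<forall>F\<in>Q. poly (F x) (1 / t) = 0"
      "\<forall>F\<in>Q. poly (F x) (1 / t) = 0 \<Longrightarrow> \<forall>F\<in>P. poly (F x) t = 0" using * by blast+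
  qed
  also have "{x \<in> SL_affine n m. (\<exists>t. \<forall>F\<in>P. poly (F x) t = 0) \<or> (\<forall>F\<in>Q. poly (F x) 0 = 0)} = sweep n m i W"
  proof -
    have "A * 1\<^sub>m n = A" if "A \<in> carrier (SL n)" for A using SL_carrier_mat[OF that] by simp
    then have "x \<in> SL_affine n m \<Longrightarrow>
      ((\<exists>t. \<forall>F\<in>P. poly (F x) t = 0) \<or> (\<forall>F\<in>Q. poly (F x) 0 = 0)) \<longleftrightarrow> x \<in> sweep n m i W" for x
      using P(2) Q(2)[where t = 0] by (cases x) (simp add: sweep_def block_mat_one)
    moreover have "sweep n m i W \<subseteq> SL_affine n m" by (auto simp: sweep_def)
    ultimately show ?thesis by blast
  qed
  finally show ?thesis .
qed

text \<open>An upper triangular \<open>b\<close> acts on the projective line by an affine map of \<open>t\<close>, so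
\<open>b\<close> moves \<open>line_mat n i s\<close> to \<open>line_mat n i t\<close> for a suitable \<open>s\<close>, up to an upper triangular factor \<open>c\<close>.\<close>

lemma sweep_invariant:
  assumes i: "Suc i < n" and inv: "upper_invariant n W"
  shows "upper_invariant n (sweep n m i W)"
  unfolding upper_invariant_def
proof (intro allI impI)
  fix A y b assume x: "(A, y) \<in> sweep n m i W" and b: "b \<in> upper_SL n"
  have A: "A \<in> carrier (SL n)" "y \<in> carrier_vec m" using x by (auto simp: sweep_def)
  have bc: "b \<in> carrier (SL n)" "b \<in> carrier_mat n n" using b by (auto simp: upper_SL_def SL_carrier_iff)
  have Ab: "(A * b, y) \<in> SL_affine n m" using A bc SL_mult_closed by auto
  from x consider "(A, y) \<in> W" | t where "(A * line_mat n i t, y) \<in> W" by (auto simp: sweep_def)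
  then show "(A * b, y) \<in> sweep n m i W"
  proof cases
    case 1
    then have "(A * b, y) \<in> W" using inv b by (auto simp: upper_invariant_def)
    then show ?thesis using Ab by (simp add: sweep_def)
  next
    case (2 t)
    have up: "b $$ (r, s) = 0" if "s < r" "r < n" for r s
      using b that by (auto simp: upper_SL_def SL_carrier_iff upper_triangular_def)
    have nz: "b $$ (i, i) \<noteq> 0" using upper_SL_diag_nonzero[OF b, of i] i by simp
    \<comment> \<open>solves \<open>b (s, 1) \<sim> (t, 1)\<close> for the 2 by 2 block of \<open>b\<close>\<close>
    define s where "s = (b $$ (Suc i, Suc i) * t - b $$ (i, Suc i)) / b $$ (i, i)"
    \<comment> \<open>the first factor is the inverse of \<open>line_mat n i t\<close>\<close>
    define c where "c = block_mat n i 0 1 (-1) t * (b * line_mat n i s)"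
    have cc: "c \<in> carrier_mat n n" unfolding c_def using bc by (intro mult_carrier_mat[of _ n n]) auto
    have inv1: "line_mat n i t * block_mat n i 0 1 (-1) t = 1\<^sub>m n"
      using i by (simp add: block_mat_mult block_mat_one)
    have bls: "b * line_mat n i s \<in> carrier_mat n n" using bc by (intro mult_carrier_mat[of _ n n]) auto
    have lc: "line_mat n i t * c = b * line_mat n i s"
    proof -
      have "line_mat n i t * c = (line_mat n i t * block_mat n i 0 1 (-1) t) * (b * line_mat n i s)"
        unfolding c_def using bls by (intro assoc_mult_mat[symmetric]) auto
      then show ?thesis using inv1 left_mult_one_mat[OF bls] by simp
    qed
    have "det (line_mat n i t) * det c = det b * det (line_mat n i s)"
      using lc bc cc by (metis block_mat_carrier det_mult)
    then have "det c = 1" using line_mat_SL[OF i] bc by (simp add: SL_carrier_iff)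
    moreover have "upper_triangular c"
    proof (rule upper_triangularI)
      fix r q assume "q < r" "r < dim_row c"
      then have rq: "q < r" "r < n" using cc by auto
      then show "c $$ (r, q) = 0"
        unfolding c_def using bls i bc up nz
        by (cases "r = i"; cases "r = Suc i"; cases "q = i"; cases "q = Suc i")
          (simp_all add: block_mat_mult_index mult_block_mat_index s_def del: index_mult_mat(1))
    qed
    ultimately have "c \<in> upper_SL n" using cc by (simp add: upper_SL_def SL_carrier_iff)
    then have "(A * line_mat n i t * c, y) \<in> W" using 2 inv by (auto simp: upper_invariant_def)
    moreover have "A * line_mat n i t * c = A * b * line_mat n i s"
      using SL_carrier_mat[OF A(1)] bc cc lc by (simp add: assoc_mult_mat[of _ n n _ n _ n])
    ultimately show ?thesis using Ab by (auto simp: sweep_def)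
  qed
qed

text \<open>Progress of column reduction: the rows below \<open>r\<close> are in upper triangular shape, and in row \<open>r\<close> the
first \<open>c\<close> entries have been cleared. Reduction proceeds from the bottom row upwards, clearing each row from
the left by operations on neighbouring columns.\<close>

definition reduced_from :: "nat \<Rightarrow> nat \<Rightarrow> nat \<Rightarrow> complex mat \<Rightarrow> bool" where
  "reduced_from n r c g \<longleftrightarrow>
    (\<forall>a b. r < a \<longrightarrow> a < n \<longrightarrow> b < a \<longrightarrow> g $$ (a, b) = 0) \<and> (\<forall>b<c. g $$ (r, b) = 0)"

text \<open>The invariant of an induction that runs backwards through column reduction. It starts with \<open>W\<close>, which
absorbs its upper triangular translates; each sweep undoes one column operation, until all translates are
absorbed. The image in the affine space must not grow on the way.\<close>

definition sweep_stage ::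
  "nat \<Rightarrow> nat \<Rightarrow> (complex mat \<times> complex vec) set \<Rightarrow> nat \<Rightarrow> nat \<Rightarrow> (complex mat \<times> complex vec) set \<Rightarrow> bool" where
  "sweep_stage n m W r c S \<longleftrightarrow>
    SL_affine_closed n m S \<and> upper_invariant n S \<and>
    snd ` S \<subseteq> snd ` W \<and>
    (\<forall>A y g. (A, y) \<in> W \<longrightarrow> g \<in> carrier (SL n) \<longrightarrow> reduced_from n r c g \<longrightarrow> (A * g, y) \<in> S)"

lemma sweep_stage_step:
  assumes c: "Suc c \<le> r" and r: "r < n" and WV: "W \<subseteq> SL_affine n m"
    and S: "sweep_stage n m W r (Suc c) S"
  shows "sweep_stage n m W r c (sweep n m c S)"
proof -
  have i: "Suc c < n" using c r by simp
  have Sc: "SL_affine_closed n m S" "upper_invariant n S" "snd ` S \<subseteq> snd ` W"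
    and Sg: "\<And>A y g. (A, y) \<in> W \<Longrightarrow> g \<in> carrier (SL n) \<Longrightarrow> reduced_from n r (Suc c) g \<Longrightarrow> (A * g, y) \<in> S"
    using S unfolding sweep_stage_def by blast+
  have "snd ` sweep n m c S \<subseteq> snd ` S" by (force simp: sweep_def)
  moreover have "(A * g, y) \<in> sweep n m c S"
    if x: "(A, y) \<in> W" and g: "g \<in> carrier (SL n)" and red: "reduced_from n r c g" for A y g
  proof -
    have AV: "A \<in> carrier (SL n)" "y \<in> carrier_vec m" using x WV by auto
    have gc: "g \<in> carrier_mat n n" and Ac: "A \<in> carrier_mat n n" using g AV SL_carrier_mat by auto
    have AgV: "(A * g, y) \<in> SL_affine n m" using AV g SL_mult_closed by auto
    show ?thesis
    proof (cases "g $$ (r, c) = 0")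
      case True
      then have "reduced_from n r (Suc c) g" using red by (auto simp: reduced_from_def less_Suc_eq)
      then show ?thesis using Sg[OF x g] AgV by (simp add: sweep_def)
    next
      case False
      \<comment> \<open>The new column \<open>c\<close> is \<open>t\<close> times the old one plus its right neighbour; \<open>t\<close> clears its entry in row \<open>r\<close>.\<close>
      define t where "t = - g $$ (r, Suc c) / g $$ (r, c)"
      have "reduced_from n r (Suc c) (g * line_mat n c t)"
        using red c r gc i False unfolding reduced_from_def
        by (auto simp: mult_block_mat_index t_def less_Suc_eq simp del: index_mult_mat(1))
      then have "(A * (g * line_mat n c t), y) \<in> S"
        using Sg[OF x SL_mult_closed[OF g line_mat_SL[OF i]]] by blast
      moreover have "A * (g * line_mat n c t) = A * g * line_mat n c t"
        using Ac gc by (simp add: assoc_mult_mat[of _ n n _ n _ n])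
      ultimately show ?thesis using AgV by (auto simp: sweep_def)
    qed
  qed
  ultimately show ?thesis
    using sweep_closed[OF i Sc(1,2)] sweep_invariant[OF i Sc(2)] Sc(3)
    unfolding sweep_stage_def by blast
qed

lemma sweep_stage_exists:
  assumes W: "SL_affine_closed n m W" and inv: "upper_invariant n W"
    and "r < n"
  shows "\<exists>S. sweep_stage n m W r 0 S"
  using assms(3)
proof (induction r)
  case 0
  have "sweep_stage n m W 0 0 W"
    using W inv by (auto simp: sweep_stage_def reduced_from_def upper_invariant_def upper_SL_def
        SL_carrier_iff upper_triangular_def)
  then show ?case by blast
next
  case (Suc r)
  then obtain S where S: "sweep_stage n m W r 0 S" by auto
  have "reduced_from n r 0 g" if "reduced_from n (Suc r) (Suc r) g" for g
    using that by (auto simp: reduced_from_def) (metis Suc_lessI)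
  then have "sweep_stage n m W (Suc r) (Suc r) S"
    using S unfolding sweep_stage_def by blast
  then have base: "\<exists>S. sweep_stage n m W (Suc r) (Suc r) S" by blast
  have "0 \<le> Suc r" by simp
  then show ?case
  proof (induction rule: inc_induct)
    case base
    show ?case by (fact \<open>\<exists>S. sweep_stage n m W (Suc r) (Suc r) S\<close>)
  next
    case (step c)
    then show ?case
      using sweep_stage_step[of c "Suc r" n W m] Suc.prems zariski_closed_subset[OF W] by auto
  qed
qed

text \<open>The last sweep absorbs all translates, so \<open>y\<close> lies in the image of \<open>W\<close> iff \<open>(1, y)\<close> lies in the last sweep,
which is a closed condition on \<open>y\<close>.\<close>

theorem flag_projection_closed:
  assumes n: "n > 0"
    and W: "SL_affine_closed n m W" and inv: "upper_invariant n W"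
  shows "zariski_closed (vec_coords m) (carrier_vec m) (snd ` W)"
proof -
  obtain S where S: "sweep_stage n m W (n - 1) 0 S"
    using sweep_stage_exists[OF W inv, of "n - 1"] n by auto
  have all: "(A * g, y) \<in> S" if "(A, y) \<in> W" "g \<in> carrier (SL n)" for A y g
  proof -
    have "reduced_from n (n - 1) 0 g" by (auto simp: reduced_from_def)
    then show ?thesis using S that unfolding sweep_stage_def by blast
  qed
  obtain E where E: "E \<subseteq> poly_functions (mat_vec_coords n m)" "S = {x \<in> SL_affine n m. \<forall>f\<in>E. f x = 0}"
    using S unfolding sweep_stage_def zariski_closed_def by blast
  have "(\<lambda>y. f (1\<^sub>m n, y)) \<in> poly_functions (vec_coords m)" if "f \<in> poly_functions (mat_vec_coords n m)" for f
    using that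
  proof (induction)
    case (coord f)
    then show ?case
      by (auto simp: mat_vec_coords_def mat_coords_def intro: poly_functions.intros)
  qed (auto intro: poly_functions.intros)
  then have "(\<lambda>f y. f (1\<^sub>m n, y)) ` E \<subseteq> poly_functions (vec_coords m)" using E by blast
  moreover have "snd ` W = {y \<in> carrier_vec m. \<forall>f\<in>(\<lambda>f y. f (1\<^sub>m n, y)) ` E. f y = 0}"
  proof -
    have "y \<in> snd ` W \<longleftrightarrow> (1\<^sub>m n, y) \<in> S" for y
    proof
      assume "y \<in> snd ` W"
      then obtain A where A: "(A, y) \<in> W" by auto
      then have "A \<in> carrier (SL n)" using zariski_closed_subset[OF W] by auto
      then obtain B where "B \<in> carrier (SL n)" "A * B = 1\<^sub>m n" by (rule SL_inverse)
      then show "(1\<^sub>m n, y) \<in> S" using all[OF A, of B] by simp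
    next
      assume "(1\<^sub>m n, y) \<in> S"
      then show "y \<in> snd ` W" using S by (force simp: sweep_stage_def)
    qed
    then show ?thesis using E(2) SL_one_closed by auto
  qed
  ultimately show ?thesis unfolding zariski_closed_def by blast
qed

section \<open>The group PSL\<close>

lemma SL_simps [simp]: "monoid.mult (SL n) = (*)" "one (SL n) = 1\<^sub>m n"
  by (simp_all add: SL_def)

lemma group_SL: "group (SL n)"
proof (rule groupI)
  fix A assume "A \<in> carrier (SL n)"
  then obtain B where "B \<in> carrier (SL n)" "B * A = 1\<^sub>m n" by (rule SL_inverse)
  then show "\<exists>B\<in>carrier (SL n). B \<otimes>\<^bsub>SL n\<^esub> A = \<one>\<^bsub>SL n\<^esub>" by auto
qed (auto simp: SL_mult_closed SL_one_closed SL_carrier_mat assoc_mult_mat[of _ n n _ n _ n] left_mult_one_mat[OF SL_carrier_mat])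

lemma (in group) centralizer_subgroup:
  assumes S: "S \<subseteq> carrier G"
  shows "subgroup (group_centralizer G S) G"
proof (rule subgroupI)
  show "group_centralizer G S \<subseteq> carrier G" by (auto simp: group_centralizer_def)
  have "\<one> \<in> group_centralizer G S" using S by (auto simp: group_centralizer_def)
  then show "group_centralizer G S \<noteq> {}" by blast
  fix a assume "a \<in> group_centralizer G S"
  then have a: "a \<in> carrier G" "\<And>s. s \<in> S \<Longrightarrow> a \<otimes> s = s \<otimes> a" by (auto simp: group_centralizer_def)
  have "inv a \<otimes> s = s \<otimes> inv a" if "s \<in> S" for s
  proof -
    have sc: "s \<in> carrier G" using that S by blast
    have "inv a \<otimes> s = inv a \<otimes> (s \<otimes> a) \<otimes> inv a" using a(1) sc by (simp add: m_assoc)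
    also have "\<dots> = inv a \<otimes> (a \<otimes> s) \<otimes> inv a" using a(2)[OF that] by simp
    also have "\<dots> = s \<otimes> inv a" using a(1) sc by (simp add: m_assoc[symmetric])
    finally show ?thesis .
  qed
  then show "inv a \<in> group_centralizer G S" using a by (simp add: group_centralizer_def)
  fix b assume "b \<in> group_centralizer G S"
  then have b: "b \<in> carrier G" "\<And>s. s \<in> S \<Longrightarrow> b \<otimes> s = s \<otimes> b" by (auto simp: group_centralizer_def)
  have "a \<otimes> b \<otimes> s = s \<otimes> (a \<otimes> b)" if "s \<in> S" for s
  proof -
    have sc: "s \<in> carrier G" using that S by blast
    have "a \<otimes> b \<otimes> s = a \<otimes> (s \<otimes> b)" using a(1) b(1) sc b(2)[OF that] by (simp add: m_assoc)
    also have "\<dots> = (a \<otimes> s) \<otimes> b" using a(1) b(1) sc by (simp add: m_assoc)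
    also have "\<dots> = s \<otimes> (a \<otimes> b)" unfolding a(2)[OF that] using a(1) b(1) sc by (simp add: m_assoc)
    finally show ?thesis .
  qed
  then show "a \<otimes> b \<in> group_centralizer G S" using a b by (simp add: group_centralizer_def)
qed

lemma (in group) center_subgroup: "subgroup (group_center G) G"
  using centralizer_subgroup[of "carrier G"] by (simp add: group_center_def group_centralizer_def)

lemma (in group) center_normal: "group_center G \<lhd> G"
proof (rule normalI[OF center_subgroup], rule ballI)
  fix x assume x: "x \<in> carrier G"
  have "z \<otimes> x = x \<otimes> z" if "z \<in> group_center G" for z
    using that x by (simp add: group_center_def)
  then show "group_center G #> x = x <# group_center G" unfolding r_coset_def l_coset_def by simp
qed

text \<open>Commutation with the transvection \<open>1 + E\<^sub>i\<^sub>j\<close> makes column \<open>i\<close> vanish off the diagonal and equates its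
diagonal entry with that of column \<open>j\<close>.\<close>

lemma SL_center_scalar:
  assumes z: "z \<in> group_center (SL n)"
  shows "\<exists>c. z = c \<cdot>\<^sub>m 1\<^sub>m n"
proof -
  have zc: "z \<in> carrier_mat n n"
    and comm: "\<And>g. g \<in> carrier (SL n) \<Longrightarrow> z * g = g * z"
    using z SL_carrier_mat by (auto simp: group_center_def)
  have key: "z $$ (r, i) = (if r = i then z $$ (j, j) else 0)"
    if ij: "i \<noteq> j" "i < n" "j < n" "r < n" for i j r
  proof -
    define T where "T = addrow_mat n (1 :: complex) i j"
    have T: "T \<in> carrier_mat n n" "det T = 1"
      using ij det_addrow_mat unfolding T_def by (auto simp: addrow_mat_def)
    have Tix: "T $$ (a, b) = (if a = i \<and> b = j then 1 else 0) + (if a = b then 1 else 0)" if "a < n" "b < n" for a b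
      using that by (auto simp: T_def addrow_mat_def)
    have "(z * T) $$ (r, j) = (\<Sum>l = 0..<n. z $$ (r, l) * T $$ (l, j))"
      using zc T ij by (simp add: scalar_prod_def)
    also have "\<dots> = (\<Sum>l = 0..<n. (if l = i then z $$ (r, i) else 0) + (if l = j then z $$ (r, j) else 0))"
      by (rule sum.cong) (use ij in \<open>auto simp: Tix\<close>)
    also have "\<dots> = z $$ (r, i) + z $$ (r, j)"
      using ij by (simp add: sum.distrib)
    finally have 1: "(z * T) $$ (r, j) = z $$ (r, i) + z $$ (r, j)" .
    have "(T * z) $$ (r, j) = (\<Sum>l = 0..<n. T $$ (r, l) * z $$ (l, j))"
      using zc T ij by (simp add: scalar_prod_def)
    also have "\<dots> = (\<Sum>l = 0..<n. (if l = j then (if r = i then z $$ (j, j) else 0) else 0) + (if l = r then z $$ (r, j) else 0))"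
      by (rule sum.cong) (use ij in \<open>auto simp: Tix\<close>)
    also have "\<dots> = (if r = i then z $$ (j, j) else 0) + z $$ (r, j)"
      using ij by (simp add: sum.distrib)
    finally have 2: "(T * z) $$ (r, j) = (if r = i then z $$ (j, j) else 0) + z $$ (r, j)" .
    show ?thesis using 1 2 comm[of T] T by (simp add: SL_carrier_iff)
  qed
  have "z = z $$ (0, 0) \<cdot>\<^sub>m 1\<^sub>m n"
  proof (rule eq_matI)
    fix r s assume "r < dim_row (z $$ (0, 0) \<cdot>\<^sub>m 1\<^sub>m n)" "s < dim_col (z $$ (0, 0) \<cdot>\<^sub>m 1\<^sub>m n)"
    then have rs: "r < n" "s < n" by auto
    then show "z $$ (r, s) = (z $$ (0, 0) \<cdot>\<^sub>m 1\<^sub>m n) $$ (r, s)"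
      using key[of s r r] key[of r 0 r] by (cases "r = s"; cases "r = 0") auto
  qed (use zc in auto)
  then show ?thesis by blast
qed

lemma scalar_mem_SL_center:
  assumes "c ^ n = 1" shows "c \<cdot>\<^sub>m 1\<^sub>m n \<in> group_center (SL n)"
  using assms unfolding group_center_def
  by (auto simp: SL_carrier_iff mult_smult_distrib[of _ n n _ n] mult_smult_assoc_mat[of _ n n _ n])

lemma to_PSL_hom: "to_PSL n \<in> hom (SL n) (PSL n)"
  unfolding to_PSL_def[abs_def] PSL_def
  using normal.r_coset_hom_Mod[OF group.center_normal[OF group_SL]] .

lemma group_PSL: "group (PSL n)"
  unfolding PSL_def by (rule normal.factorgroup_is_group[OF group.center_normal[OF group_SL]])

lemma carrier_PSL: "carrier (PSL n) = to_PSL n ` carrier (SL n)"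
  by (auto simp: PSL_def FactGroup_def RCOSETS_def to_PSL_def)

lemma to_PSL_closed: "A \<in> carrier (SL n) \<Longrightarrow> to_PSL n A \<in> carrier (PSL n)"
  by (simp add: carrier_PSL)

lemma to_PSL_mult:
  "A \<in> carrier (SL n) \<Longrightarrow> B \<in> carrier (SL n) \<Longrightarrow> to_PSL n (A * B) = to_PSL n A \<otimes>\<^bsub>PSL n\<^esub> to_PSL n B"
  using to_PSL_hom[of n] by (auto simp: hom_def)

lemma to_PSL_one: "to_PSL n (1\<^sub>m n) = \<one>\<^bsub>PSL n\<^esub>"
  using hom_one[OF to_PSL_hom group_SL group_PSL, of n] by simp

lemma to_PSL_inv:
  assumes "A \<in> carrier (SL n)" "B \<in> carrier (SL n)" "A * B = 1\<^sub>m n"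
  shows "inv\<^bsub>PSL n\<^esub> (to_PSL n A) = to_PSL n B"
proof -
  interpret group "PSL n" by (rule group_PSL)
  have "B * A = 1\<^sub>m n" using mat_mult_left_right_inverse[of A n B] assms SL_carrier_mat by auto
  then show ?thesis using assms to_PSL_mult to_PSL_one to_PSL_closed
    by (intro inv_equality) metis+
qed

lemma to_PSL_eq_iff:
  assumes A: "A \<in> carrier (SL n)" and B: "B \<in> carrier (SL n)"
  shows "to_PSL n A = to_PSL n B \<longleftrightarrow> (\<exists>c. A = c \<cdot>\<^sub>m B)"
proof
  interpret S: group "SL n" by (rule group_SL)
  note sub = S.center_subgroup
  assume "to_PSL n A = to_PSL n B"
  then have "A \<in> group_center (SL n) #>\<^bsub>SL n\<^esub> B"
    unfolding to_PSL_def using S.rcos_self[OF A sub] by simp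
  then obtain z where z: "z \<in> group_center (SL n)" "A = z * B" by (auto simp: r_coset_def)
  then show "\<exists>c. A = c \<cdot>\<^sub>m B"
    using SL_center_scalar[OF z(1)] SL_carrier_mat[OF B]
    by (auto simp: mult_smult_assoc_mat[of _ n n _ n])
next
  interpret S: group "SL n" by (rule group_SL)
  note sub = S.center_subgroup
  assume "\<exists>c. A = c \<cdot>\<^sub>m B"
  then obtain c where c: "A = c \<cdot>\<^sub>m B" by blast
  then have "c ^ n = 1" using A B by (auto simp: SL_carrier_iff)
  note z = scalar_mem_SL_center[OF this]
  have "A = (c \<cdot>\<^sub>m 1\<^sub>m n) * B" using c SL_carrier_mat[OF B]
    by (auto simp: mult_smult_assoc_mat[of _ n n _ n])
  then have "A \<in> group_center (SL n) #>\<^bsub>SL n\<^esub> B" using z by (auto simp: r_coset_def)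
  from S.repr_independence[OF this B sub] show "to_PSL n A = to_PSL n B"
    unfolding to_PSL_def by simp
qed

lemma to_PSL_commute_iff:
  assumes A: "A \<in> carrier (SL n)" and B: "B \<in> carrier (SL n)"
  shows "to_PSL n A \<otimes>\<^bsub>PSL n\<^esub> to_PSL n B = to_PSL n B \<otimes>\<^bsub>PSL n\<^esub> to_PSL n A
    \<longleftrightarrow> (\<exists>c. A * B = c \<cdot>\<^sub>m (B * A))"
  using to_PSL_eq_iff[OF SL_mult_closed[OF A B] SL_mult_closed[OF B A]] to_PSL_mult A B by metis

section \<open>Stabilizers of subspaces are parabolic\<close>

text \<open>The matrix maps the span of the first \<open>r\<close> basis vectors into itself.\<close>

definition stabilizes_initial :: "nat \<Rightarrow> nat \<Rightarrow> complex mat \<Rightarrow> bool" where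
  "stabilizes_initial n r X \<longleftrightarrow> (\<forall>i j. r \<le> i \<longrightarrow> i < n \<longrightarrow> j < r \<longrightarrow> X $$ (i, j) = 0)"

lemma stabilizes_initial_mult:
  assumes "X \<in> carrier_mat n n" "Y \<in> carrier_mat n n" "r \<le> n"
    and "stabilizes_initial n r X" "stabilizes_initial n r Y"
  shows "stabilizes_initial n r (X * Y)"
  unfolding stabilizes_initial_def
proof (intro allI impI)
  fix i j assume ij: "r \<le> i" "i < n" "j < r"
  have "(X * Y) $$ (i, j) = (\<Sum>l = 0..<n. X $$ (i, l) * Y $$ (l, j))"
    using assms ij by (simp add: scalar_prod_def)
  also have "\<dots> = 0"
  proof (rule sum.neutral, rule ballI)
    fix l assume "l \<in> {0..<n}"
    then show "X $$ (i, l) * Y $$ (l, j) = 0"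
      using assms(4,5) ij unfolding stabilizes_initial_def by (cases "l < r") auto
  qed
  finally show "(X * Y) $$ (i, j) = 0" .
qed

lemma stabilizes_initial_mult_vec:
  assumes X: "X \<in> carrier_mat n n" and r: "r \<le> n" and stab: "stabilizes_initial n r X" and w: "w \<in> carrier_vec r"
  shows "X *\<^sub>v vec n (\<lambda>i. if i < r then w $ i else 0) =
    vec n (\<lambda>i. if i < r then (mat r r (\<lambda>(i, j). X $$ (i, j)) *\<^sub>v w) $ i else 0)" (is "?L = ?R")
proof (rule eq_vecI)
  fix i assume "i < dim_vec ?R"
  then have i: "i < n" by simp
  have "?L $ i = (\<Sum>l = 0..<n. X $$ (i, l) * (if l < r then w $ l else 0))"
    using X i by (simp add: scalar_prod_def)
  also have "\<dots> = (\<Sum>l = 0..<r. X $$ (i, l) * w $ l)"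
    using r by (intro sum.mono_neutral_cong_right) auto
  also have "\<dots> = ?R $ i"
    using stab w i by (auto simp: stabilizes_initial_def scalar_prod_def intro!: sum.neutral)
  finally show "?L $ i = ?R $ i" .
qed (use X in auto)

text \<open>The leading block of \<open>X\<close> is injective because \<open>X\<close> is, so \<open>X\<close> maps the initial subspace onto itself; the adjugate of the
block provides preimages of the basis vectors, up to the factor \<open>det X1\<close>.\<close>

lemma stabilizes_initial_inverse:
  assumes X: "X \<in> carrier_mat n n" and Y: "Y \<in> carrier_mat n n" and YX: "Y * X = 1\<^sub>m n"
    and r: "r \<le> n" and stab: "stabilizes_initial n r X"
  shows "stabilizes_initial n r Y"
proof -
  let ?pad = "\<lambda>w. vec n (\<lambda>i. if i < r then w $ i else (0 :: complex))"
  define X1 where "X1 = mat r r (\<lambda>(i, j). X $$ (i, j))"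
  have X1: "X1 \<in> carrier_mat r r" by (simp add: X1_def)
  have pad: "X *\<^sub>v ?pad w = ?pad (X1 *\<^sub>v w)" if "w \<in> carrier_vec r" for w
    unfolding X1_def by (rule stabilizes_initial_mult_vec[OF X r stab that])
  have YX_vec: "Y *\<^sub>v (X *\<^sub>v v) = v" if "v \<in> carrier_vec n" for v
    using that YX assoc_mult_mat_vec[OF Y X that] by simp
  have "det X1 \<noteq> 0"
  proof
    assume "det X1 = 0"
    then obtain v where v: "v \<in> carrier_vec r" "v \<noteq> 0\<^sub>v r" "X1 *\<^sub>v v = 0\<^sub>v r"
      using det_0_iff_vec_prod_zero_field[OF X1] by blast
    have "X *\<^sub>v ?pad v = 0\<^sub>v n" using pad[OF v(1)] v(3) r by (auto intro!: eq_vecI)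
    moreover have "Y *\<^sub>v 0\<^sub>v n = 0\<^sub>v n" using Y by (auto intro!: eq_vecI)
    ultimately have pad0: "?pad v = 0\<^sub>v n" using YX_vec[of "?pad v"] by simp
    have "v $ i = 0" if "i < r" for i
    proof -
      have "v $ i = ?pad v $ i" using that r by simp
      then show ?thesis unfolding pad0 using that r by simp
    qed
    then have "v = 0\<^sub>v r" using v(1) by (intro eq_vecI) auto
    then show False using v(2) by simp
  qed
  show ?thesis unfolding stabilizes_initial_def
  proof (intro allI impI)
    fix i j assume ij: "r \<le> i" "i < n" "j < r"
    define w where "w = col (adj_mat X1) j"
    have w: "w \<in> carrier_vec r" using adj_mat(1)[OF X1] by (auto simp: w_def)
    have "X1 *\<^sub>v w = col (X1 * adj_mat X1) j"
      using adj_mat(1)[OF X1] ij X1 by (auto simp: w_def intro!: eq_vecI)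
    then have X1w: "(X1 *\<^sub>v w) $ k = (if k = j then det X1 else 0)" if "k < r" for k
      using that ij by (simp add: adj_mat(2)[OF X1])
    have "X *\<^sub>v ?pad w = det X1 \<cdot>\<^sub>v unit_vec n j"
      unfolding pad[OF w] using ij r by (intro eq_vecI) (auto simp: X1w unit_vec_def)
    then have "?pad w = Y *\<^sub>v (det X1 \<cdot>\<^sub>v unit_vec n j)" using YX_vec[of "?pad w"] by simp
    also have "\<dots> = det X1 \<cdot>\<^sub>v col Y j"
      using Y ij r by (intro eq_vecI) (auto simp: mult_mat_vec[OF Y])
    finally have "?pad w $ i = (det X1 \<cdot>\<^sub>v col Y j) $ i" by simp
    then show "Y $$ (i, j) = 0" using ij Y \<open>det X1 \<noteq> 0\<close> by simp
  qed
qed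

text \<open>For \<open>h = g\<^sup>-\<^sup>1\<close> this is the stabilizer of the span of the first \<open>r\<close> columns of \<open>g\<close>.\<close>

definition block_parabolic :: "nat \<Rightarrow> nat \<Rightarrow> complex mat \<Rightarrow> complex mat \<Rightarrow> complex mat set set" where
  "block_parabolic n r g h = to_PSL n ` {A \<in> carrier (SL n). stabilizes_initial n r (h * A * g)}"

lemma mem_block_parabolic_iff:
  assumes A: "A \<in> carrier (SL n)" and g: "g \<in> carrier (SL n)" and h: "h \<in> carrier (SL n)" and r: "r \<le> n"
  shows "to_PSL n A \<in> block_parabolic n r g h \<longleftrightarrow> stabilizes_initial n r (h * A * g)"
proof
  assume "to_PSL n A \<in> block_parabolic n r g h"
  then obtain B where B: "B \<in> carrier (SL n)" "stabilizes_initial n r (h * B * g)" "to_PSL n A = to_PSL n B"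
    unfolding block_parabolic_def by auto
  then obtain c where "A = c \<cdot>\<^sub>m B" using to_PSL_eq_iff[OF A B(1)] by blast
  then have "h * A * g = c \<cdot>\<^sub>m (h * B * g)"
    using SL_carrier_mat[OF h] SL_carrier_mat[OF g] SL_carrier_mat[OF B(1)]
    by (simp add: mult_smult_distrib[of _ n n _ n] mult_smult_assoc_mat[of _ n n _ n])
  then show "stabilizes_initial n r (h * A * g)"
    using B(2) r SL_carrier_mat[OF h] SL_carrier_mat[OF g] by (auto simp: stabilizes_initial_def)
qed (use A in \<open>auto simp: block_parabolic_def\<close>)

lemma block_parabolic_subgroup:
  assumes g: "g \<in> carrier (SL n)" and h: "h \<in> carrier (SL n)" and gh: "g * h = 1\<^sub>m n" "h * g = 1\<^sub>m n" and r: "r \<le> n"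
  shows "subgroup (block_parabolic n r g h) (PSL n)"
proof -
  interpret G: group "PSL n" by (rule group_PSL)
  have gc: "g \<in> carrier_mat n n" "h \<in> carrier_mat n n" using g h SL_carrier_mat by auto
  show ?thesis
  proof (rule G.subgroupI)
    show "block_parabolic n r g h \<subseteq> carrier (PSL n)"
      by (auto simp: block_parabolic_def to_PSL_closed)
    have "stabilizes_initial n r (h * 1\<^sub>m n * g)" using gc gh r by (auto simp: stabilizes_initial_def)
    then show "block_parabolic n r g h \<noteq> {}" using SL_one_closed by (auto simp: block_parabolic_def)
  next
    fix a assume "a \<in> block_parabolic n r g h"
    then obtain A where A: "a = to_PSL n A" "A \<in> carrier (SL n)" "stabilizes_initial n r (h * A * g)"
      by (auto simp: block_parabolic_def)
    obtain B where B: "B \<in> carrier (SL n)" "A * B = 1\<^sub>m n" "B * A = 1\<^sub>m n" using SL_inverse[OF A(2)] .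
    have "(h * B * g) * (h * A * g) = h * (B * A) * g"
      using mat_conj_mult[OF gc gh(1)] A(2) B(1) SL_carrier_mat by blast
    then have "(h * B * g) * (h * A * g) = 1\<^sub>m n" using B(3) gc gh by simp
    then have "stabilizes_initial n r (h * B * g)"
      using stabilizes_initial_inverse[of "h * A * g" n "h * B * g" r] A(3) r
        mult_carrier_mat[OF mult_carrier_mat[OF gc(2) SL_carrier_mat[OF A(2)]] gc(1)]
        mult_carrier_mat[OF mult_carrier_mat[OF gc(2) SL_carrier_mat[OF B(1)]] gc(1)] by blast
    then show "inv\<^bsub>PSL n\<^esub> a \<in> block_parabolic n r g h"
      using to_PSL_inv[OF A(2) B(1,2)] A B by (auto simp: block_parabolic_def)
  next
    fix a b assume "a \<in> block_parabolic n r g h" "b \<in> block_parabolic n r g h"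
    then obtain A B where A: "a = to_PSL n A" "A \<in> carrier (SL n)" "stabilizes_initial n r (h * A * g)"
      and B: "b = to_PSL n B" "B \<in> carrier (SL n)" "stabilizes_initial n r (h * B * g)"
      by (auto simp: block_parabolic_def)
    have "stabilizes_initial n r ((h * A * g) * (h * B * g))"
      using stabilizes_initial_mult[of "h * A * g" n "h * B * g" r] A(3) B(3) r
        mult_carrier_mat[OF mult_carrier_mat[OF gc(2) SL_carrier_mat[OF A(2)]] gc(1)]
        mult_carrier_mat[OF mult_carrier_mat[OF gc(2) SL_carrier_mat[OF B(2)]] gc(1)] by blast
    then have "stabilizes_initial n r (h * (A * B) * g)"
      using mat_conj_mult[OF gc gh(1)] A B SL_carrier_mat by simp
    then show "a \<otimes>\<^bsub>PSL n\<^esub> b \<in> block_parabolic n r g h"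
      using A B to_PSL_mult SL_mult_closed by (auto simp: block_parabolic_def image_iff) metis
  qed
qed

lemma block_parabolic_proper:
  assumes g: "g \<in> carrier (SL n)" and h: "h \<in> carrier (SL n)" and gh: "g * h = 1\<^sub>m n" "h * g = 1\<^sub>m n"
    and r: "0 < r" "r < n"
  shows "block_parabolic n r g h \<noteq> carrier (PSL n)"
proof -
  have gc: "g \<in> carrier_mat n n" "h \<in> carrier_mat n n" using g h SL_carrier_mat by auto
  define T where "T = addrow_mat n (1 :: complex) r 0"
  have T: "T \<in> carrier_mat n n" by (simp add: T_def addrow_mat_def)
  have "det T = 1" unfolding T_def by (rule det_addrow_mat) (use r in simp)
  have TS: "T \<in> carrier (SL n)" using T \<open>det T = 1\<close> by (simp add: SL_carrier_iff)
  have "T $$ (r, 0) = 1" using r by (simp add: T_def addrow_mat_def)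
  then have notstab: "\<not> stabilizes_initial n r T"
    unfolding stabilizes_initial_def using r by (metis le_refl zero_neq_one)
  have "h * (g * T * h) * g = (h * g) * T * (h * g)"
    using gc T by (simp add: assoc_mult_mat[of _ n n _ n _ n] mult_carrier_mat[of _ n n _ n])
  then have "\<not> stabilizes_initial n r (h * (g * T * h) * g)" using notstab gh T by simp
  moreover have S: "g * T * h \<in> carrier (SL n)" using g h TS SL_mult_closed by blast
  ultimately have "to_PSL n (g * T * h) \<notin> block_parabolic n r g h"
    using mem_block_parabolic_iff[OF S g h] r by simp
  then show ?thesis using to_PSL_closed[OF S] by blast
qed

lemma block_parabolic_closed:
  assumes g: "g \<in> carrier (SL n)" and h: "h \<in> carrier (SL n)" and r: "r \<le> n"
  shows "PSL_closed n (block_parabolic n r g h)"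
proof -
  define f where "f = (\<lambda>i j (A :: complex mat). \<Sum>l = 0..<n. h $$ (i, l) * (\<Sum>k = 0..<n. A $$ (l, k) * g $$ (k, j)))"
  have entry: "(h * A * g) $$ (i, j) = f i j A" if "A \<in> carrier (SL n)" "i < n" "j < n" for A i j
    using that SL_carrier_mat[OF g] SL_carrier_mat[OF h] SL_carrier_mat[OF that(1)]
    by (simp add: f_def scalar_prod_def)
  have pol: "f i j \<in> poly_functions (mat_coords n)" for i j
    unfolding f_def
    by (intro poly_functions_sum poly_functions.mult poly_functions.const)
      (auto intro!: poly_functions.coord simp: mat_coords_def)
  have "{A \<in> carrier (SL n). to_PSL n A \<in> block_parabolic n r g h} =
    {A \<in> carrier (SL n). \<forall>q\<in>{f i j | i j. r \<le> i \<and> i < n \<and> j < r}. q A = 0}"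
  proof (rule Collect_cong, rule conj_cong)
    fix A assume A: "A \<in> carrier (SL n)"
    show "to_PSL n A \<in> block_parabolic n r g h \<longleftrightarrow> (\<forall>q\<in>{f i j | i j. r \<le> i \<and> i < n \<and> j < r}. q A = 0)"
      unfolding mem_block_parabolic_iff[OF A g h r] stabilizes_initial_def
      using entry[OF A] r by (auto simp del: index_mult_mat(1)) (metis entry[OF A] order_less_le_trans)
  qed simp
  moreover have "{f i j | i j. r \<le> i \<and> i < n \<and> j < r} \<subseteq> poly_functions (mat_coords n)" using pol by blast
  ultimately have "zariski_closed (mat_coords n) (carrier (SL n))
     {A \<in> carrier (SL n). to_PSL n A \<in> block_parabolic n r g h}"
    unfolding zariski_closed_def by blast
  moreover have "block_parabolic n r g h \<subseteq> carrier (PSL n)"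
    by (auto simp: block_parabolic_def to_PSL_closed)
  ultimately show ?thesis unfolding PSL_closed_def by blast
qed

text \<open>Right translation by \<open>h\<close> carries the preimage of a closed subset of the quotient to a set that is invariant
under the standard parabolic subgroup, in particular under the upper triangular matrices.\<close>

lemma block_parabolic_complete:
  assumes g: "g \<in> carrier (SL n)" and h: "h \<in> carrier (SL n)" and gh: "g * h = 1\<^sub>m n" "h * g = 1\<^sub>m n"
    and r: "0 < r" "r < n"
  shows "complete_quotient n (block_parabolic n r g h)"
  unfolding complete_quotient_def
proof (intro allI impI)
  fix m and W :: "(complex mat set set \<times> complex vec) set"
  interpret G: group "PSL n" by (rule group_PSL)
  have gc: "g \<in> carrier_mat n n" "h \<in> carrier_mat n n" using g h SL_carrier_mat by auto
  let ?P = "block_parabolic n r g h"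
  have sub: "subgroup ?P (PSL n)" using block_parabolic_subgroup[OF g h gh] r by simp
  assume "quotient_times_affine_closed n ?P m W"
  then have WL: "W \<subseteq> (lcosets\<^bsub>PSL n\<^esub> ?P) \<times> carrier_vec m"
    and cl: "SL_affine_closed n m
      {(A, y). A \<in> carrier (SL n) \<and> y \<in> carrier_vec m \<and> (to_PSL n A <#\<^bsub>PSL n\<^esub> ?P, y) \<in> W}"
    unfolding quotient_times_affine_closed_def by auto
  define W1 where "W1 = {(A, y) \<in> SL_affine n m. (to_PSL n (A * h) <#\<^bsub>PSL n\<^esub> ?P, y) \<in> W}"
  have "W1 = {(A, y) \<in> SL_affine n m. (A * h, y) \<in>
      {(A, y). A \<in> carrier (SL n) \<and> y \<in> carrier_vec m \<and> (to_PSL n A <#\<^bsub>PSL n\<^esub> ?P, y) \<in> W}}"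
    using SL_mult_closed[OF _ h] by (auto simp: W1_def)
  then have W1: "SL_affine_closed n m W1"
    using right_translate_closed[OF cl h] by simp
  have "upper_invariant n W1"
    unfolding upper_invariant_def
  proof (intro allI impI)
    fix A y b assume x: "(A, y) \<in> W1" and b: "b \<in> upper_SL n"
    have A: "A \<in> carrier (SL n)" "y \<in> carrier_vec m" and AW: "(to_PSL n (A * h) <#\<^bsub>PSL n\<^esub> ?P, y) \<in> W"
      using x by (auto simp: W1_def)
    have bS: "b \<in> carrier (SL n)" and up: "upper_triangular b" using b by (auto simp: upper_SL_def)
    have bc: "b \<in> carrier_mat n n" "A \<in> carrier_mat n n" using bS A SL_carrier_mat by auto
    have gbh: "g * b * h \<in> carrier (SL n)" using g bS h SL_mult_closed by blast
    have "h * (g * b * h) * g = (h * g) * b * (h * g)"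
      using gc bc by (simp add: assoc_mult_mat[of _ n n _ n _ n] mult_carrier_mat[of _ n n _ n])
    then have "h * (g * b * h) * g = b" using gh bc by simp
    moreover have "stabilizes_initial n r b"
      using up bc by (auto simp: stabilizes_initial_def upper_triangular_def)
    ultimately have gbhP: "to_PSL n (g * b * h) \<in> ?P"
      using mem_block_parabolic_iff[OF gbh g h] r by simp
    have "A * b * h = (A * h) * (g * b * h)"
    proof -
      have "(A * h) * (g * b * h) = A * (h * g) * b * h"
        using gc bc by (simp add: assoc_mult_mat[of _ n n _ n _ n] mult_carrier_mat[of _ n n _ n])
      then show ?thesis using gh bc by simp
    qed
    then have "to_PSL n (A * b * h) <#\<^bsub>PSL n\<^esub> ?P =
       (to_PSL n (A * h) \<otimes>\<^bsub>PSL n\<^esub> to_PSL n (g * b * h)) <#\<^bsub>PSL n\<^esub> ?P"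
      using to_PSL_mult[OF SL_mult_closed[OF A(1) h] gbh] by simp
    also have "\<dots> = to_PSL n (A * h) <#\<^bsub>PSL n\<^esub> (to_PSL n (g * b * h) <#\<^bsub>PSL n\<^esub> ?P)"
      using G.lcos_m_assoc[OF subgroup.subset[OF sub]] to_PSL_closed SL_mult_closed A h gbh by metis
    also have "to_PSL n (g * b * h) <#\<^bsub>PSL n\<^esub> ?P = ?P"
      using G.coset_join3[OF _ sub gbhP] to_PSL_closed[OF gbh] by blast
    finally show "(A * b, y) \<in> W1" using AW A bS SL_mult_closed by (auto simp: W1_def)
  qed
  from flag_projection_closed[OF _ W1 this] r
  have "zariski_closed (vec_coords m) (carrier_vec m) (snd ` W1)" by simp
  also have "snd ` W1 = snd ` W"
  proof
    show "snd ` W1 \<subseteq> snd ` W" by (force simp: W1_def)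
    show "snd ` W \<subseteq> snd ` W1"
    proof clarify
      fix C y assume C: "(C, y) \<in> W"
      then have y: "y \<in> carrier_vec m" and "C \<in> lcosets\<^bsub>PSL n\<^esub> ?P" using WL by auto
      then obtain A where A: "A \<in> carrier (SL n)" "C = to_PSL n A <#\<^bsub>PSL n\<^esub> ?P"
        by (auto simp: LCOSETS_def carrier_PSL)
      have "A * g * h = A" using gh gc SL_carrier_mat[OF A(1)] by simp
      then have "(A * g, y) \<in> W1" using A C y SL_mult_closed[OF A(1) g] by (auto simp: W1_def)
      then show "snd (C, y) \<in> snd ` W1" by force
    qed
  qed
  finally show "zariski_closed (vec_coords m) (carrier_vec m) (snd ` W)" .
qed

theorem block_parabolic_parabolic:
  assumes g: "g \<in> carrier (SL n)" and h: "h \<in> carrier (SL n)" and gh: "g * h = 1\<^sub>m n" "h * g = 1\<^sub>m n"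
    and r: "0 < r" "r < n"
  shows "parabolic n (block_parabolic n r g h)"
  unfolding parabolic_def
  using block_parabolic_subgroup[OF g h gh] block_parabolic_proper[OF g h gh r]
    block_parabolic_closed[OF g h] block_parabolic_complete[OF g h gh r] r by simp

text \<open>Scaling changes neither the column span of an invertible matrix nor conjugation by it, so bases may be taken in
\<open>SL\<^sub>n\<close>.\<close>

lemma scale_to_SL:
  assumes g: "g \<in> carrier_mat n n" and d: "det g \<noteq> 0" and n: "n > 0"
  obtains c where "c \<noteq> 0" "c \<cdot>\<^sub>m g \<in> carrier (SL n)"
proof -
  obtain c where c: "c ^ n = 1 / det g" using nth_root_exists[of n "1 / det g"] n by blast
  have "c \<noteq> 0" using c d n by (auto simp: power_0_left)
  moreover have "c \<cdot>\<^sub>m g \<in> carrier (SL n)" using g c d by (simp add: SL_carrier_iff)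
  ultimately show thesis using that by blast
qed

section \<open>Schur's lemma for irreducible subgroups\<close>

lemma irreducible_stabilizes_no_subspace:
  assumes irr: "irreducible_subgroup n H" and r: "0 < r" "r < n"
    and g: "g \<in> carrier_mat n n" and h: "h \<in> carrier_mat n n" and hg: "h * g = 1\<^sub>m n"
  shows "\<exists>A \<in> carrier (SL n). to_PSL n A \<in> H \<and> \<not> stabilizes_initial n r (h * A * g)"
proof (rule ccontr)
  assume neg: "\<not> ?thesis"
  have gh: "g * h = 1\<^sub>m n" using mat_mult_left_right_inverse[OF h g hg] .
  have "det g \<noteq> 0" using det_mult[OF h g] hg by auto
  then obtain c where c: "c \<noteq> 0" "c \<cdot>\<^sub>m g \<in> carrier (SL n)" using scale_to_SL[OF g] r by auto
  define g' h' where "g' = c \<cdot>\<^sub>m g" and "h' = (1 / c) \<cdot>\<^sub>m h"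
  have g'h': "g' * h' = 1\<^sub>m n" "h' * g' = 1\<^sub>m n"
    using g h gh hg c unfolding g'_def h'_def
    by (auto simp: mult_smult_distrib[of _ n n _ n] mult_smult_assoc_mat[of _ n n _ n] smult_smult_mat intro!: eq_matI)
  have g'S: "g' \<in> carrier (SL n)" using c g'_def by simp
  have "det g' * det h' = 1"
    using det_mult[of g' n h'] g'h' g h by (simp add: g'_def h'_def)
  then have h'S: "h' \<in> carrier (SL n)" using g'S h by (simp add: SL_carrier_iff h'_def)
  have eq: "h' * A * g' = h * A * g" if "A \<in> carrier_mat n n" for A
    using g h that c unfolding g'_def h'_def
    by (auto simp: mult_smult_distrib[of _ n n _ n] mult_smult_assoc_mat[of _ n n _ n] smult_smult_mat intro!: eq_matI)
  have "H \<subseteq> block_parabolic n r g' h'"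
  proof
    fix x assume x: "x \<in> H"
    have "H \<subseteq> carrier (PSL n)" using irr subgroup.subset by (auto simp: irreducible_subgroup_def)
    then obtain A where A: "A \<in> carrier (SL n)" "x = to_PSL n A" using x carrier_PSL by auto
    then have "stabilizes_initial n r (h * A * g)" using neg x by blast
    then show "x \<in> block_parabolic n r g' h'"
      using A eq[OF SL_carrier_mat[OF A(1)]] by (auto simp: block_parabolic_def)
  qed
  then show False
    using irr block_parabolic_parabolic[OF g'S h'S g'h' r] by (auto simp: irreducible_subgroup_def)
qed

text \<open>The reduced row echelon form \<open>P M\<close> of a singular matrix. The first \<open>r\<close> columns of \<open>Q\<close> span the image of \<open>M\<close>,
because the pivot columns \<open>f j\<close> of \<open>P M\<close> are the first \<open>r\<close> basis vectors.\<close>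

lemma singular_factorization:
  fixes M :: "complex mat"
  assumes M: "M \<in> carrier_mat n n" and nz: "M \<noteq> 0\<^sub>m n n" and sing: "det M = 0"
  obtains P Q r f where "P \<in> carrier_mat n n" "Q \<in> carrier_mat n n" "P * Q = 1\<^sub>m n" "Q * P = 1\<^sub>m n"
    "0 < r" "r < n"
    "\<And>i j. r \<le> i \<Longrightarrow> i < n \<Longrightarrow> j < n \<Longrightarrow> (P * M) $$ (i, j) = 0"
    "\<And>j. j < r \<Longrightarrow> f j < n \<and> (\<forall>i<n. (P * M) $$ (i, f j) = (if i = j then 1 else 0))"
proof -
  define C where "C = gauss_jordan_single M"
  note gj = gauss_jordan_single[OF M C_def[symmetric]]
  have C: "C \<in> carrier_mat n n" using gj(2) .
  obtain P Q where PQ: "C = P * M" "P \<in> carrier_mat n n" "Q \<in> carrier_mat n n" "P * Q = 1\<^sub>m n" "Q * P = 1\<^sub>m n"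
    using gj(4) by blast
  obtain f where f: "pivot_fun C f n" using gj(3) C by (auto simp: row_echelon_form_def)
  have drow: "dim_row C = n" using C by simp
  note piv = pivot_funD[OF drow f]
  have "C \<noteq> 1\<^sub>m n"
  proof
    assume "C = 1\<^sub>m n"
    then have "det P * det M = 1" using det_mult[OF PQ(2) M] PQ(1) by simp
    then show False using sing by simp
  qed
  then have n: "0 < n" and last: "row C (n - 1) = 0\<^sub>v n"
    using row_echelon_form_imp_1_or_0_row[OF C gj(3)] by auto
  have M_QC: "M = Q * C" using PQ M assoc_mult_mat[of Q n n P n M n] by simp
  define r where "r = (LEAST i. n \<le> i \<or> f i = n)"
  have fl: "f (n - 1) = n"
  proof (rule ccontr)
    assume "f (n - 1) \<noteq> n"
    then have "C $$ (n - 1, f (n - 1)) = 1" "f (n - 1) < n" using piv(1,4)[of "n - 1"] n by auto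
    moreover have "row C (n - 1) $ f (n - 1) = 0" using last \<open>f (n - 1) < n\<close> by simp
    ultimately show False using C n by simp
  qed
  have rP: "n \<le> r \<or> f r = n" unfolding r_def by (rule LeastI[of _ n]) simp
  have rl: "r \<le> n - 1" unfolding r_def by (rule Least_le) (use fl in simp)
  then have fr: "f r = n" using rP n by auto
  have before: "f j < n" if "j < r" for j
    using not_less_Least[of j "\<lambda>i. n \<le> i \<or> f i = n"] that piv(1)[of j] rl n unfolding r_def[symmetric] by force
  have after: "f i = n" if "r \<le> i" "i < n" for i
    using that
  proof (induction i rule: dec_induct)
    case base
    show ?case by (rule fr)
  next
    case (step i)
    then show ?case using piv(3)[of i] piv(1)[of "Suc i"] by auto
  qed
  have zero: "C $$ (i, j) = 0" if "r \<le> i" "i < n" "j < n" for i j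
    using piv(2)[of i j] after[of i] that by simp
  have "0 < r"
  proof (rule ccontr)
    assume "\<not> 0 < r"
    then have "C = 0\<^sub>m n n" using zero C by (intro eq_matI) auto
    then have "Q * C = 0\<^sub>m n n" using PQ(3) by simp
    then show False using M_QC nz by metis
  qed
  moreover have "f j < n \<and> (\<forall>i<n. C $$ (i, f j) = (if i = j then 1 else 0))" if "j < r" for j
    using before[OF that] piv(4,5)[of j] that rl n by auto
  ultimately show thesis
    using that[of P Q r f] PQ zero rl n by auto
qed

text \<open>For an eigenvalue \<open>l\<close> of \<open>N\<close>, the matrix \<open>M = N - l\<close> is singular and its image is stable under all \<open>A\<close>
that commute with \<open>N\<close>. Unless \<open>M = 0\<close>, that image is a proper non-zero subspace; in the basis given
by the columns of \<open>Q\<close> its stability is visible in the pivot columns.\<close>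

theorem irreducible_schur:
  assumes irr: "irreducible_subgroup n H" and N: "N \<in> carrier_mat n n"
    and comm: "\<And>A. A \<in> carrier (SL n) \<Longrightarrow> to_PSL n A \<in> H \<Longrightarrow> A * N = N * A"
  shows "\<exists>c. N = c \<cdot>\<^sub>m 1\<^sub>m n"
proof (cases "n = 0")
  case True
  then show ?thesis using N by (auto intro!: eq_matI)
next
  case False
  obtain l where l: "eigenvalue N l" using spectrum_non_empty[OF N] False by (auto simp: spectrum_def)
  define M where "M = N - l \<cdot>\<^sub>m 1\<^sub>m n"
  have M: "M \<in> carrier_mat n n" using N by (auto simp: M_def)
  have NM: "N = M + l \<cdot>\<^sub>m 1\<^sub>m n" using N by (auto simp: M_def intro!: eq_matI)
  obtain v where v: "v \<in> carrier_vec n" "v \<noteq> 0\<^sub>v n" "N *\<^sub>v v = l \<cdot>\<^sub>v v"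
    using l N by (auto simp: eigenvalue_def eigenvector_def)
  have "M *\<^sub>v v = N *\<^sub>v v - (l \<cdot>\<^sub>m 1\<^sub>m n) *\<^sub>v v"
    unfolding M_def using N v by (intro minus_mult_distrib_mat_vec) auto
  also have "(l \<cdot>\<^sub>m 1\<^sub>m n) *\<^sub>v v = l \<cdot>\<^sub>v v" by (rule eq_vecI) (use v in auto)
  also have "N *\<^sub>v v - l \<cdot>\<^sub>v v = 0\<^sub>v n" using v by simp
  finally have sing: "det M = 0" using det_0_iff_vec_prod_zero_field[OF M] v by blast
  show ?thesis
  proof (cases "M = 0\<^sub>m n n")
    case True
    then show ?thesis using NM by auto
  next
    case nz: False
    obtain P Q r f where PQ: "P \<in> carrier_mat n n" "Q \<in> carrier_mat n n" "P * Q = 1\<^sub>m n" "Q * P = 1\<^sub>m n"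
      and r: "0 < r" "r < n"
      and zero: "\<And>i j. r \<le> i \<Longrightarrow> i < n \<Longrightarrow> j < n \<Longrightarrow> (P * M) $$ (i, j) = 0"
      and piv: "\<And>j. j < r \<Longrightarrow> f j < n \<and> (\<forall>i<n. (P * M) $$ (i, f j) = (if i = j then 1 else 0))"
      using singular_factorization[OF M nz sing] by metis
    define C where "C = P * M"
    have C: "C \<in> carrier_mat n n" using PQ M by (simp add: C_def)
    have "stabilizes_initial n r (P * A * Q)" if A: "A \<in> carrier (SL n)" "to_PSL n A \<in> H" for A
      unfolding stabilizes_initial_def
    proof (intro allI impI)
      fix i j assume ij: "r \<le> i" "i < n" "j < r"
      have Ac: "A \<in> carrier_mat n n" using A SL_carrier_mat by auto
      have AM: "A * M = M * A"
        using comm[OF A] Ac N unfolding M_def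
        by (simp add: mult_minus_distrib_mat[of _ n n] minus_mult_distrib_mat[of _ n n]
            mult_smult_distrib[of _ n n _ n] mult_smult_assoc_mat[of _ n n _ n])
      have X: "P * A * Q \<in> carrier_mat n n" using PQ Ac by auto
      have "Q * (P * M) = M" using assoc_mult_mat[OF PQ(2,1) M] PQ(4) M by simp
      then have XC: "P * A * Q * C = C * A" using PQ Ac M AM
        by (simp add: C_def mult_carrier_mat[of _ n n _ n] assoc_mult_mat[of _ n n _ n _ n])
      have "(P * A * Q * C) $$ (i, f j) = (\<Sum>k = 0..<n. (P * A * Q) $$ (i, k) * C $$ (k, f j))"
        using ij piv[of j] by (intro mult_mat_index_sum[OF X C]) auto
      also have "\<dots> = (\<Sum>k = 0..<n. if k = j then (P * A * Q) $$ (i, k) else 0)"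
        using piv[OF ij(3)] by (intro sum.cong) (auto simp: C_def)
      also have "\<dots> = (P * A * Q) $$ (i, j)" using ij r by simp
      finally have 1: "(P * A * Q * C) $$ (i, f j) = (P * A * Q) $$ (i, j)" .
      have "(C * A) $$ (i, f j) = (\<Sum>k = 0..<n. C $$ (i, k) * A $$ (k, f j))"
        using ij piv[of j] by (intro mult_mat_index_sum[OF C Ac]) auto
      also have "\<dots> = 0" using zero ij by (intro sum.neutral) (auto simp: C_def)
      finally show "(P * A * Q) $$ (i, j) = 0" using 1 XC by simp
    qed
    then show ?thesis
      using irreducible_stabilizes_no_subspace[OF irr r PQ(2,1,3)] by blast
  qed
qed

lemma twisted_power_lift:
  assumes A: "A \<in> carrier (SL n)" and X: "X \<in> carrier_mat n n" and Y: "Y \<in> carrier_mat n n"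
    and XA: "X * A = a \<cdot>\<^sub>m (A * X)" and YA: "Y * A = b \<cdot>\<^sub>m (A * Y)"
  shows "\<exists>B \<in> carrier (SL n). to_PSL n B = to_PSL n A [^]\<^bsub>PSL n\<^esub> (k :: nat) \<and>
    X * B = a ^ k \<cdot>\<^sub>m (B * X) \<and> Y * B = b ^ k \<cdot>\<^sub>m (B * Y)"
proof (induction k)
  case 0
  show ?case
    using X Y SL_one_closed[of n] by (intro bexI[of _ "1\<^sub>m n"]) (simp_all add: to_PSL_one one_smult_mat)
next
  case (Suc k)
  interpret group "PSL n" by (rule group_PSL)
  from Suc obtain B where B: "B \<in> carrier (SL n)" "to_PSL n B = to_PSL n A [^]\<^bsub>PSL n\<^esub> k"
    "X * B = a ^ k \<cdot>\<^sub>m (B * X)" "Y * B = b ^ k \<cdot>\<^sub>m (B * Y)" by blast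
  note c = SL_carrier_mat[OF A] SL_carrier_mat[OF B(1)]
  have "to_PSL n (B * A) = to_PSL n A [^]\<^bsub>PSL n\<^esub> Suc k"
    using to_PSL_mult[OF B(1) A] B(2) by simp
  moreover have "X * (B * A) = a ^ Suc k \<cdot>\<^sub>m (B * A * X)" "Y * (B * A) = b ^ Suc k \<cdot>\<^sub>m (B * A * Y)"
    using twisted_mult[OF X c(2,1) B(3) XA] twisted_mult[OF Y c(2,1) B(4) YA] by (simp_all only: power_Suc2)
  ultimately show ?case using SL_mult_closed[OF B(1) A] by blast
qed

text \<open>Commutation of matrices, as opposed to commutation of their classes in \<open>PSL\<close>, does not depend on the
choice of representatives.\<close>

definition commutant_image :: "nat \<Rightarrow> complex mat \<Rightarrow> complex mat set set" where
  "commutant_image n Y = to_PSL n ` {B \<in> carrier (SL n). B * Y = Y * B}"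

lemma mem_commutant_image_iff:
  assumes B: "B \<in> carrier (SL n)" and Y: "Y \<in> carrier_mat n n"
  shows "to_PSL n B \<in> commutant_image n Y \<longleftrightarrow> B * Y = Y * B"
proof
  assume "to_PSL n B \<in> commutant_image n Y"
  then obtain C where C: "C \<in> carrier (SL n)" "C * Y = Y * C" "to_PSL n B = to_PSL n C"
    by (auto simp: commutant_image_def)
  then obtain c where "B = c \<cdot>\<^sub>m C" using to_PSL_eq_iff[OF B C(1)] by blast
  then show "B * Y = Y * B"
    using C(2) mult_smult_distrib[OF Y SL_carrier_mat[OF C(1)]] mult_smult_assoc_mat[OF SL_carrier_mat[OF C(1)] Y]
    by simp
qed (use B in \<open>auto simp: commutant_image_def\<close>)

lemma commutant_image_subgroup:
  assumes Y: "Y \<in> carrier_mat n n"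
  shows "subgroup (commutant_image n Y) (PSL n)"
proof -
  interpret G: group "PSL n" by (rule group_PSL)
  show ?thesis
  proof (rule G.subgroupI)
    show "commutant_image n Y \<subseteq> carrier (PSL n)" by (auto simp: commutant_image_def to_PSL_closed)
    have "1\<^sub>m n * Y = Y * 1\<^sub>m n" using Y by simp
    then show "commutant_image n Y \<noteq> {}" using SL_one_closed by (auto simp: commutant_image_def)
    fix a assume "a \<in> commutant_image n Y"
    then obtain A where A: "A \<in> carrier (SL n)" "A * Y = Y * A" "a = to_PSL n A" by (auto simp: commutant_image_def)
    note Ac = SL_carrier_mat[OF A(1)]
    obtain A' where A': "A' \<in> carrier (SL n)" "A * A' = 1\<^sub>m n" "A' * A = 1\<^sub>m n" using SL_inverse[OF A(1)] .
    note Ac' = SL_carrier_mat[OF A'(1)]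
    have "A' * Y = A' * (Y * A) * A'"
      using A' Ac Ac' Y by (simp add: assoc_mult_mat[of _ n n _ n _ n] mult_carrier_mat[of _ n n _ n])
    also have "\<dots> = A' * A * Y * A'"
      unfolding A(2)[symmetric] using Ac Ac' Y
      by (simp add: assoc_mult_mat[of _ n n _ n _ n] mult_carrier_mat[of _ n n _ n])
    also have "\<dots> = Y * A'" using A'(3) Y Ac' by simp
    finally have "to_PSL n A' \<in> commutant_image n Y" using A' by (auto simp: commutant_image_def)
    then show "inv\<^bsub>PSL n\<^esub> a \<in> commutant_image n Y" using to_PSL_inv[OF A(1) A'(1,2)] A(3) by simp
    fix b assume "b \<in> commutant_image n Y"
    then obtain B where B: "B \<in> carrier (SL n)" "B * Y = Y * B" "b = to_PSL n B" by (auto simp: commutant_image_def)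
    note Bc = SL_carrier_mat[OF B(1)]
    have "Y * (A * B) = (1 * 1) \<cdot>\<^sub>m ((A * B) * Y)"
      using A(2) B(2) by (intro twisted_mult[OF Y Ac Bc]) (simp_all only: one_smult_mat)
    then have "to_PSL n (A * B) \<in> commutant_image n Y"
      using SL_mult_closed[OF A(1) B(1)] by (auto simp: commutant_image_def one_smult_mat)
    then show "a \<otimes>\<^bsub>PSL n\<^esub> b \<in> commutant_image n Y" using to_PSL_mult[OF A(1) B(1)] A(3) B(3) by simp
  qed
qed

lemma to_PSL_eq_one_iff:
  assumes "A \<in> carrier (SL n)"
  shows "to_PSL n A = \<one>\<^bsub>PSL n\<^esub> \<longleftrightarrow> (\<exists>c. A = c \<cdot>\<^sub>m 1\<^sub>m n)"
  using to_PSL_eq_iff[OF assms SL_one_closed] to_PSL_one by metis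

lemma irreducible_not_in_commutant:
  assumes irr: "irreducible_subgroup n H" and Y: "Y \<in> carrier (SL n)" and ne: "to_PSL n Y \<noteq> \<one>\<^bsub>PSL n\<^esub>"
  shows "\<not> H \<subseteq> commutant_image n Y"
proof
  assume sub: "H \<subseteq> commutant_image n Y"
  have "\<exists>c. Y = c \<cdot>\<^sub>m 1\<^sub>m n"
    using irreducible_schur[OF irr SL_carrier_mat[OF Y]] mem_commutant_image_iff[OF _ SL_carrier_mat[OF Y]] sub
    by blast
  then show False using ne to_PSL_eq_one_iff[OF Y] by blast
qed

text \<open>If \<open>X\<close> and \<open>Y\<close> lie over the centralizer, then every \<open>A\<close> over \<open>H\<close> commutes with \<open>X Y\<close> and with \<open>Y X\<close> up to the same
scalar \<open>a b\<close>. So \<open>A\<close> commutes with \<open>(X Y) (Y X)\<^sup>-\<^sup>1\<close>, which is scalar by Schur's lemma.\<close>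

lemma irreducible_centralizer_commutative:
  assumes irr: "irreducible_subgroup n H" and n: "0 < n"
    and x: "x \<in> group_centralizer (PSL n) H" and y: "y \<in> group_centralizer (PSL n) H"
  shows "x \<otimes>\<^bsub>PSL n\<^esub> y = y \<otimes>\<^bsub>PSL n\<^esub> x"
proof -
  obtain X Y where X: "X \<in> carrier (SL n)" "x = to_PSL n X" and Y: "Y \<in> carrier (SL n)" "y = to_PSL n Y"
    using x y carrier_PSL by (auto simp: group_centralizer_def)
  have XY: "X * Y \<in> carrier (SL n)" "Y * X \<in> carrier (SL n)" using X Y SL_mult_closed by auto
  obtain W where W: "W \<in> carrier (SL n)" "Y * X * W = 1\<^sub>m n" "W * (Y * X) = 1\<^sub>m n" using SL_inverse[OF XY(2)] .
  note c = SL_carrier_mat[OF X(1)] SL_carrier_mat[OF Y(1)] SL_carrier_mat[OF XY(1)] SL_carrier_mat[OF XY(2)]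
    SL_carrier_mat[OF W(1)]
  have "A * (X * Y * W) = (X * Y * W) * A" if A: "A \<in> carrier (SL n)" "to_PSL n A \<in> H" for A
  proof -
    note Ac = SL_carrier_mat[OF A(1)]
    obtain a where a: "A * X = a \<cdot>\<^sub>m (X * A)"
      using x A X to_PSL_commute_iff[OF A(1) X(1)] by (auto simp: group_centralizer_def)
    obtain b where b: "A * Y = b \<cdot>\<^sub>m (Y * A)"
      using y A Y to_PSL_commute_iff[OF A(1) Y(1)] by (auto simp: group_centralizer_def)
    have 1: "A * (X * Y) = (a * b) \<cdot>\<^sub>m (X * Y * A)" by (rule twisted_mult[OF Ac c(1,2) a b])
    have 2: "A * (Y * X) = (a * b) \<cdot>\<^sub>m (Y * X * A)" using twisted_mult[OF Ac c(2,1) b a] by (simp only: mult.commute)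
    have "det (A * (X * Y)) = 1" using SL_mult_closed[OF A(1) XY(1)] by (simp add: SL_carrier_iff)
    then have "(a * b) ^ n * det (X * Y * A) = 1"
      unfolding 1 using carrier_matD[OF mult_carrier_mat[OF c(3) Ac]] by simp
    then have ab: "a * b \<noteq> 0" using n by (cases "a * b = 0") (auto simp: power_0_left)
    then have "a * b * (1 / (a * b)) = 1" by simp
    then show ?thesis
      using twisted_mult[OF Ac c(3,5) 1 twisted_inverse[OF Ac c(4,5) 2 W(2,3) ab]] by (simp only: one_smult_mat)
  qed
  then obtain s where s: "X * Y * W = s \<cdot>\<^sub>m 1\<^sub>m n"
    using irreducible_schur[OF irr mult_carrier_mat[OF c(3,5)]] by blast
  have "X * Y = X * Y * (W * (Y * X))" using W(3) right_mult_one_mat[OF c(3)] by simp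
  also have "\<dots> = (X * Y * W) * (Y * X)" by (rule assoc_mult_mat[OF c(3,5,4), symmetric])
  also have "\<dots> = s \<cdot>\<^sub>m (Y * X)"
    unfolding s using mult_smult_assoc_mat[OF one_carrier_mat c(4), of s] left_mult_one_mat[OF c(4)] by (simp only:)
  finally show ?thesis using to_PSL_commute_iff[OF X(1) Y(1)] X(2) Y(2) by blast
qed

section \<open>The matrices D and M\<close>

text \<open>With this factor the cases \<open>p = 2\<close> and \<open>p\<close> odd can be treated alike: \<open>D\<close> is the scalar times
\<open>diag(1, \<xi>, \<dots>)\<close>, and \<open>M\<close> is the scalar times a permutation matrix.\<close>

definition unimodular_scalar :: "nat \<Rightarrow> complex" where
  "unimodular_scalar p = (if p = 2 then \<i> else 1)"

locale prime_root =
  fixes p :: nat and \<xi> :: complex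
  assumes prime: "prime p" and root: "primitive_root_of_unity p \<xi>"
begin

lemma p_pos: "0 < p" and p_gt_1: "1 < p"
  using prime prime_gt_1_nat by (auto simp: prime_gt_0_nat)

lemma root_pow: "\<xi> ^ p = 1"
  using root by (simp add: primitive_root_of_unity_def)

lemma root_nonzero: "\<xi> \<noteq> 0"
  using root_pow p_pos by (auto simp: power_0_left)

lemma root_pow_eq_1_iff: "\<xi> ^ k = 1 \<longleftrightarrow> p dvd k"
proof
  assume 1: "\<xi> ^ k = 1"
  have "\<xi> ^ k = (\<xi> ^ p) ^ (k div p) * \<xi> ^ (k mod p)"
    by (metis mult_div_mod_eq power_add power_mult)
  then have "\<xi> ^ (k mod p) = 1" using 1 root_pow by simp
  then have "\<not> 0 < k mod p"
    using root p_pos unfolding primitive_root_of_unity_def by (meson mod_less_divisor)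
  then show "p dvd k" by (simp add: dvd_eq_mod_eq_0)
next
  assume "p dvd k"
  then show "\<xi> ^ k = 1" using root_pow by (auto simp: power_mult elim!: dvdE)
qed

lemma root_inj: "inj_on (\<lambda>k. \<xi> ^ k) {..<p}"
proof -
  have "\<xi> ^ i \<noteq> \<xi> ^ j" if "i < j" "j < p" for i j
  proof
    assume "\<xi> ^ i = \<xi> ^ j"
    then have "\<xi> ^ (j - i) = 1" using that root_nonzero by (simp add: power_diff)
    then have "p dvd j - i" by (simp add: root_pow_eq_1_iff)
    then show False using that by (auto dest: dvd_imp_le)
  qed
  then show ?thesis unfolding inj_on_def by (metis lessThan_iff linorder_neqE_nat)
qed

lemma root_of_unity_pow:
  assumes "z ^ p = 1" obtains k where "k < p" "z = \<xi> ^ k"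
proof -
  have "(\<lambda>k. \<xi> ^ k) ` {..<p} \<subseteq> {z. z ^ p = 1}"
    using root_pow by (auto simp flip: power_mult simp: mult.commute[of _ p]) (simp add: power_mult)
  moreover have "card ((\<lambda>k. \<xi> ^ k) ` {..<p}) = p" using root_inj by (simp add: card_image)
  moreover have "finite {z :: complex. z ^ p = 1}" "card {z :: complex. z ^ p = 1} \<le> p"
    using finite_roots_unity[of p] card_roots_unity[of p] p_pos by auto
  ultimately have "(\<lambda>k. \<xi> ^ k) ` {..<p} = {z. z ^ p = 1}" by (intro card_seteq) auto
  then show thesis using assms that by blast
qed

lemma root_mod: "\<xi> ^ (k mod p) = \<xi> ^ k"
  by (metis mult.left_neutral mult_div_mod_eq power_add power_mult power_one root_pow)

lemma root_orthogonality:
  assumes "i < p" "j < p"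
  shows "(\<Sum>k<p. (\<xi> ^ j / \<xi> ^ i) ^ k) = (if i = j then of_nat p else 0)"
proof (cases "i = j")
  case True
  then show ?thesis using root_nonzero by simp
next
  case False
  then have "\<xi> ^ j / \<xi> ^ i \<noteq> 1" using root_inj assms root_nonzero by (auto simp: inj_on_def)
  moreover have "(\<xi> ^ k) ^ p = 1" for k by (metis mult.commute power_mult power_one root_pow)
  then have "(\<xi> ^ j / \<xi> ^ i) ^ p = 1" by (simp add: power_divide)
  ultimately show ?thesis using False by (simp add: geometric_sum)
qed

abbreviation "\<kappa> \<equiv> unimodular_scalar p"
abbreviation "D \<equiv> D_mat p \<xi>"
abbreviation "M \<equiv> M_c p"

lemma scalar_nonzero: "\<kappa> \<noteq> 0"
  by (simp add: unimodular_scalar_def)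

lemma D_carrier [simp]: "D \<in> carrier_mat p p"
  by (auto simp: D_mat_def)

lemma M_carrier [simp]: "M \<in> carrier_mat p p"
  by (auto simp: M_c_def)

lemma D_dim [simp]: "dim_row D = p" "dim_col D = p" and M_dim [simp]: "dim_row M = p" "dim_col M = p"
  using carrier_matD[OF D_carrier] carrier_matD[OF M_carrier] by simp_all

lemma root_2: "p = 2 \<Longrightarrow> \<xi> = -1"
  using root_pow root_pow_eq_1_iff[of 1] by (auto simp: power2_eq_1_iff)

lemma D_index: "i < p \<Longrightarrow> j < p \<Longrightarrow> D $$ (i, j) = (if i = j then \<kappa> * \<xi> ^ i else 0)"
  using root_2 by (cases "p = 2") (auto simp: D_mat_def unimodular_scalar_def less_2_cases_iff)

lemma M_index: "i < p \<Longrightarrow> j < p \<Longrightarrow> M $$ (i, j) = (if i = Suc j mod p then \<kappa> else 0)"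
  by (cases "p = 2") (auto simp: M_c_def unimodular_scalar_def less_2_cases_iff)

lemma D_mult_index:
  assumes X: "X \<in> carrier_mat p p" and ij: "i < p" "j < p"
  shows "(D * X) $$ (i, j) = \<kappa> * \<xi> ^ i * X $$ (i, j)"
proof -
  have "(D * X) $$ (i, j) = (\<Sum>k = 0..<p. D $$ (i, k) * X $$ (k, j))"
    using X ij by (intro mult_mat_index_sum) auto
  also have "\<dots> = (\<Sum>k = 0..<p. if k = i then \<kappa> * \<xi> ^ i * X $$ (i, j) else 0)"
    using ij by (intro sum.cong) (auto simp: D_index)
  finally show ?thesis using ij by simp
qed

lemma mult_D_index:
  assumes X: "X \<in> carrier_mat p p" and ij: "i < p" "j < p"
  shows "(X * D) $$ (i, j) = X $$ (i, j) * (\<kappa> * \<xi> ^ j)"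
proof -
  have "(X * D) $$ (i, j) = (\<Sum>k = 0..<p. X $$ (i, k) * D $$ (k, j))"
    using X ij by (intro mult_mat_index_sum) auto
  also have "\<dots> = (\<Sum>k = 0..<p. if k = j then X $$ (i, j) * (\<kappa> * \<xi> ^ j) else 0)"
    using ij by (intro sum.cong) (auto simp: D_index)
  finally show ?thesis using ij by simp
qed

lemma mult_M_index:
  assumes X: "X \<in> carrier_mat p p" and ij: "i < p" "j < p"
  shows "(X * M) $$ (i, j) = \<kappa> * X $$ (i, Suc j mod p)"
proof -
  have "(X * M) $$ (i, j) = (\<Sum>k = 0..<p. X $$ (i, k) * M $$ (k, j))"
    using X ij by (intro mult_mat_index_sum) auto
  also have "\<dots> = (\<Sum>k = 0..<p. if k = Suc j mod p then \<kappa> * X $$ (i, Suc j mod p) else 0)"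
    using ij by (intro sum.cong) (auto simp: M_index)
  finally show ?thesis using p_pos by simp
qed

lemma Suc_mod_inj:
  assumes "i < p" "j < p" "Suc i mod p = Suc j mod p" shows "i = j"
  using assms by (auto simp: mod_Suc split: if_splits)

lemma M_mult_index:
  assumes X: "X \<in> carrier_mat p p" and ij: "i < p" "j < p"
  shows "(M * X) $$ (Suc i mod p, j) = \<kappa> * X $$ (i, j)"
proof -
  have "(M * X) $$ (Suc i mod p, j) = (\<Sum>k = 0..<p. M $$ (Suc i mod p, k) * X $$ (k, j))"
    using X ij p_pos by (intro mult_mat_index_sum) auto
  also have "\<dots> = (\<Sum>k = 0..<p. if k = i then \<kappa> * X $$ (i, j) else 0)"
  proof (rule sum.cong)
    fix k assume "k \<in> {0..<p}"
    then show "M $$ (Suc i mod p, k) * X $$ (k, j) = (if k = i then \<kappa> * X $$ (i, j) else 0)"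
      using ij p_pos Suc_mod_inj[of i k] by (auto simp: M_index)
  qed simp
  finally show ?thesis using ij by simp
qed

lemma D_M_commutation: "D * M = \<xi> \<cdot>\<^sub>m (M * D)"
proof (rule eq_matI)
  fix i j assume "i < dim_row (\<xi> \<cdot>\<^sub>m (M * D))" "j < dim_col (\<xi> \<cdot>\<^sub>m (M * D))"
  then have ij: "i < p" "j < p" by auto
  have MD: "M * D \<in> carrier_mat p p" by (rule mult_carrier_mat[OF M_carrier D_carrier])
  have "(D * M) $$ (i, j) = \<kappa> * \<xi> ^ i * M $$ (i, j)" by (rule D_mult_index[OF M_carrier ij])
  also have "\<dots> = \<xi> * (M $$ (i, j) * (\<kappa> * \<xi> ^ j))"
    using ij root_mod[of "Suc j"] by (simp add: M_index)
  also have "\<dots> = (\<xi> \<cdot>\<^sub>m (M * D)) $$ (i, j)"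
    using mult_D_index[OF M_carrier ij] index_smult_mat(1)[of i "M * D" j \<xi>] MD ij by simp
  finally show "(D * M) $$ (i, j) = (\<xi> \<cdot>\<^sub>m (M * D)) $$ (i, j)" .
qed auto

text \<open>The columns of \<open>P\<close> are eigenvectors of \<open>X\<close> for different eigenvalues. A linear relation \<open>x\<close> among them stays
a relation when its \<open>j\<close>-th coefficient is multiplied by \<open>\<xi>\<^sup>j\<^sup>k\<close>, and the discrete Fourier
transform of these relations isolates each single term.\<close>

lemma eigenvector_matrix_invertible:
  assumes X: "X \<in> carrier_mat p p" and P: "P \<in> carrier_mat p p" and a: "a \<noteq> 0"
    and XP: "X * P = a \<cdot>\<^sub>m (P * D)" and col: "\<And>j. j < p \<Longrightarrow> \<exists>i<p. P $$ (i, j) \<noteq> 0"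
  shows "det P \<noteq> 0"
proof
  assume "det P = 0"
  then obtain x where x: "x \<in> carrier_vec p" "x \<noteq> 0\<^sub>v p" "P *\<^sub>v x = 0\<^sub>v p"
    using det_0_iff_vec_prod_zero_field[OF P] by blast
  have entry: "(\<Sum>s = 0..<p. X $$ (r, s) * P $$ (s, j)) = a * (P $$ (r, j) * (\<kappa> * \<xi> ^ j))"
    if "r < p" "j < p" for r j
  proof -
    have "(\<Sum>s = 0..<p. X $$ (r, s) * P $$ (s, j)) = (X * P) $$ (r, j)"
      using mult_mat_index_sum[OF X P that] by simp
    also have "\<dots> = a * (P * D) $$ (r, j)"
      unfolding XP using that P by (intro index_smult_mat(1)) auto
    finally show ?thesis using mult_D_index[OF P that] by simp
  qed
  have van: "(\<Sum>j = 0..<p. P $$ (r, j) * (\<xi> ^ j) ^ k * x $ j) = 0" if "r < p" for r k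
    using that
  proof (induction k arbitrary: r)
    case 0
    have "(\<Sum>j = 0..<p. P $$ (r, j) * x $ j) = (P *\<^sub>v x) $ r"
      using P x(1) 0 by (simp add: scalar_prod_def)
    then show ?case using x(3) 0 by simp
  next
    case (Suc k)
    have "a * \<kappa> * (\<Sum>j = 0..<p. P $$ (r, j) * (\<xi> ^ j) ^ Suc k * x $ j) =
      (\<Sum>j = 0..<p. (a * (P $$ (r, j) * (\<kappa> * \<xi> ^ j))) * ((\<xi> ^ j) ^ k * x $ j))"
      by (simp add: sum_distrib_left algebra_simps)
    also have "\<dots> = (\<Sum>j = 0..<p. (\<Sum>s = 0..<p. X $$ (r, s) * P $$ (s, j)) * ((\<xi> ^ j) ^ k * x $ j))"
      using Suc.prems by (intro sum.cong) (simp_all add: entry)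
    also have "\<dots> = (\<Sum>j = 0..<p. \<Sum>s = 0..<p. X $$ (r, s) * (P $$ (s, j) * (\<xi> ^ j) ^ k * x $ j))"
      by (simp add: sum_distrib_right mult.assoc)
    also have "\<dots> = (\<Sum>s = 0..<p. X $$ (r, s) * (\<Sum>j = 0..<p. P $$ (s, j) * (\<xi> ^ j) ^ k * x $ j))"
      by (subst sum.swap) (simp add: sum_distrib_left)
    also have "\<dots> = 0" using Suc.IH by (intro sum.neutral) auto
    finally show ?case using a scalar_nonzero by simp
  qed
  have "P $$ (r, i) * x $ i = 0" if r: "r < p" and i: "i < p" for r i
  proof -
    have "0 = (\<Sum>k<p. (1 / \<xi> ^ i) ^ k * (\<Sum>j = 0..<p. P $$ (r, j) * (\<xi> ^ j) ^ k * x $ j))"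
      using van[OF r] by simp
    also have "\<dots> = (\<Sum>k<p. \<Sum>j = 0..<p. P $$ (r, j) * x $ j * (\<xi> ^ j / \<xi> ^ i) ^ k)"
      by (simp add: sum_distrib_left power_divide algebra_simps)
    also have "\<dots> = (\<Sum>j = 0..<p. P $$ (r, j) * x $ j * (\<Sum>k<p. (\<xi> ^ j / \<xi> ^ i) ^ k))"
      by (subst sum.swap) (simp add: sum_distrib_left)
    also have "\<dots> = (\<Sum>j = 0..<p. if j = i then P $$ (r, i) * x $ i * of_nat p else 0)"
      using i by (intro sum.cong) (auto simp: root_orthogonality)
    finally show ?thesis using i p_pos by simp
  qed
  then have "x $ i = 0" if "i < p" for i using col[OF that] that by auto
  then have "x = 0\<^sub>v p" using x(1) by (intro eq_vecI) auto
  then show False using x(2) by simp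
qed

lemma det_D: "det D = 1"
proof -
  have "det D = prod_list (diag_mat D)"
    by (rule det_upper_triangular[OF _ D_carrier])
      (simp add: upper_triangular_def D_index)
  also have "\<dots> = (\<Prod>i = 0..<p. D $$ (i, i))"
    by (simp add: diag_mat_def prod.distinct_set_conv_list[symmetric])
  also have "\<dots> = (\<Prod>i = 0..<p. \<kappa> * \<xi> ^ i)" by (intro prod.cong) (simp_all add: D_index)
  also have "\<dots> = \<kappa> ^ p * \<xi> ^ (\<Sum>{0..<p})" by (simp add: prod.distrib power_sum)
  also have "\<dots> = 1"
  proof (cases "p = 2")
    case True
    then have "{0..<p} = {0, 1}" by auto
    then show ?thesis using True root_2 by (simp add: unimodular_scalar_def)
  next
    case False
    then have "odd p" using prime prime_odd_nat[of p] p_gt_1 by auto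
    then obtain b where "p = 2 * b + 1" by (elim oddE)
    then have "p * (p - 1) = 2 * (p * b)" by simp
    then have "p * (p - 1) div 2 = p * b" by (metis nonzero_mult_div_cancel_left zero_neq_numeral)
    then have "p dvd p * (p - 1) div 2" by (metis dvd_triv_left)
    then have "p dvd \<Sum>{0..<p}" by (simp add: Sum_Ico_nat)
    then show ?thesis using False root_pow_eq_1_iff by (simp add: unimodular_scalar_def)
  qed
  finally show ?thesis .
qed

text \<open>The Fourier matrix \<open>F\<close> diagonalizes \<open>M\<close> to \<open>D\<close>, so the determinants agree.\<close>

lemma det_M: "det M = 1"
proof -
  define F where "F = mat p p (\<lambda>(i, k). (1 / \<xi> ^ k) ^ i)"
  have F: "F \<in> carrier_mat p p" by (simp add: F_def)
  have MF: "M * F = 1 \<cdot>\<^sub>m (F * D)"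
  proof (rule eq_matI)
    fix i k assume "i < dim_row (1 \<cdot>\<^sub>m (F * D))" "k < dim_col (1 \<cdot>\<^sub>m (F * D))"
    then have ik: "i < p" "k < p" using F by auto
    define j where "j = (i + (p - 1)) mod p"
    have j: "j < p" "Suc j mod p = i"
      using ik p_pos by (auto simp: j_def mod_Suc_eq)
    let ?e = "1 / \<xi> ^ k"
    have ep: "?e ^ p = 1" by (metis div_by_1 mult.commute power_mult power_one power_one_over root_pow)
    have "?e ^ (Suc j mod p) = ?e ^ Suc j"
      using ep by (metis mult.left_neutral mult_div_mod_eq power_add power_mult power_one)
    then have e: "?e ^ i = ?e ^ j * ?e" using j by simp
    have "(M * F) $$ (i, k) = \<kappa> * F $$ (j, k)" using M_mult_index[OF F j(1) ik(2)] j(2) by simp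
    also have "\<dots> = F $$ (i, k) * (\<kappa> * \<xi> ^ k)" using ik j e root_nonzero by (simp add: F_def)
    also have "\<dots> = (F * D) $$ (i, k)" using mult_D_index[OF F ik] by simp
    also have "\<dots> = (1 \<cdot>\<^sub>m (F * D)) $$ (i, k)"
      using ik F index_smult_mat(1)[of i "F * D" k 1] by simp
    finally show "(M * F) $$ (i, k) = (1 \<cdot>\<^sub>m (F * D)) $$ (i, k)" .
  qed (use F in auto)
  have "det F \<noteq> 0"
    by (rule eigenvector_matrix_invertible[OF M_carrier F _ MF])
      (use root_nonzero in \<open>auto simp: F_def\<close>)
  moreover have "det M * det F = det F * det D"
    using det_mult[OF M_carrier F] det_mult[OF F D_carrier] MF by (auto simp: F_def)
  ultimately show ?thesis using det_D by auto
qed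

lemma D_SL: "D \<in> carrier (SL p)" and M_SL: "M \<in> carrier (SL p)"
  by (simp_all add: SL_carrier_iff det_D det_M)

lemma commutes_D_iff_diagonal:
  assumes X: "X \<in> carrier_mat p p"
  shows "X * D = D * X \<longleftrightarrow> diagonal_mat X"
proof
  assume "X * D = D * X"
  then have eq: "X $$ (i, j) * (\<kappa> * \<xi> ^ j) = \<kappa> * \<xi> ^ i * X $$ (i, j)" if "i < p" "j < p" for i j
    using mult_D_index[OF X that] D_mult_index[OF X that] by metis
  have "X $$ (i, j) = 0" if ij: "i < p" "j < p" "i \<noteq> j" for i j
  proof -
    have "\<xi> ^ i \<noteq> \<xi> ^ j" using ij root_inj by (auto simp: inj_on_def)
    moreover have "\<kappa> * X $$ (i, j) * (\<xi> ^ j - \<xi> ^ i) = 0" using eq[OF ij(1,2)] by (simp add: algebra_simps)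
    ultimately show ?thesis using scalar_nonzero by simp
  qed
  then show "diagonal_mat X" using X by (simp add: diagonal_mat_def)
next
  assume diag: "diagonal_mat X"
  have XD: "X * D \<in> carrier_mat p p" "D * X \<in> carrier_mat p p"
    using X by (auto intro: mult_carrier_mat[OF X D_carrier] mult_carrier_mat[OF D_carrier X])
  show "X * D = D * X"
  proof (rule eq_matI)
    fix i j assume "i < dim_row (D * X)" "j < dim_col (D * X)"
    then have ij: "i < p" "j < p" using XD by auto
    show "(X * D) $$ (i, j) = (D * X) $$ (i, j)"
      unfolding mult_D_index[OF X ij] D_mult_index[OF X ij]
      using diag X ij by (cases "i = j") (auto simp: diagonal_mat_def)
  qed (use XD in auto)
qed

lemma diagonal_commutes_M_scalar:
  assumes X: "X \<in> carrier_mat p p" and diag: "diagonal_mat X" and comm: "X * M = M * X"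
  shows "\<exists>c. X = c \<cdot>\<^sub>m 1\<^sub>m p"
proof -
  have shift: "X $$ (Suc j mod p, Suc j mod p) = X $$ (j, j)" if "j < p" for j
    using mult_M_index[OF X _ that, of "Suc j mod p"] M_mult_index[OF X that that] comm p_pos scalar_nonzero
    by simp
  have const: "X $$ (j, j) = X $$ (0, 0)" if "j < p" for j
    using that
  proof (induction j)
    case (Suc j)
    then show ?case using shift[of j] by simp
  qed simp
  have "X = X $$ (0, 0) \<cdot>\<^sub>m 1\<^sub>m p"
  proof (rule eq_matI)
    fix i j assume "i < dim_row (X $$ (0, 0) \<cdot>\<^sub>m 1\<^sub>m p)" "j < dim_col (X $$ (0, 0) \<cdot>\<^sub>m 1\<^sub>m p)"
    then have ij: "i < p" "j < p" by auto
    show "X $$ (i, j) = (X $$ (0, 0) \<cdot>\<^sub>m 1\<^sub>m p) $$ (i, j)"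
    proof (cases "i = j")
      case True
      then show ?thesis using const[OF ij(2)] ij by simp
    next
      case False
      then show ?thesis using diag X ij by (simp add: diagonal_mat_def)
    qed
  qed (use X in auto)
  then show ?thesis by blast
qed

text \<open>If \<open>v\<close> is an eigenvector of \<open>g\<close>, then \<open>u k = A\<^sup>k v\<close> is one for the eigenvalue \<open>l \<xi>\<^sup>k\<close>. The vectors
\<open>u 0, \<dots>, u (p - 1)\<close> form a basis, and \<open>u p\<close> is a multiple \<open>c v\<close> because it belongs to the
eigenvalue \<open>l\<close> again. Dividing \<open>u j\<close> by \<open>s\<^sup>j\<close> with \<open>s\<^sup>p = c\<close> closes the cycle, so that \<open>A\<close> acts as
\<open>s\<close> times the cyclic permutation.\<close>

theorem commuting_pair_normal_form:
  assumes g: "g \<in> carrier (SL p)" and A: "A \<in> carrier (SL p)" and gA: "g * A = \<xi> \<cdot>\<^sub>m (A * g)"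
  shows "\<exists>P \<in> carrier (SL p). \<exists>a b. g * P = a \<cdot>\<^sub>m (P * D) \<and> A * P = b \<cdot>\<^sub>m (P * M)"
proof -
  have gc: "g \<in> carrier_mat p p" and Ac: "A \<in> carrier_mat p p" using g A SL_carrier_mat by auto
  have inj: "v = 0\<^sub>v p" if "X \<in> carrier (SL p)" "v \<in> carrier_vec p" "X *\<^sub>v v = 0\<^sub>v p" for X v
    using det_0_iff_vec_prod_zero_field[of X p] that by (auto simp: SL_carrier_iff)
  obtain l where "eigenvalue g l" using spectrum_non_empty[OF gc] p_pos by (auto simp: spectrum_def)
  then obtain v where v: "v \<in> carrier_vec p" "v \<noteq> 0\<^sub>v p" "g *\<^sub>v v = l \<cdot>\<^sub>v v"
    using gc by (auto simp: eigenvalue_def eigenvector_def)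
  have l: "l \<noteq> 0"
  proof
    assume "l = 0"
    then have "g *\<^sub>v v = 0\<^sub>v p" using v by (auto intro!: eq_vecI)
    then show False using inj[OF g v(1)] v(2) by blast
  qed
  define u where "u = (\<lambda>k. ((\<lambda>w. A *\<^sub>v w) ^^ k) v)"
  have u0: "u 0 = v" and uS: "u (Suc k) = A *\<^sub>v u k" for k by (simp_all add: u_def)
  have uc: "u k \<in> carrier_vec p" for k by (induction k) (use v Ac u0 uS in auto)
  have une: "u k \<noteq> 0\<^sub>v p" for k
    by (induction k) (use v u0 uS inj[OF A uc] in auto)
  have gu: "g *\<^sub>v u k = (l * \<xi> ^ k) \<cdot>\<^sub>v u k" for k
  proof (induction k)
    case 0
    then show ?case using v u0 by simp
  next
    case (Suc k)
    have "g *\<^sub>v u (Suc k) = (g * A) *\<^sub>v u k" using gc Ac uc uS by simp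
    also have "\<dots> = \<xi> \<cdot>\<^sub>v ((A * g) *\<^sub>v u k)" unfolding gA using gc Ac uc by (intro smult_mat_mult_vec) auto
    also have "(A * g) *\<^sub>v u k = A *\<^sub>v ((l * \<xi> ^ k) \<cdot>\<^sub>v u k)" using gc Ac uc Suc by simp
    also have "\<dots> = (l * \<xi> ^ k) \<cdot>\<^sub>v u (Suc k)" using mult_mat_vec[OF Ac uc] uS by simp
    finally show ?case by (simp add: smult_smult_assoc mult.left_commute)
  qed
  have columns: "g * P = (l / \<kappa>) \<cdot>\<^sub>m (P * D) \<and> det P \<noteq> 0"
    if P: "P = mat p p (\<lambda>(r, j). s ^ j * u j $ r)" and s: "s \<noteq> 0" for P s
  proof
    have Pc: "P \<in> carrier_mat p p" by (simp add: P)
    show gP: "g * P = (l / \<kappa>) \<cdot>\<^sub>m (P * D)"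
    proof (rule eq_matI)
      fix r j assume "r < dim_row ((l / \<kappa>) \<cdot>\<^sub>m (P * D))" "j < dim_col ((l / \<kappa>) \<cdot>\<^sub>m (P * D))"
      then have rj: "r < p" "j < p" using Pc by auto
      have "(g * P) $$ (r, j) = (\<Sum>k = 0..<p. g $$ (r, k) * P $$ (k, j))"
        by (rule mult_mat_index_sum[OF gc Pc rj])
      also have "\<dots> = s ^ j * (g *\<^sub>v u j) $ r"
        using gc uc[of j] rj by (simp add: P scalar_prod_def sum_distrib_left algebra_simps)
      also have "\<dots> = (l / \<kappa>) * (P * D) $$ (r, j)"
        using mult_D_index[OF Pc rj] rj scalar_nonzero uc[of j] by (simp add: gu P)
      also have "\<dots> = ((l / \<kappa>) \<cdot>\<^sub>m (P * D)) $$ (r, j)"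
        using rj Pc by (intro index_smult_mat(1)[symmetric]) auto
      finally show "(g * P) $$ (r, j) = ((l / \<kappa>) \<cdot>\<^sub>m (P * D)) $$ (r, j)" .
    qed (use gc Pc in auto)
    show "det P \<noteq> 0"
    proof (rule eigenvector_matrix_invertible[OF gc Pc _ gP])
      show "l / \<kappa> \<noteq> 0" using l scalar_nonzero by simp
      fix j assume j: "j < p"
      have "\<exists>r<p. u j $ r \<noteq> 0"
      proof (rule ccontr)
        assume "\<not> ?thesis"
        then have "u j = 0\<^sub>v p" using uc[of j] by (intro eq_vecI) auto
        then show False using une by blast
      qed
      then show "\<exists>r<p. P $$ (r, j) \<noteq> 0" using j s by (auto simp: P)
    qed
  qed
  obtain c where c: "u p = c \<cdot>\<^sub>v v"
  proof -
    define P where "P = mat p p (\<lambda>(r, j). 1 ^ j * u j $ r)"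
    have P: "P \<in> carrier_mat p p" and gP: "g * P = (l / \<kappa>) \<cdot>\<^sub>m (P * D)" and dP: "det P \<noteq> 0"
      using columns[OF P_def] by (auto simp: P_def)
    define x where "x = (1 / det P) \<cdot>\<^sub>v (adj_mat P *\<^sub>v u p)"
    have adj: "adj_mat P \<in> carrier_mat p p" by (rule adj_mat(1)[OF P])
    have x: "x \<in> carrier_vec p" using adj uc by (simp add: x_def)
    have "P *\<^sub>v (adj_mat P *\<^sub>v u p) = (det P \<cdot>\<^sub>m 1\<^sub>m p) *\<^sub>v u p"
      using assoc_mult_mat_vec[OF P adj uc[of p]] adj_mat(2)[OF P] by simp
    also have "\<dots> = det P \<cdot>\<^sub>v u p" using uc[of p] by (intro eq_vecI) auto
    finally have "P *\<^sub>v (adj_mat P *\<^sub>v u p) = det P \<cdot>\<^sub>v u p" .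
    then have Px: "P *\<^sub>v x = u p"
      using mult_mat_vec[OF P, of "adj_mat P *\<^sub>v u p" "1 / det P"] adj uc[of p] dP
      by (simp add: x_def smult_smult_assoc)
    define y where "y = (1 / \<kappa>) \<cdot>\<^sub>v (D *\<^sub>v x)"
    have Dx: "D *\<^sub>v x \<in> carrier_vec p" using mult_mat_vec_carrier[OF D_carrier x] .
    have y: "y \<in> carrier_vec p" using Dx by (simp add: y_def)
    have yi: "y $ i = \<xi> ^ i * x $ i" if "i < p" for i
    proof -
      have "(D *\<^sub>v x) $ i = (\<Sum>k = 0..<p. D $$ (i, k) * x $ k)"
        using that x by (simp add: scalar_prod_def)
      also have "\<dots> = (\<Sum>k = 0..<p. if k = i then \<kappa> * \<xi> ^ i * x $ i else 0)"
        using that by (intro sum.cong) (auto simp: D_index)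
      finally show ?thesis using that Dx scalar_nonzero by (simp add: y_def)
    qed
    have "l \<cdot>\<^sub>v u p = g *\<^sub>v (P *\<^sub>v x)" using gu[of p] root_pow Px by simp
    also have "\<dots> = ((l / \<kappa>) \<cdot>\<^sub>m (P * D)) *\<^sub>v x" using gP assoc_mult_mat_vec[OF gc P x] by simp
    also have "\<dots> = (l / \<kappa>) \<cdot>\<^sub>v ((P * D) *\<^sub>v x)"
      by (rule smult_mat_mult_vec[OF mult_carrier_mat[OF P D_carrier] x])
    also have "(P * D) *\<^sub>v x = P *\<^sub>v (D *\<^sub>v x)" by (rule assoc_mult_mat_vec[OF P D_carrier x])
    also have "(l / \<kappa>) \<cdot>\<^sub>v (P *\<^sub>v (D *\<^sub>v x)) = l \<cdot>\<^sub>v (P *\<^sub>v y)"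
      using mult_mat_vec[OF P Dx, of "1 / \<kappa>"] by (simp add: y_def smult_smult_assoc)
    finally have "(1 / l) \<cdot>\<^sub>v (l \<cdot>\<^sub>v u p) = (1 / l) \<cdot>\<^sub>v (l \<cdot>\<^sub>v (P *\<^sub>v y))" by simp
    then have "P *\<^sub>v x = P *\<^sub>v y" using l Px by (simp add: smult_smult_assoc)
    then have "P *\<^sub>v (x - y) = 0\<^sub>v p"
      using mult_minus_distrib_mat_vec[OF P x y] P y by simp
    moreover have "x - y \<in> carrier_vec p" using x y by simp
    ultimately have "x - y = 0\<^sub>v p" using det_0_iff_vec_prod_zero_field[OF P] dP by blast
    then have "(x - y) $ i = 0" if "i < p" for i using that by simp
    then have "x $ i = \<xi> ^ i * x $ i" if "i < p" for i using that x y yi by auto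
    moreover have "\<xi> ^ i \<noteq> 1" if "i < p" "i \<noteq> 0" for i
      using that root_pow_eq_1_iff by (auto dest: dvd_imp_le)
    ultimately have x0: "x $ i = 0" if "i < p" "i \<noteq> 0" for i using that by force
    have "u p = x $ 0 \<cdot>\<^sub>v v"
    proof (rule eq_vecI)
      fix r assume "r < dim_vec (x $ 0 \<cdot>\<^sub>v v)"
      then have r: "r < p" using v by simp
      have "u p $ r = (\<Sum>k = 0..<p. P $$ (r, k) * x $ k)"
        unfolding Px[symmetric] using r P x by (simp add: scalar_prod_def)
      also have "\<dots> = (\<Sum>k = 0..<p. if k = 0 then P $$ (r, 0) * x $ 0 else 0)"
        by (intro sum.cong) (auto simp: x0)
      also have "\<dots> = (x $ 0 \<cdot>\<^sub>v v) $ r" using r p_pos v by (simp add: P_def u0)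
      finally show "u p $ r = (x $ 0 \<cdot>\<^sub>v v) $ r" .
    qed (use uc[of p] v in auto)
    then show thesis by (rule that)
  qed
  obtain s where s: "s ^ p = c" using nth_root_exists[of p c] p_pos by blast
  have "c \<noteq> 0"
  proof
    assume "c = 0"
    then have "u p = 0\<^sub>v p" using c v by (auto intro!: eq_vecI)
    then show False using une by blast
  qed
  then have s0: "s \<noteq> 0" using s p_pos by (auto simp: power_0_left)
  define P where "P = mat p p (\<lambda>(r, j). (1 / s) ^ j * u j $ r)"
  have P: "P \<in> carrier_mat p p" and gP: "g * P = (l / \<kappa>) \<cdot>\<^sub>m (P * D)" and dP: "det P \<noteq> 0"
    using columns[OF P_def] s0 by (auto simp: P_def)
  have AP: "A * P = (s / \<kappa>) \<cdot>\<^sub>m (P * M)"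
  proof (rule eq_matI)
    fix r j assume "r < dim_row ((s / \<kappa>) \<cdot>\<^sub>m (P * M))" "j < dim_col ((s / \<kappa>) \<cdot>\<^sub>m (P * M))"
    then have rj: "r < p" "j < p" using P by auto
    have "(A * P) $$ (r, j) = (\<Sum>k = 0..<p. A $$ (r, k) * P $$ (k, j))"
      by (rule mult_mat_index_sum[OF Ac P rj])
    also have "\<dots> = (1 / s) ^ j * u (Suc j) $ r"
      using Ac uc[of j] rj by (simp add: P_def uS scalar_prod_def sum_distrib_left algebra_simps)
    also have "\<dots> = s * P $$ (r, Suc j mod p)"
    proof (cases "Suc j = p")
      case True
      have "s ^ j * s = c" using s True by (metis power_Suc2)
      then have "(1 / s) ^ j * c = s" using s0 by (simp add: power_one_over field_simps)
      then show ?thesis using True c v rj p_pos by (simp add: P_def u0)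
    next
      case False
      then have "Suc j < p" using rj by simp
      then show ?thesis using rj s0 by (simp add: P_def)
    qed
    also have "\<dots> = (s / \<kappa>) * (P * M) $$ (r, j)" using mult_M_index[OF P rj] scalar_nonzero by simp
    also have "\<dots> = ((s / \<kappa>) \<cdot>\<^sub>m (P * M)) $$ (r, j)"
      using rj P by (intro index_smult_mat(1)[symmetric]) auto
    finally show "(A * P) $$ (r, j) = ((s / \<kappa>) \<cdot>\<^sub>m (P * M)) $$ (r, j)" .
  qed (use Ac P in auto)
  obtain t where t: "t \<cdot>\<^sub>m P \<in> carrier (SL p)" using scale_to_SL[OF P dP p_pos] by blast
  have swap: "a \<cdot>\<^sub>m (b \<cdot>\<^sub>m X) = b \<cdot>\<^sub>m (a \<cdot>\<^sub>m X)" for a b :: complex and X by (rule eq_matI) auto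
  have "g * (t \<cdot>\<^sub>m P) = (l / \<kappa>) \<cdot>\<^sub>m ((t \<cdot>\<^sub>m P) * D)" "A * (t \<cdot>\<^sub>m P) = (s / \<kappa>) \<cdot>\<^sub>m ((t \<cdot>\<^sub>m P) * M)"
    using gP AP mult_smult_distrib[OF gc P, of t] mult_smult_distrib[OF Ac P, of t]
      mult_smult_assoc_mat[OF P D_carrier, of t] mult_smult_assoc_mat[OF P M_carrier, of t]
    by (simp_all add: swap)
  then show ?thesis using t by blast
qed

end

section \<open>Groups generated by a torus part and a cyclic permutation\<close>

lemma (in group) int_pow_mod:
  assumes x: "x \<in> carrier G" and "x [^] p = \<one>"
  shows "x [^] (k mod int p) = x [^] k"
proof -
  have "x [^] (int p * (k div int p)) = \<one>"
    using assms by (metis int_pow_int int_pow_one int_pow_pow)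
  then have "x [^] (int p * (k div int p) + k mod int p) = x [^] (k mod int p)"
    using x by (simp only: int_pow_mult) simp
  then show ?thesis by simp
qed

lemma (in group) prime_order_generator:
  assumes x: "x \<in> carrier G" and p: "prime p" "x [^] p = \<one>" and k: "\<not> int p dvd k"
  shows "\<exists>m :: int. (x [^] k) [^] m = x"
proof -
  have "coprime (int p) k" using p k by (intro prime_imp_coprime) auto
  then obtain a b where "a * int p + b * k = 1" by (metis bezout_int coprime_iff_gcd_eq_1)
  then have "k * b mod int p = 1 mod int p" by (metis mod_mult_self3 mult.commute)
  then have "x [^] (k * b) = x"
    using int_pow_mod[OF x p(2), of "k * b"] int_pow_mod[OF x p(2), of 1] x by simp
  then show ?thesis using x by (metis int_pow_pow)
qed

lemma (in group) prime_order_pow_eq_1_iff: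
  assumes x: "x \<in> carrier G" and p: "prime p" "x [^] p = \<one>" and "x \<noteq> \<one>"
  shows "x [^] (k :: int) = \<one> \<longleftrightarrow> int p dvd k"
proof
  assume "x [^] k = \<one>"
  then show "int p dvd k" using prime_order_generator[OF x p, of k] assms(4) by auto
next
  assume "int p dvd k"
  then show "x [^] k = \<one>" using int_pow_mod[OF x p(2), of k] by simp
qed

lemma (in group) commute_int_pow:
  assumes x: "x \<in> carrier G" and y: "y \<in> carrier G" and "x \<otimes> y = y \<otimes> x"
  shows "x \<otimes> y [^] (k :: int) = y [^] k \<otimes> x"
proof -
  have nat: "x \<otimes> y [^] (n :: nat) = y [^] n \<otimes> x" for n
  proof (induction n)
    case (Suc n)
    have "x \<otimes> y [^] Suc n = (x \<otimes> y [^] n) \<otimes> y" using x y by (simp add: m_assoc)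
    also have "\<dots> = y [^] n \<otimes> (x \<otimes> y)" using Suc x y by (simp add: m_assoc)
    also have "\<dots> = y [^] Suc n \<otimes> x" using x y assms(3) by (simp add: m_assoc)
    finally show ?case .
  qed (use x in simp)
  show ?thesis
  proof (cases k)
    case (nonneg n)
    then show ?thesis using nat by (simp add: int_pow_int)
  next
    case (neg n)
    have "x \<otimes> inv (y [^] Suc n) = inv (y [^] Suc n) \<otimes> x"
      using nat[of "Suc n"] x y by (metis inv_closed inv_solve_left inv_solve_right m_assoc m_closed nat_pow_closed)
    then show ?thesis using neg y by (simp only: int_pow_neg_int)
  qed
qed

lemma (in group) cyclic_subgroup_iso:
  assumes x: "x \<in> carrier G" and p: "prime p" "x [^] p = \<one>" and "x \<noteq> \<one>"
  shows "G\<lparr>carrier := generate G {x}\<rparr> \<cong> integer_mod_group p"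
proof -
  note pow1 = prime_order_pow_eq_1_iff[OF x p assms(4)]
  have pc: "carrier (integer_mod_group p) = {0..<int p}"
    using p by (auto simp: carrier_integer_mod_group)
  have "(\<lambda>k. x [^] k) \<in> iso (integer_mod_group p) (G\<lparr>carrier := generate G {x}\<rparr>)"
  proof (rule isoI)
    show "(\<lambda>k. x [^] k) \<in> hom (integer_mod_group p) (G\<lparr>carrier := generate G {x}\<rparr>)"
      using x p by (auto simp: hom_def generate_pow int_pow_mod int_pow_mult)
    have "inj_on (\<lambda>k. x [^] k) {0..<int p}"
    proof (rule inj_onI)
      fix a b assume ab: "a \<in> {0..<int p}" "b \<in> {0..<int p}" "x [^] a = x [^] b"
      then have "x [^] (a - b) = \<one>" using x by (simp add: int_pow_diff)
      then have "int p dvd a - b" using pow1 by simp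
      then show "a = b" using ab
        by (metis atLeastLessThan_iff mod_eq_dvd_iff mod_pos_pos_trivial)
    qed
    moreover have "(\<lambda>k. x [^] k) ` {0..<int p} = generate G {x}"
    proof -
      have "x [^] k \<in> (\<lambda>k. x [^] k) ` {0..<int p}" for k :: int
        using p int_pow_mod[OF x p(2), of k] prime_gt_0_nat
        by (intro image_eqI[of _ _ "k mod int p"]) auto
      then show ?thesis using generate_pow[OF x] by auto
    qed
    ultimately show "bij_betw (\<lambda>k. x [^] k) (carrier (integer_mod_group p)) (carrier (G\<lparr>carrier := generate G {x}\<rparr>))"
      unfolding pc by (simp add: bij_betw_def)
  qed
  then have "integer_mod_group p \<cong> G\<lparr>carrier := generate G {x}\<rparr>" by (rule is_isoI)
  then show ?thesis using group.iso_sym[OF group_integer_mod_group] by blast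
qed

text \<open>The properties of \<open>PSL\<close> from which the classification follows by pure group theory; \<open>T\<close> is the
group of diagonal classes.\<close>

locale torus_pair = group G for G (structure) +
  fixes p :: nat and \<delta> \<mu> :: 'a and T :: "'a set"
  assumes prime: "prime p"
    and T_subgroup: "subgroup T G"
    and T_comm: "\<And>s t. s \<in> T \<Longrightarrow> t \<in> T \<Longrightarrow> s \<otimes> t = t \<otimes> s"
    and \<delta>_T: "\<delta> \<in> T" and \<delta>_order: "\<delta> [^] p = \<one>" "\<delta> \<noteq> \<one>"
    and \<mu>_closed: "\<mu> \<in> carrier G" and \<mu>_order: "\<mu> [^] p = \<one>" "\<mu> \<noteq> \<one>"
    and comm: "\<delta> \<otimes> \<mu> = \<mu> \<otimes> \<delta>"
    and normalizes: "\<And>t. t \<in> T \<Longrightarrow> \<mu> \<otimes> t \<otimes> inv \<mu> \<in> T"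
    and centralizer_\<delta>: "\<And>x. x \<in> carrier G \<Longrightarrow> x \<otimes> \<delta> = \<delta> \<otimes> x \<Longrightarrow> \<exists>k :: nat. x \<otimes> \<mu> [^] k \<in> T"
    and fixed_by_\<mu>: "\<And>t. t \<in> T \<Longrightarrow> t \<otimes> \<mu> = \<mu> \<otimes> t \<Longrightarrow> t \<in> generate G {\<delta>}"
    and T_meets_\<mu>: "\<And>k :: int. \<mu> [^] k \<in> T \<Longrightarrow> \<mu> [^] k = \<one>"
begin

lemma T_closed: "t \<in> T \<Longrightarrow> t \<in> carrier G"
  using subgroup.mem_carrier[OF T_subgroup] .

lemma \<delta>_closed: "\<delta> \<in> carrier G"
  using \<delta>_T T_closed by blast

abbreviation "Q \<equiv> generate G {\<mu>}"
abbreviation "R \<equiv> generate G {\<delta>}"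

lemma Q_eq: "Q = {\<mu> [^] (k :: int) | k. True}" and R_eq: "R = {\<delta> [^] (k :: int) | k. True}"
  using generate_pow[OF \<mu>_closed] generate_pow[OF \<delta>_closed] by auto

lemma R_subset_T: "R \<subseteq> T"
  using generate_subgroup_incl[OF _ T_subgroup] \<delta>_T by simp

lemma Q_subgroup: "subgroup Q G" and R_subgroup: "subgroup R G"
  using generate_is_subgroup \<mu>_closed \<delta>_closed by auto

lemma Q_normalizes_T:
  assumes "q \<in> Q" "t \<in> T" shows "q \<otimes> t \<otimes> inv q \<in> T"
proof -
  obtain k :: int where k: "q = \<mu> [^] k" using assms(1) Q_eq by auto
  have nat: "\<mu> [^] n \<otimes> t \<otimes> inv (\<mu> [^] n) \<in> T" for n :: nat
  proof (induction n)
    case 0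
    then show ?case using assms(2) T_closed by simp
  next
    case (Suc n)
    have tc: "t \<in> carrier G" using assms(2) T_closed by blast
    have "\<mu> [^] Suc n = \<mu> \<otimes> \<mu> [^] n" by (rule nat_pow_Suc2[OF \<mu>_closed])
    then have "\<mu> [^] Suc n \<otimes> t \<otimes> inv (\<mu> [^] Suc n) = \<mu> \<otimes> (\<mu> [^] n \<otimes> t \<otimes> inv (\<mu> [^] n)) \<otimes> inv \<mu>"
      using \<mu>_closed tc by (simp add: m_assoc inv_mult_group)
    then show ?case using normalizes[OF Suc] by simp
  qed
  have "k mod int p \<ge> 0" using prime prime_gt_0_nat by simp
  then have "q = \<mu> [^] (nat (k mod int p))"
    using k int_pow_mod[OF \<mu>_closed \<mu>_order(1), of k] by (metis int_nat_eq int_pow_int)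
  then show ?thesis using nat by metis
qed

lemma T_inter_Q: "T \<inter> Q = {\<one>}"
  using T_meets_\<mu> Q_eq subgroup.one_closed[OF T_subgroup] subgroup.one_closed[OF Q_subgroup] by auto

context
  fixes H
  assumes H: "subgroup H G" and \<mu>_H: "\<mu> \<in> H" and H_centralizes_\<delta>: "\<And>h. h \<in> H \<Longrightarrow> h \<otimes> \<delta> = \<delta> \<otimes> h"
    and Z_centralizes_\<delta>: "\<And>x. x \<in> group_centralizer G H \<Longrightarrow> x \<otimes> \<delta> = \<delta> \<otimes> x"
begin

lemma H_closed: "h \<in> H \<Longrightarrow> h \<in> carrier G"
  using subgroup.mem_carrier[OF H] .

lemma Q_subset_H: "Q \<subseteq> H"
  using generate_subgroup_incl[OF _ H] \<mu>_H by simp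

lemma K_subgroup: "subgroup (H \<inter> T) G"
  using subgroups_Inter_pair[OF H T_subgroup] .

lemma H_decomposition: "(H \<inter> T) <#> Q = H"
proof
  show "(H \<inter> T) <#> Q \<subseteq> H"
    using Q_subset_H subgroup.m_closed[OF H] by (auto simp: set_mult_def)
  show "H \<subseteq> (H \<inter> T) <#> Q"
  proof
    fix h assume h: "h \<in> H"
    obtain k :: nat where k: "h \<otimes> \<mu> [^] k \<in> T"
      using centralizer_\<delta>[OF H_closed[OF h] H_centralizes_\<delta>[OF h]] by blast
    have q: "\<mu> [^] k \<in> Q" using Q_eq int_pow_int[of G \<mu> k] by (metis (mono_tags, lifting) mem_Collect_eq)
    then have "h \<otimes> \<mu> [^] k \<in> H \<inter> T" using k h Q_subset_H subgroup.m_closed[OF H] by blast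
    moreover have "inv (\<mu> [^] k) \<in> Q" using subgroup.m_inv_closed[OF Q_subgroup q] .
    moreover have "h = (h \<otimes> \<mu> [^] k) \<otimes> inv (\<mu> [^] k)"
      using H_closed[OF h] \<mu>_closed by (simp add: m_assoc)
    ultimately show "h \<in> (H \<inter> T) <#> Q" unfolding set_mult_def by blast
  qed
qed

lemma H_normalizes_T:
  assumes "h \<in> H" "t \<in> T" shows "h \<otimes> t \<otimes> inv h \<in> T"
proof -
  obtain s q where sq: "s \<in> T" "q \<in> Q" "h = s \<otimes> q"
    using assms(1) H_decomposition unfolding set_mult_def by blast
  have c: "s \<in> carrier G" "q \<in> carrier G" "t \<in> carrier G"
    using sq assms T_closed subgroup.mem_carrier[OF Q_subgroup] by auto
  have "h \<otimes> t \<otimes> inv h = s \<otimes> (q \<otimes> t \<otimes> inv q) \<otimes> inv s"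
    using c sq by (simp add: m_assoc inv_mult_group)
  moreover have "q \<otimes> t \<otimes> inv q \<in> T" using Q_normalizes_T sq assms by blast
  ultimately show ?thesis
    using sq subgroup.m_closed[OF T_subgroup] subgroup.m_inv_closed[OF T_subgroup] by metis
qed

lemma K_conj_invariant: "conj_invariant G Q (H \<inter> T)"
proof -
  have sub: "q \<otimes> t \<otimes> inv q \<in> H \<inter> T" if "q \<in> Q" "t \<in> H \<inter> T" for q t
  proof
    have "q \<in> H" using that Q_subset_H by blast
    then show "q \<otimes> t \<otimes> inv q \<in> H" "q \<otimes> t \<otimes> inv q \<in> T"
      using that H_normalizes_T subgroup.m_closed[OF H] subgroup.m_inv_closed[OF H] by simp_all
  qed
  have "t \<in> conj_set G q (H \<inter> T)" if q: "q \<in> Q" and t: "t \<in> H \<inter> T" for q t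
  proof -
    have c: "q \<in> carrier G" "t \<in> carrier G" using q t subgroup.mem_carrier[OF Q_subgroup] T_closed by auto
    have "inv q \<otimes> t \<otimes> inv (inv q) \<in> H \<inter> T"
      using sub[OF subgroup.m_inv_closed[OF Q_subgroup q] t] .
    moreover have "t = q \<otimes> (inv q \<otimes> t \<otimes> inv (inv q)) \<otimes> inv q"
      using c by (simp add: m_assoc) (simp add: m_assoc[symmetric])
    ultimately show ?thesis unfolding conj_set_def by (rule image_eqI[rotated])
  qed
  then have "conj_set G q (H \<inter> T) = H \<inter> T" if "q \<in> Q" for q
    using sub that by (auto simp: conj_set_def)
  then show ?thesis unfolding conj_invariant_def by blast
qed

lemma normal_in_H:
  assumes N: "subgroup N G" "N \<subseteq> H" and inv: "\<And>h n. h \<in> H \<Longrightarrow> n \<in> N \<Longrightarrow> h \<otimes> n \<otimes> inv h \<in> N"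
  shows "N \<lhd> G\<lparr>carrier := H\<rparr>"
proof -
  have grp: "group (G\<lparr>carrier := H\<rparr>)" using subgroup.subgroup_is_group[OF H group_axioms] .
  have "subgroup N (G\<lparr>carrier := H\<rparr>)" using subgroup_incl[OF N(1) H N(2)] .
  then show ?thesis
    using group.normal_inv_iff[OF grp] inv m_inv_consistent[OF H] by auto
qed

lemma K_semidirect: "internal_semidirect G (H \<inter> T) Q"
  unfolding internal_semidirect_def H_decomposition
proof (intro conjI)
  show "subgroup H G" by (rule H)
  show "H \<inter> T \<lhd> G\<lparr>carrier := H\<rparr>"
    using H_normalizes_T subgroup.m_closed[OF H] subgroup.m_inv_closed[OF H]
    by (intro normal_in_H K_subgroup) auto
  show "subgroup Q (G\<lparr>carrier := H\<rparr>)" using subgroup_incl[OF Q_subgroup H Q_subset_H] .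
  show "H \<inter> T \<inter> Q = {\<one>}" using T_inter_Q subgroup.one_closed[OF H] by blast
qed

text \<open>As \<open>x\<close> centralizes both \<open>\<delta>\<close> and \<open>\<mu>\<close>, its diagonal part is fixed by \<open>\<mu>\<close>.\<close>

lemma centralizer_decomposition:
  assumes x: "x \<in> group_centralizer G H"
  shows "\<exists>k :: int. x \<otimes> \<mu> [^] k \<in> R"
proof -
  have xc: "x \<in> carrier G" and xh: "\<And>h. h \<in> H \<Longrightarrow> x \<otimes> h = h \<otimes> x"
    using x by (auto simp: group_centralizer_def)
  obtain k :: nat where k: "x \<otimes> \<mu> [^] k \<in> T" using centralizer_\<delta>[OF xc Z_centralizes_\<delta>[OF x]] by blast
  have "(x \<otimes> \<mu> [^] k) \<otimes> \<mu> = x \<otimes> (\<mu> \<otimes> \<mu> [^] k)"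
    using xc \<mu>_closed nat_pow_Suc2[OF \<mu>_closed, of k] by (simp add: m_assoc)
  also have "\<dots> = \<mu> \<otimes> (x \<otimes> \<mu> [^] k)"
    using xh[OF \<mu>_H] xc \<mu>_closed by (simp add: m_assoc[symmetric])
  finally have "x \<otimes> \<mu> [^] k \<in> R" using fixed_by_\<mu>[OF k] by blast
  then have "x \<otimes> \<mu> [^] (int k) \<in> R" by (simp add: int_pow_int)
  then show ?thesis by blast
qed

text \<open>Here \<open>H\<close> is generated by the commuting elements \<open>\<delta>\<close> and \<open>\<mu>\<close>, so it is abelian, and
\<open>centralizer_decomposition\<close> puts its centralizer back into \<open>H\<close>.\<close>

lemma self_centralizing_case:
  assumes K: "H \<inter> T = R"
  shows "group_centralizer G H = H" "internal_direct G R Q" "R <#> Q = H"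
    "G\<lparr>carrier := H\<rparr> \<cong> integer_mod_group p \<times>\<times> integer_mod_group p"
proof -
  show RQ: "R <#> Q = H" using H_decomposition K by simp
  have generates: "H \<subseteq> group_centralizer G S"
    if "S \<subseteq> carrier G" "\<delta> \<in> group_centralizer G S" "\<mu> \<in> group_centralizer G S" for S
  proof -
    note C = centralizer_subgroup[OF that(1)]
    have "R \<subseteq> group_centralizer G S" "Q \<subseteq> group_centralizer G S"
      using that generate_subgroup_incl[OF _ C] by simp_all
    then show ?thesis unfolding RQ[symmetric] set_mult_def using subgroup.m_closed[OF C] by blast
  qed
  have "H \<subseteq> group_centralizer G {\<mu>}"
    using generates[of "{\<mu>}"] comm \<delta>_closed \<mu>_closed by (simp add: group_centralizer_def)
  then have "\<mu> \<in> group_centralizer G H" using \<mu>_closed by (auto simp: group_centralizer_def subset_iff)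
  moreover have "\<delta> \<in> group_centralizer G H"
    using H_centralizes_\<delta> \<delta>_closed by (simp add: group_centralizer_def)
  ultimately have HZ: "H \<subseteq> group_centralizer G H" using generates H_closed by blast
  have RH: "R \<subseteq> H" using K by blast
  show "group_centralizer G H = H"
  proof
    show "H \<subseteq> group_centralizer G H" by (rule HZ)
    show "group_centralizer G H \<subseteq> H"
    proof
      fix x assume x: "x \<in> group_centralizer G H"
      then have xc: "x \<in> carrier G" and xh: "\<And>h. h \<in> H \<Longrightarrow> x \<otimes> h = h \<otimes> x"
        by (auto simp: group_centralizer_def)
      obtain k :: int where k: "x \<otimes> \<mu> [^] k \<in> R" using centralizer_decomposition[OF x] by blast
      have "\<mu> [^] k \<in> H" using subgroup_int_pow_closed[OF H \<mu>_H] .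
      moreover have "x = (x \<otimes> \<mu> [^] k) \<otimes> inv (\<mu> [^] k)"
        using xc \<mu>_closed by (simp add: m_assoc)
      ultimately show "x \<in> H"
        using k RH subgroup.m_closed[OF H] subgroup.m_inv_closed[OF H] by (metis subsetD)
    qed
  qed
  have normalQ: "Q \<lhd> G\<lparr>carrier := H\<rparr>"
  proof (rule normal_in_H[OF Q_subgroup Q_subset_H])
    fix h q assume hq: "h \<in> H" "q \<in> Q"
    then have "h \<otimes> q = q \<otimes> h" using HZ Q_subset_H by (auto simp: group_centralizer_def)
    then have "h \<otimes> q \<otimes> inv h = q" using hq Q_subset_H H_closed by (auto simp: m_assoc)
    then show "h \<otimes> q \<otimes> inv h \<in> Q" using hq by simp
  qed
  then show "internal_direct G R Q"
    using K_semidirect unfolding K internal_direct_def RQ by blast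
  have R_normal: "R \<lhd> G\<lparr>carrier := H\<rparr>"
    using K_semidirect unfolding K internal_semidirect_def RQ by blast
  have grp: "group (G\<lparr>carrier := S\<rparr>)" if "subgroup S G" for S
    using subgroup.subgroup_is_group[OF that group_axioms] .
  have gen: "subgroup_generated (G\<lparr>carrier := H\<rparr>) S = G\<lparr>carrier := S\<rparr>" if "S \<lhd> G\<lparr>carrier := H\<rparr>" for S
    using subgroup.carrier_subgroup_generated_subgroup[OF normal_imp_subgroup[OF that]]
    by (simp add: subgroup_generated_def)
  have "R \<inter> Q \<subseteq> {\<one>}" using T_inter_Q R_subset_T by blast
  then have "(\<lambda>(x, y). x \<otimes> y) \<in> iso (G\<lparr>carrier := R\<rparr> \<times>\<times> G\<lparr>carrier := Q\<rparr>) (G\<lparr>carrier := H\<rparr>)"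
    using group.iso_group_mul_gen[OF grp[OF H] R_normal normalQ] RQ gen[OF R_normal] gen[OF normalQ] by simp
  then have "G\<lparr>carrier := H\<rparr> \<cong> G\<lparr>carrier := R\<rparr> \<times>\<times> G\<lparr>carrier := Q\<rparr>"
    using group.iso_sym[OF DirProd_group[OF grp[OF R_subgroup] grp[OF Q_subgroup]]] is_isoI by blast
  moreover have "G\<lparr>carrier := R\<rparr> \<times>\<times> G\<lparr>carrier := Q\<rparr> \<cong> integer_mod_group p \<times>\<times> integer_mod_group p"
    using group.DirProd_iso_set_trans[OF grp[OF R_subgroup]]
      cyclic_subgroup_iso[OF \<delta>_closed prime \<delta>_order] cyclic_subgroup_iso[OF \<mu>_closed prime \<mu>_order]
    unfolding is_iso_def by blast
  ultimately show "G\<lparr>carrier := H\<rparr> \<cong> integer_mod_group p \<times>\<times> integer_mod_group p" by (rule iso_trans)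
qed

text \<open>As \<open>H\<close> exceeds \<open>Q\<close>, the group \<open>K = H \<inter> T\<close> is not trivial, and as \<open>R\<close> has prime order, \<open>K\<close>
contains some \<open>t0\<close> outside \<open>R\<close>. If an element of the centralizer had a
non-trivial component \<open>\<mu>\<^sup>k\<close>, this component would commute with \<open>t0\<close>, and so would
\<open>\<mu>\<close>, which is a power of it; but \<open>\<mu>\<close> fixes nothing in \<open>T\<close> outside \<open>R\<close>.\<close>

lemma cyclic_centralizer_case:
  assumes K: "H \<inter> T \<noteq> R" and Q: "H \<noteq> Q"
  shows "group_centralizer G H = R" "H \<inter> T \<noteq> {\<one>}"
proof -
  show nontriv: "H \<inter> T \<noteq> {\<one>}"
  proof
    assume "H \<inter> T = {\<one>}"
    then have "H = {\<one>} <#> Q" using H_decomposition by simp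
    also have "\<dots> = Q" using subgroup.mem_carrier[OF Q_subgroup] by (force simp: set_mult_def)
    finally show False using Q by simp
  qed
  have not_sub: "\<not> H \<inter> T \<subseteq> R"
  proof
    assume sub: "H \<inter> T \<subseteq> R"
    obtain t where t: "t \<in> H \<inter> T" "t \<noteq> \<one>" using nontriv subgroup.one_closed[OF K_subgroup] by blast
    then obtain k :: int where k: "t = \<delta> [^] k" using sub R_eq by auto
    then have "\<not> int p dvd k" using t(2) prime_order_pow_eq_1_iff[OF \<delta>_closed prime \<delta>_order] by blast
    then obtain m :: int where "\<delta> = t [^] m" using prime_order_generator[OF \<delta>_closed prime \<delta>_order(1)] k by metis
    then have "\<delta> \<in> H \<inter> T" using subgroup_int_pow_closed[OF K_subgroup] t by metis
    then have "R \<subseteq> H \<inter> T" using generate_subgroup_incl[OF _ K_subgroup] by blast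
    then show False using sub K by blast
  qed
  show "group_centralizer G H = R"
  proof
    show "R \<subseteq> group_centralizer G H"
    proof
      fix r assume "r \<in> R"
      then obtain k :: int where k: "r = \<delta> [^] k" using R_eq by auto
      have "h \<otimes> r = r \<otimes> h" if "h \<in> H" for h
        unfolding k by (rule commute_int_pow[OF H_closed[OF that] \<delta>_closed H_centralizes_\<delta>[OF that]])
      then show "r \<in> group_centralizer G H" using k \<delta>_closed by (auto simp: group_centralizer_def)
    qed
    show "group_centralizer G H \<subseteq> R"
    proof
      fix x assume x: "x \<in> group_centralizer G H"
      then have xc: "x \<in> carrier G" and xh: "\<And>h. h \<in> H \<Longrightarrow> x \<otimes> h = h \<otimes> x"
        by (auto simp: group_centralizer_def)
      obtain t0 where t0: "t0 \<in> H" "t0 \<in> T" "t0 \<notin> R" using not_sub by blast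
      have t0c: "t0 \<in> carrier G" using t0 T_closed by blast
      obtain k :: int where k: "x \<otimes> \<mu> [^] k \<in> R" using centralizer_decomposition[OF x] by blast
      have m: "\<mu> [^] k \<in> carrier G" using \<mu>_closed by simp
      have "\<mu> [^] k = \<one>"
      proof (rule ccontr)
        assume "\<mu> [^] k \<noteq> \<one>"
        then have "\<not> int p dvd k" using prime_order_pow_eq_1_iff[OF \<mu>_closed prime \<mu>_order] by blast
        then obtain m :: int where m': "(\<mu> [^] k) [^] m = \<mu>"
          using prime_order_generator[OF \<mu>_closed prime \<mu>_order(1)] by blast
        have "x \<otimes> (t0 \<otimes> \<mu> [^] k) = t0 \<otimes> (x \<otimes> \<mu> [^] k)"
          using xh[OF t0(1)] xc t0c m by (simp add: m_assoc[symmetric])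
        also have "\<dots> = (x \<otimes> \<mu> [^] k) \<otimes> t0" using T_comm[OF t0(2)] k R_subset_T by blast
        also have "\<dots> = x \<otimes> (\<mu> [^] k \<otimes> t0)" using xc t0c m by (simp add: m_assoc)
        finally have "t0 \<otimes> \<mu> [^] k = \<mu> [^] k \<otimes> t0" using xc t0c m by simp
        then have "t0 \<otimes> \<mu> = \<mu> \<otimes> t0" using commute_int_pow[OF t0c m, of m] m' by simp
        then show False using fixed_by_\<mu>[OF t0(2)] t0(3) by blast
      qed
      then show "x \<in> R" using k xc by simp
    qed
  qed
qed

end

end

section \<open>The pair D, M in PSL\<close>

context prime_root
begin

abbreviation "\<delta> \<equiv> to_PSL p D"
abbreviation "\<mu> \<equiv> to_PSL p M"

lemma D_bar_eq_commutant: "D_bar p = commutant_image p D"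
  using commutes_D_iff_diagonal SL_carrier_mat unfolding D_bar_def commutant_image_def by blast

lemma M_D_commutation: "M * D = (1 / \<xi>) \<cdot>\<^sub>m (D * M)"
  unfolding D_M_commutation by (simp add: smult_smult_mat root_nonzero one_smult_mat)

text \<open>Commutation with \<open>D\<close> makes the matrix diagonal, and commutation with \<open>M\<close> makes its entries equal. This
evaluates powers of \<open>D\<close> and \<open>M\<close> in \<open>PSL\<close> without computing their entries.\<close>

lemma commutes_D_M_scalar:
  assumes B: "B \<in> carrier (SL p)" and "B * D = D * B" "B * M = M * B"
  shows "to_PSL p B = \<one>\<^bsub>PSL p\<^esub>"
  using diagonal_commutes_M_scalar[OF SL_carrier_mat[OF B]] commutes_D_iff_diagonal[OF SL_carrier_mat[OF B]]
    to_PSL_eq_one_iff[OF B] assms by blast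

lemma D_power_lift:
  obtains B where "B \<in> carrier (SL p)" "to_PSL p B = \<delta> [^]\<^bsub>PSL p\<^esub> (k :: nat)" "D * B = B * D"
    "M * B = (1 / \<xi>) ^ k \<cdot>\<^sub>m (B * M)"
proof -
  have "D * D = 1 \<cdot>\<^sub>m (D * D)" by (simp only: one_smult_mat)
  from twisted_power_lift[OF D_SL D_carrier M_carrier this M_D_commutation, of k]
  show thesis using that by (auto simp: one_smult_mat)
qed

lemma M_power_lift:
  obtains B where "B \<in> carrier (SL p)" "to_PSL p B = \<mu> [^]\<^bsub>PSL p\<^esub> (k :: nat)" "M * B = B * M"
    "D * B = \<xi> ^ k \<cdot>\<^sub>m (B * D)"
proof -
  have "M * M = 1 \<cdot>\<^sub>m (M * M)" by (simp only: one_smult_mat)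
  from twisted_power_lift[OF M_SL M_carrier D_carrier this D_M_commutation, of k]
  show thesis using that by (auto simp: one_smult_mat)
qed

lemma root_not_one: "\<xi> \<noteq> 1"
  using root_pow_eq_1_iff[of 1] p_gt_1 by auto

lemma \<delta>_pow: "\<delta> [^]\<^bsub>PSL p\<^esub> p = \<one>\<^bsub>PSL p\<^esub>"
proof -
  obtain B where B: "B \<in> carrier (SL p)" "to_PSL p B = \<delta> [^]\<^bsub>PSL p\<^esub> p" "D * B = B * D"
    "M * B = (1 / \<xi>) ^ p \<cdot>\<^sub>m (B * M)" by (rule D_power_lift)
  have "(1 / \<xi>) ^ p = 1" using root_pow by (simp add: power_one_over)
  then have "M * B = B * M" using B(4) by (simp only: one_smult_mat)
  then show ?thesis using commutes_D_M_scalar[OF B(1)] B(2,3) by simp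
qed

lemma \<mu>_pow: "\<mu> [^]\<^bsub>PSL p\<^esub> p = \<one>\<^bsub>PSL p\<^esub>"
proof -
  obtain B where B: "B \<in> carrier (SL p)" "to_PSL p B = \<mu> [^]\<^bsub>PSL p\<^esub> p" "M * B = B * M"
    "D * B = \<xi> ^ p \<cdot>\<^sub>m (B * D)" by (rule M_power_lift)
  then have "D * B = B * D" using root_pow by (simp only: one_smult_mat)
  then show ?thesis using commutes_D_M_scalar[OF B(1)] B(2,3) by simp
qed

lemma \<delta>_not_one: "\<delta> \<noteq> \<one>\<^bsub>PSL p\<^esub>"
proof
  assume "\<delta> = \<one>\<^bsub>PSL p\<^esub>"
  then obtain c where c: "D = c \<cdot>\<^sub>m 1\<^sub>m p" using to_PSL_eq_one_iff[OF D_SL] by blast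
  have "D $$ (0, 0) = c" "D $$ (1, 1) = c" unfolding c using p_gt_1 by auto
  then have "\<kappa> * \<xi> = \<kappa>" using p_gt_1 by (simp add: D_index)
  then show False using scalar_nonzero root_not_one by simp
qed

lemma \<mu>_not_one: "\<mu> \<noteq> \<one>\<^bsub>PSL p\<^esub>"
proof
  assume "\<mu> = \<one>\<^bsub>PSL p\<^esub>"
  then obtain c where c: "M = c \<cdot>\<^sub>m 1\<^sub>m p" using to_PSL_eq_one_iff[OF M_SL] by blast
  have "M $$ (1, 0) = 0" unfolding c using p_gt_1 by auto
  then show False using M_index[of 1 0] p_gt_1 scalar_nonzero by simp
qed

lemma twist_is_root_power:
  assumes A: "A \<in> carrier (SL p)" and B: "B \<in> carrier (SL p)" and AB: "A * B = c \<cdot>\<^sub>m (B * A)"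
  obtains k where "k < p" "c = \<xi> ^ k"
proof -
  have "det (A * B) = c ^ p * det (B * A)"
    unfolding AB using carrier_matD[OF mult_carrier_mat[OF SL_carrier_mat[OF B] SL_carrier_mat[OF A]]] by simp
  then have "c ^ p = 1" using SL_mult_closed[OF A B] SL_mult_closed[OF B A] by (simp add: SL_carrier_iff)
  then show thesis using root_of_unity_pow that by blast
qed

text \<open>The structural properties follow by adjusting a matrix by a power of \<open>D\<close> or \<open>M\<close> until its twist with respect to \<open>M\<close> or \<open>D\<close>
is \<open>1\<close>, which is possible because every twist is a power of \<open>\<xi>\<close>.\<close>

sublocale PSL: torus_pair "PSL p" p \<delta> \<mu> "D_bar p"
proof (intro torus_pair.intro torus_pair_axioms.intro group_PSL)
  interpret G: group "PSL p" by (rule group_PSL)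
  show "prime p" by (rule prime)
  show "subgroup (D_bar p) (PSL p)"
    unfolding D_bar_eq_commutant by (rule commutant_image_subgroup[OF D_carrier])
  show "\<delta> \<in> D_bar p" unfolding D_bar_eq_commutant commutant_image_def using D_SL by blast
  show "\<delta> [^]\<^bsub>PSL p\<^esub> p = \<one>\<^bsub>PSL p\<^esub>" by (rule \<delta>_pow)
  show "\<delta> \<noteq> \<one>\<^bsub>PSL p\<^esub>" by (rule \<delta>_not_one)
  show \<mu>c: "\<mu> \<in> carrier (PSL p)" using to_PSL_closed[OF M_SL] .
  show "\<mu> [^]\<^bsub>PSL p\<^esub> p = \<one>\<^bsub>PSL p\<^esub>" by (rule \<mu>_pow)
  show "\<mu> \<noteq> \<one>\<^bsub>PSL p\<^esub>" by (rule \<mu>_not_one)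
  show "\<delta> \<otimes>\<^bsub>PSL p\<^esub> \<mu> = \<mu> \<otimes>\<^bsub>PSL p\<^esub> \<delta>" using to_PSL_commute_iff[OF D_SL M_SL] D_M_commutation by blast
  fix t assume "t \<in> D_bar p"
  then obtain A where A: "A \<in> carrier (SL p)" "diagonal_mat A" "t = to_PSL p A" by (auto simp: D_bar_def)
  note Ac = SL_carrier_mat[OF A(1)]
  have AD: "A * D = D * A" using commutes_D_iff_diagonal[OF Ac] A(2) by blast
  {
    fix s assume "s \<in> D_bar p"
    then obtain B where B: "B \<in> carrier (SL p)" "diagonal_mat B" "s = to_PSL p B" by (auto simp: D_bar_def)
    show "s \<otimes>\<^bsub>PSL p\<^esub> t = t \<otimes>\<^bsub>PSL p\<^esub> s"
      using diagonal_commute[OF Ac SL_carrier_mat[OF B(1)] A(2) B(2)] to_PSL_mult[OF A(1) B(1)] to_PSL_mult[OF B(1) A(1)]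
        A(3) B(3) by metis
  next
    show "\<mu> \<otimes>\<^bsub>PSL p\<^esub> t \<otimes>\<^bsub>PSL p\<^esub> inv\<^bsub>PSL p\<^esub> \<mu> \<in> D_bar p"
    proof -
      obtain N where N: "N \<in> carrier (SL p)" "M * N = 1\<^sub>m p" "N * M = 1\<^sub>m p" using SL_inverse[OF M_SL] .
      note Nc = SL_carrier_mat[OF N(1)]
      have DN: "D * N = (1 / \<xi>) \<cdot>\<^sub>m (N * D)"
        by (rule twisted_inverse[OF D_carrier M_carrier Nc D_M_commutation N(2,3) root_nonzero])
      have "D * A = 1 \<cdot>\<^sub>m (A * D)" using AD by (simp only: one_smult_mat)
      from twisted_mult[OF D_carrier M_carrier Ac D_M_commutation this]
      have "D * (M * A) = \<xi> \<cdot>\<^sub>m (M * A * D)" by simp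
      from twisted_mult[OF D_carrier mult_carrier_mat[OF M_carrier Ac] Nc this DN]
      moreover have "\<xi> * (1 / \<xi>) = 1" using root_nonzero by simp
      ultimately have "D * (M * A * N) = M * A * N * D" by (simp only: one_smult_mat)
      moreover have S: "M * A * N \<in> carrier (SL p)" using SL_mult_closed M_SL A(1) N(1) by blast
      ultimately have "to_PSL p (M * A * N) \<in> D_bar p"
        unfolding D_bar_eq_commutant mem_commutant_image_iff[OF S D_carrier] by simp
      then show ?thesis
        using to_PSL_mult[OF SL_mult_closed[OF M_SL A(1)] N(1)] to_PSL_mult[OF M_SL A(1)]
          to_PSL_inv[OF M_SL N(1,2)] A(3) by simp
    qed
  next
    assume "t \<otimes>\<^bsub>PSL p\<^esub> \<mu> = \<mu> \<otimes>\<^bsub>PSL p\<^esub> t"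
    then obtain c where c: "M * A = c \<cdot>\<^sub>m (A * M)" using to_PSL_commute_iff[OF M_SL A(1)] A(3) by metis
    obtain k where k: "k < p" "c = \<xi> ^ k" by (rule twist_is_root_power[OF M_SL A(1) c])
    obtain B where B: "B \<in> carrier (SL p)" "to_PSL p B = \<delta> [^]\<^bsub>PSL p\<^esub> k" "D * B = B * D"
      "M * B = (1 / \<xi>) ^ k \<cdot>\<^sub>m (B * M)" by (rule D_power_lift)
    note Bc = SL_carrier_mat[OF B(1)]
    have ck: "c * (1 / \<xi>) ^ k = 1" using k root_nonzero by (simp add: power_one_over)
    have "M * (A * B) = (c * (1 / \<xi>) ^ k) \<cdot>\<^sub>m (A * B * M)" by (rule twisted_mult[OF M_carrier Ac Bc c B(4)])
    then have 1: "A * B * M = M * (A * B)" by (simp only: ck one_smult_mat)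
    have "D * A = 1 \<cdot>\<^sub>m (A * D)" "D * B = 1 \<cdot>\<^sub>m (B * D)" using AD B(3) by (simp_all only: one_smult_mat)
    then have 2: "A * B * D = D * (A * B)"
      using twisted_mult[OF D_carrier Ac Bc, of 1 1] by (simp only: one_smult_mat mult_1)
    have tk: "t \<otimes>\<^bsub>PSL p\<^esub> \<delta> [^]\<^bsub>PSL p\<^esub> k = \<one>\<^bsub>PSL p\<^esub>"
      using commutes_D_M_scalar[OF SL_mult_closed[OF A(1) B(1)] 2 1] to_PSL_mult[OF A(1) B(1)] A(3) B(2) by simp
    have \<delta>c: "\<delta> \<in> carrier (PSL p)" "t \<in> carrier (PSL p)" using to_PSL_closed D_SL A by auto
    then have "t = inv\<^bsub>PSL p\<^esub> (\<delta> [^]\<^bsub>PSL p\<^esub> k)" using G.inv_equality[OF tk] by simp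
    also have "\<dots> = \<delta> [^]\<^bsub>PSL p\<^esub> (- int k)" using \<delta>c by (simp add: G.int_pow_neg_int)
    finally show "t \<in> generate (PSL p) {\<delta>}" using G.generate_pow[OF \<delta>c(1)] by blast
  }
next
  fix x assume x: "x \<in> carrier (PSL p)" and "x \<otimes>\<^bsub>PSL p\<^esub> \<delta> = \<delta> \<otimes>\<^bsub>PSL p\<^esub> x"
  then obtain A c where A: "A \<in> carrier (SL p)" "x = to_PSL p A" and c: "D * A = c \<cdot>\<^sub>m (A * D)"
    using carrier_PSL[of p] to_PSL_commute_iff[OF D_SL] by (smt (verit) imageE)
  obtain k where k: "k < p" "c = \<xi> ^ k" by (rule twist_is_root_power[OF D_SL A(1) c])
  obtain B where B: "B \<in> carrier (SL p)" "to_PSL p B = \<mu> [^]\<^bsub>PSL p\<^esub> (p - k)" "M * B = B * M"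
    "D * B = \<xi> ^ (p - k) \<cdot>\<^sub>m (B * D)" by (rule M_power_lift)
  have "c * \<xi> ^ (p - k) = 1" using k root_pow by (simp flip: power_add)
  then have "D * (A * B) = A * B * D"
    using twisted_mult[OF D_carrier SL_carrier_mat[OF A(1)] SL_carrier_mat[OF B(1)] c B(4)] by (simp only: one_smult_mat)
  then have "to_PSL p (A * B) \<in> D_bar p"
    unfolding D_bar_eq_commutant mem_commutant_image_iff[OF SL_mult_closed[OF A(1) B(1)] D_carrier] by simp
  then show "\<exists>k :: nat. x \<otimes>\<^bsub>PSL p\<^esub> \<mu> [^]\<^bsub>PSL p\<^esub> k \<in> D_bar p"
    using to_PSL_mult[OF A(1) B(1)] A(2) B(2) by auto
next
  interpret G: group "PSL p" by (rule group_PSL)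
  fix k :: int assume mem: "\<mu> [^]\<^bsub>PSL p\<^esub> k \<in> D_bar p"
  have \<mu>c: "\<mu> \<in> carrier (PSL p)" using to_PSL_closed[OF M_SL] .
  define j where "j = nat (k mod int p)"
  have j: "\<mu> [^]\<^bsub>PSL p\<^esub> k = \<mu> [^]\<^bsub>PSL p\<^esub> j"
    using G.int_pow_mod[OF \<mu>c \<mu>_pow, of k] p_pos by (simp add: j_def flip: int_pow_int)
  obtain B where B: "B \<in> carrier (SL p)" "to_PSL p B = \<mu> [^]\<^bsub>PSL p\<^esub> j" "M * B = B * M"
    "D * B = \<xi> ^ j \<cdot>\<^sub>m (B * D)" by (rule M_power_lift)
  have "to_PSL p B \<in> commutant_image p D" using mem j B(2) D_bar_eq_commutant by simp
  then have BD: "B * D = D * B" using mem_commutant_image_iff[OF B(1) D_carrier] by blast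
  then show "\<mu> [^]\<^bsub>PSL p\<^esub> k = \<one>\<^bsub>PSL p\<^esub>"
    using commutes_D_M_scalar[OF B(1) BD] B(2,3) j by simp
qed

text \<open>By Schur's lemma some \<open>A\<close> over \<open>H\<close> has a non-trivial twist with \<open>g\<close>. As \<open>p\<close> is prime, this twist generates the
\<open>p\<close>-th roots of unity, so a power of \<open>A\<close> has twist \<open>\<xi>\<close>.\<close>

lemma bad_twisted_pair:
  assumes irr: "irreducible_subgroup p H" and z: "z \<in> group_centralizer (PSL p) H" "z \<noteq> \<one>\<^bsub>PSL p\<^esub>"
  obtains g A where "g \<in> carrier (SL p)" "z = to_PSL p g" "A \<in> carrier (SL p)" "to_PSL p A \<in> H"
    "g * A = \<xi> \<cdot>\<^sub>m (A * g)"
proof -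
  have H: "subgroup H (PSL p)" using irr by (simp add: irreducible_subgroup_def)
  obtain g where g: "g \<in> carrier (SL p)" "z = to_PSL p g"
    using z(1) carrier_PSL by (auto simp: group_centralizer_def)
  note gc = SL_carrier_mat[OF g(1)]
  have "\<not> H \<subseteq> commutant_image p g" using irreducible_not_in_commutant[OF irr g(1)] z(2) g(2) by simp
  then obtain h where h: "h \<in> H" "h \<notin> commutant_image p g" by blast
  then obtain A where A: "A \<in> carrier (SL p)" "h = to_PSL p A"
    using subgroup.mem_carrier[OF H] carrier_PSL by blast
  have ne: "A * g \<noteq> g * A" using h A mem_commutant_image_iff[OF A(1) gc] by simp
  obtain c where c: "g * A = c \<cdot>\<^sub>m (A * g)"
    using z(1) h A g to_PSL_commute_iff[OF g(1) A(1)] by (auto simp: group_centralizer_def)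
  obtain k where k: "k < p" "c = \<xi> ^ k" by (rule twist_is_root_power[OF g(1) A(1) c])
  have "k \<noteq> 0"
  proof
    assume "k = 0"
    then have "g * A = A * g" using c k(2) by (simp only: power_0 one_smult_mat)
    then show False using ne by simp
  qed
  then have "coprime k p" using k(1) prime by (metis coprime_commute dvd_imp_le linorder_not_less neq0_conv prime_imp_coprime)
  then obtain m where m: "[k * m = Suc 0] (mod p)" using cong_solve_coprime_nat by blast
  have "c ^ m = \<xi> ^ (k * m mod p)" by (simp add: k(2) power_mult root_mod)
  also have "\<dots> = \<xi>" using m p_gt_1 by (simp add: cong_def)
  finally have cm: "c ^ m = \<xi>" .
  obtain B where B: "B \<in> carrier (SL p)" "to_PSL p B = to_PSL p A [^]\<^bsub>PSL p\<^esub> m" "g * B = c ^ m \<cdot>\<^sub>m (B * g)"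
    using twisted_power_lift[OF A(1) gc gc c c, of m] by blast
  have "to_PSL p B \<in> H"
    unfolding B(2) int_pow_int[symmetric] using PSL.subgroup_int_pow_closed[OF H h(1)] A(2) by simp
  then show thesis using that[OF g B(1)] B(3) cm by simp
qed

end

section \<open>Conjugation of subgroups\<close>

abbreviation conj_by :: "('a, 'b) monoid_scheme \<Rightarrow> 'a \<Rightarrow> 'a \<Rightarrow> 'a" where
  "conj_by G g h \<equiv> g \<otimes>\<^bsub>G\<^esub> h \<otimes>\<^bsub>G\<^esub> inv\<^bsub>G\<^esub> g"

lemma (in group) conj_hom:
  assumes "g \<in> carrier G" "a \<in> carrier G" "b \<in> carrier G"
  shows "(g \<otimes> a \<otimes> inv g) \<otimes> (g \<otimes> b \<otimes> inv g) = g \<otimes> (a \<otimes> b) \<otimes> inv g"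
proof -
  have "inv g \<otimes> (g \<otimes> c) = c" if "c \<in> carrier G" for c
    using assms(1) that by (simp add: m_assoc[symmetric])
  then show ?thesis using assms by (simp add: m_assoc)
qed

lemma (in group) conj_eq_iff:
  assumes "g \<in> carrier G" "a \<in> carrier G" "b \<in> carrier G"
  shows "g \<otimes> a \<otimes> inv g = g \<otimes> b \<otimes> inv g \<longleftrightarrow> a = b"
  using assms by simp

lemma (in group) conj_cancel:
  assumes "g \<in> carrier G" "a \<in> carrier G"
  shows "g \<otimes> (inv g \<otimes> a \<otimes> inv (inv g)) \<otimes> inv g = a" "inv g \<otimes> (g \<otimes> a \<otimes> inv g) \<otimes> inv (inv g) = a"
  using assms by (simp_all add: m_assoc) (simp_all add: m_assoc[symmetric])

lemma (in group) conj_set_cancel: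
  assumes g: "g \<in> carrier G" and S: "S \<subseteq> carrier G"
  shows "conj_set G g (conj_set G (inv g) S) = S"
proof -
  have "conj_set G g (conj_set G (inv g) S) = (\<lambda>a. g \<otimes> (inv g \<otimes> a \<otimes> inv (inv g)) \<otimes> inv g) ` S"
    by (simp add: conj_set_def image_image)
  also have "\<dots> = (\<lambda>a. a) ` S" using conj_cancel(1)[OF g] S by (intro image_cong) auto
  finally show ?thesis by simp
qed

lemma (in group) conj_set_subgroup:
  assumes g: "g \<in> carrier G" and S: "subgroup S G"
  shows "subgroup (conj_set G g S) G"
proof (rule subgroupI)
  have c: "s \<in> carrier G" if "s \<in> S" for s using subgroup.mem_carrier[OF S that] .
  show "conj_set G g S \<subseteq> carrier G" using g c by (auto simp: conj_set_def)
  show "conj_set G g S \<noteq> {}" using subgroup.one_closed[OF S] by (auto simp: conj_set_def)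
  fix a assume "a \<in> conj_set G g S"
  then obtain s where s: "s \<in> S" "a = g \<otimes> s \<otimes> inv g" by (auto simp: conj_set_def)
  have "inv a = g \<otimes> inv s \<otimes> inv g" using s g c by (simp add: inv_mult_group m_assoc)
  then show "inv a \<in> conj_set G g S" using subgroup.m_inv_closed[OF S s(1)] by (auto simp: conj_set_def)
  fix b assume "b \<in> conj_set G g S"
  then obtain t where t: "t \<in> S" "b = g \<otimes> t \<otimes> inv g" by (auto simp: conj_set_def)
  have "a \<otimes> b = g \<otimes> (s \<otimes> t) \<otimes> inv g" using conj_hom[OF g c c] s t by simp
  then show "a \<otimes> b \<in> conj_set G g S" using subgroup.m_closed[OF S s(1) t(1)] by (auto simp: conj_set_def)
qed

lemma (in group) centralizer_conj_set:
  assumes g: "g \<in> carrier G" and S: "S \<subseteq> carrier G"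
  shows "group_centralizer G (conj_set G g S) = conj_set G g (group_centralizer G S)"
proof
  have comm: "(g \<otimes> a \<otimes> inv g) \<otimes> (g \<otimes> s \<otimes> inv g) = (g \<otimes> s \<otimes> inv g) \<otimes> (g \<otimes> a \<otimes> inv g) \<longleftrightarrow>
      a \<otimes> s = s \<otimes> a" if "a \<in> carrier G" "s \<in> S" for a s
  proof -
    have sc: "s \<in> carrier G" using that S by blast
    show ?thesis
      unfolding conj_hom[OF g that(1) sc] conj_hom[OF g sc that(1)]
      using conj_eq_iff[OF g m_closed[OF that(1) sc] m_closed[OF sc that(1)]] .
  qed
  show "conj_set G g (group_centralizer G S) \<subseteq> group_centralizer G (conj_set G g S)"
  proof
    fix x assume "x \<in> conj_set G g (group_centralizer G S)"
    then obtain a where a: "a \<in> carrier G" "\<And>s. s \<in> S \<Longrightarrow> a \<otimes> s = s \<otimes> a" "x = g \<otimes> a \<otimes> inv g"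
      by (auto simp: conj_set_def group_centralizer_def)
    then show "x \<in> group_centralizer G (conj_set G g S)"
      using comm[OF a(1)] g by (auto simp: conj_set_def group_centralizer_def)
  qed
  show "group_centralizer G (conj_set G g S) \<subseteq> conj_set G g (group_centralizer G S)"
  proof
    fix x assume x: "x \<in> group_centralizer G (conj_set G g S)"
    then have xc: "x \<in> carrier G" by (simp add: group_centralizer_def)
    define a where "a = inv g \<otimes> x \<otimes> inv (inv g)"
    have a: "a \<in> carrier G" "x = g \<otimes> a \<otimes> inv g"
      using conj_cancel(1)[OF g xc] g xc by (auto simp: a_def)
    have "a \<otimes> s = s \<otimes> a" if "s \<in> S" for s
    proof -
      have "x \<otimes> (g \<otimes> s \<otimes> inv g) = (g \<otimes> s \<otimes> inv g) \<otimes> x"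
        using x that by (simp add: group_centralizer_def conj_set_def)
      then show ?thesis using comm[OF a(1) that] unfolding a(2)[symmetric] by blast
    qed
    then show "x \<in> conj_set G g (group_centralizer G S)"
      using a by (auto simp: conj_set_def group_centralizer_def)
  qed
qed

lemma (in group) conj_set_iso:
  assumes g: "g \<in> carrier G" and S: "subgroup S G"
  shows "G\<lparr>carrier := conj_set G g S\<rparr> \<cong> G\<lparr>carrier := S\<rparr>"
proof -
  have c: "s \<in> carrier G" if "s \<in> S" for s using subgroup.mem_carrier[OF S that] .
  have "(\<lambda>h. g \<otimes> h \<otimes> inv g) \<in> iso (G\<lparr>carrier := S\<rparr>) (G\<lparr>carrier := conj_set G g S\<rparr>)"
  proof (rule isoI)
    show "(\<lambda>h. g \<otimes> h \<otimes> inv g) \<in> hom (G\<lparr>carrier := S\<rparr>) (G\<lparr>carrier := conj_set G g S\<rparr>)"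
    proof (rule homI)
      fix x y assume "x \<in> carrier (G\<lparr>carrier := S\<rparr>)" "y \<in> carrier (G\<lparr>carrier := S\<rparr>)"
      then show "g \<otimes> (x \<otimes>\<^bsub>G\<lparr>carrier := S\<rparr>\<^esub> y) \<otimes> inv g =
          (g \<otimes> x \<otimes> inv g) \<otimes>\<^bsub>G\<lparr>carrier := conj_set G g S\<rparr>\<^esub> (g \<otimes> y \<otimes> inv g)"
        using conj_hom[OF g c c] by simp
    qed (auto simp: conj_set_def)
    have "inj_on (\<lambda>h. g \<otimes> h \<otimes> inv g) S"
    proof (rule inj_onI)
      fix x y assume "x \<in> S" "y \<in> S" "g \<otimes> x \<otimes> inv g = g \<otimes> y \<otimes> inv g"
      then show "x = y" using conj_eq_iff[OF g c c] by blast
    qed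
    then show "bij_betw (\<lambda>h. g \<otimes> h \<otimes> inv g) (carrier (G\<lparr>carrier := S\<rparr>)) (carrier (G\<lparr>carrier := conj_set G g S\<rparr>))"
      by (simp add: bij_betw_def conj_set_def)
  qed
  then have "G\<lparr>carrier := S\<rparr> \<cong> G\<lparr>carrier := conj_set G g S\<rparr>" by (rule is_isoI)
  then show ?thesis using group.iso_sym[OF subgroup.subgroup_is_group[OF S group_axioms]] by blast
qed

section \<open>Bad subgroups\<close>

text \<open>Makes the two cases of the classification exclude each other.\<close>

lemma integer_mod_group_not_iso_square:
  assumes "prime p"
  shows "\<not> integer_mod_group p \<cong> integer_mod_group p \<times>\<times> integer_mod_group p"
proof
  have "carrier (integer_mod_group p) = {0..<int p}" using assms by (auto simp: carrier_integer_mod_group)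
  then have card: "card (carrier (integer_mod_group p)) = p" by simp
  assume "integer_mod_group p \<cong> integer_mod_group p \<times>\<times> integer_mod_group p"
  then have "card (carrier (integer_mod_group p)) = card (carrier (integer_mod_group p \<times>\<times> integer_mod_group p))"
    by (rule iso_same_card)
  then have "p = p * p" by (simp add: card card_cartesian_product)
  then show False using prime_gt_1_nat[OF assms] by simp
qed

theorem theorem1:
  fixes p :: nat and \<xi> :: complex and H :: "complex mat set set"
  defines "G \<equiv> PSL p"
  defines "Z \<equiv> group_centralizer (PSL p) H"
  assumes "prime p"
    and "primitive_root_of_unity p \<xi>"
    and "bad_subgroup p H"
  shows "(G\<lparr>carrier := Z\<rparr> \<cong> integer_mod_group p \<times>\<times> integer_mod_group p \<or>
          G\<lparr>carrier := Z\<rparr> \<cong> integer_mod_group p) \<and>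
         (G\<lparr>carrier := Z\<rparr> \<cong> integer_mod_group p \<times>\<times> integer_mod_group p \<longrightarrow>
            internal_direct G (gen_D p \<xi>) (gen_M p) \<and>
            conjugate_in G H (gen_D p \<xi> <#>\<^bsub>G\<^esub> gen_M p) \<and>
            Z = H) \<and>
         (G\<lparr>carrier := Z\<rparr> \<cong> integer_mod_group p \<longrightarrow>
            (\<exists>K. subgroup K G \<and> K \<subseteq> D_bar p \<and> K \<noteq> {\<one>\<^bsub>G\<^esub>} \<and> K \<noteq> gen_D p \<xi> \<and>
                 conj_invariant G (gen_M p) K \<and>
                 internal_semidirect G K (gen_M p) \<and>
                 conjugate_in G H (K <#>\<^bsub>G\<^esub> gen_M p)) \<and>
            conjugate_in G Z (gen_D p \<xi>))"
proof -
  let ?ZZ = "integer_mod_group p \<times>\<times> integer_mod_group p"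
  interpret prime_root p \<xi> using assms(3,4) by unfold_locales
  interpret G: group G unfolding G_def by (rule group_PSL)
  have gens: "gen_D p \<xi> = generate G {\<delta>}" "gen_M p = generate G {\<mu>}"
    by (simp_all add: gen_D_def gen_M_def G_def)
  have irr: "irreducible_subgroup p H" and bad: "Z \<noteq> group_center G"
    using assms(5) by (auto simp: bad_subgroup_def Z_def G_def)
  have H: "subgroup H G" using irr by (simp add: irreducible_subgroup_def G_def)
  have Hc: "H \<subseteq> carrier G" using subgroup.subset[OF H] .
  have Zsub: "subgroup Z G" unfolding Z_def using G.centralizer_subgroup[OF Hc] by (simp add: G_def)
  have "group_center G \<subseteq> Z" using Hc by (auto simp: Z_def group_center_def group_centralizer_def G_def)
  then obtain z where z: "z \<in> Z" "z \<notin> group_center G" using bad by blast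
  have "z \<noteq> \<one>\<^bsub>G\<^esub>" using z(2) subgroup.one_closed[OF G.center_subgroup] by blast
  then obtain g A where gA: "g \<in> carrier (SL p)" "z = to_PSL p g" "A \<in> carrier (SL p)" "to_PSL p A \<in> H"
    "g * A = \<xi> \<cdot>\<^sub>m (A * g)"
    using bad_twisted_pair[OF irr, of z] z(1) unfolding Z_def G_def by metis
  obtain P a b where P: "P \<in> carrier (SL p)" "g * P = a \<cdot>\<^sub>m (P * D)" "A * P = b \<cdot>\<^sub>m (P * M)"
    using commuting_pair_normal_form[OF gA(1,3,5)] by blast
  define x where "x = to_PSL p P"
  have x: "x \<in> carrier G" using to_PSL_closed[OF P(1)] by (simp add: x_def G_def)
  have mult: "to_PSL p (B * C) = to_PSL p B \<otimes>\<^bsub>G\<^esub> to_PSL p C" if "B \<in> carrier (SL p)" "C \<in> carrier (SL p)" for B C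
    using to_PSL_mult[OF that] by (simp add: G_def)
  have closed: "to_PSL p B \<in> carrier G" if "B \<in> carrier (SL p)" for B
    using to_PSL_closed[OF that] by (simp add: G_def)
  have "z \<otimes>\<^bsub>G\<^esub> x = x \<otimes>\<^bsub>G\<^esub> \<delta>"
    using to_PSL_eq_iff[OF SL_mult_closed[OF gA(1) P(1)] SL_mult_closed[OF P(1) D_SL]] P(2)
      mult[OF gA(1) P(1)] mult[OF P(1) D_SL] gA(2) by (auto simp: x_def)
  then have z_conj: "z = conj_by G x \<delta>"
    using x closed[OF gA(1)] gA(2) closed[OF D_SL] by (metis G.inv_solve_right G.m_closed)
  have "to_PSL p A \<otimes>\<^bsub>G\<^esub> x = x \<otimes>\<^bsub>G\<^esub> \<mu>"
    using to_PSL_eq_iff[OF SL_mult_closed[OF gA(3) P(1)] SL_mult_closed[OF P(1) M_SL]] P(3)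
      mult[OF gA(3) P(1)] mult[OF P(1) M_SL] by (auto simp: x_def)
  then have A_conj: "to_PSL p A = conj_by G x \<mu>"
    using x closed[OF gA(3)] closed[OF M_SL] by (metis G.inv_solve_right G.m_closed)
  \<comment> \<open>From here on the conjugate \<open>H1\<close>, which contains \<open>\<mu>\<close> and commutes with \<open>\<delta>\<close>, replaces \<open>H\<close>.\<close>
  define H1 where "H1 = conj_set G (inv\<^bsub>G\<^esub> x) H"
  have H1: "subgroup H1 G" unfolding H1_def using G.conj_set_subgroup[OF _ H] x by simp
  have H1c: "H1 \<subseteq> carrier G" using subgroup.subset[OF H1] .
  have H_conj: "H = conj_set G x H1" unfolding H1_def using G.conj_set_cancel[OF x Hc] by simp
  define Z1 where "Z1 = group_centralizer G H1"
  have Z1: "subgroup Z1 G" unfolding Z1_def by (rule G.centralizer_subgroup[OF H1c])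
  have Z_conj: "Z = conj_set G x Z1"
    unfolding Z1_def Z_def G_def[symmetric] using G.centralizer_conj_set[OF x H1c] H_conj by simp
  have mem_conj: "y \<in> S" if "conj_by G x y \<in> conj_set G x S" "y \<in> carrier G" "S \<subseteq> carrier G" for y S
    using that G.conj_eq_iff[OF x that(2)] by (auto simp: conj_set_def subset_iff)
  have \<mu>_H1: "\<mu> \<in> H1" using gA(4) A_conj H_conj mem_conj[OF _ closed[OF M_SL] H1c] by simp
  have \<delta>_Z1: "\<delta> \<in> Z1" using z(1) z_conj Z_conj mem_conj[OF _ closed[OF D_SL] subgroup.subset[OF Z1]] by simp
  have cent_\<delta>: "h \<otimes>\<^bsub>PSL p\<^esub> \<delta> = \<delta> \<otimes>\<^bsub>PSL p\<^esub> h" if "h \<in> H1" for h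
    using \<delta>_Z1 that by (simp add: Z1_def group_centralizer_def G_def)
  have Z1_comm: "w \<otimes>\<^bsub>PSL p\<^esub> \<delta> = \<delta> \<otimes>\<^bsub>PSL p\<^esub> w" if w: "w \<in> Z1" for w
  proof -
    have wc: "w \<in> carrier G" using subgroup.mem_carrier[OF Z1 w] .
    have "conj_by G x w \<in> Z" using w Z_conj by (auto simp: conj_set_def)
    then have "(conj_by G x w) \<otimes>\<^bsub>G\<^esub> z = z \<otimes>\<^bsub>G\<^esub> (conj_by G x w)"
      using irreducible_centralizer_commutative[OF irr p_pos] z(1) unfolding Z_def G_def by blast
    then have "conj_by G x (w \<otimes>\<^bsub>G\<^esub> \<delta>) = conj_by G x (\<delta> \<otimes>\<^bsub>G\<^esub> w)"
      unfolding z_conj using G.conj_hom[OF x wc closed[OF D_SL]] G.conj_hom[OF x closed[OF D_SL] wc] by simp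
    then show ?thesis using G.conj_eq_iff[OF x] wc closed[OF D_SL] by (simp add: G_def)
  qed
  have not_cyclic: "H1 \<noteq> generate G {\<mu>}"
  proof
    assume eq: "H1 = generate G {\<mu>}"
    obtain N where N: "N \<in> carrier (SL p)" "P * N = 1\<^sub>m p" "N * P = 1\<^sub>m p" using SL_inverse[OF P(1)] .
    \<comment> \<open>If \<open>H1\<close> is generated by \<open>\<mu>\<close>, all matrices over \<open>H\<close> commute with this conjugate of \<open>M\<close>.\<close>
    define Y where "Y = P * M * N"
    have Y: "Y \<in> carrier (SL p)" unfolding Y_def using P(1) N(1) M_SL SL_mult_closed by blast
    have conj: "to_PSL p (P * B * N) = conj_by G x (to_PSL p B)" if "B \<in> carrier (SL p)" for B
      using mult[OF SL_mult_closed[OF P(1) that] N(1)] mult[OF P(1) that] to_PSL_inv[OF P(1) N(1,2)]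
      by (simp add: x_def G_def)
    have "to_PSL p Y \<noteq> \<one>\<^bsub>PSL p\<^esub>"
    proof
      assume "to_PSL p Y = \<one>\<^bsub>PSL p\<^esub>"
      then have "conj_by G x \<mu> = conj_by G x \<one>\<^bsub>G\<^esub>"
        using conj[OF M_SL] x by (simp add: Y_def G_def)
      then have "\<mu> = \<one>\<^bsub>G\<^esub>" using G.conj_eq_iff[OF x closed[OF M_SL] G.one_closed] by blast
      then show False using \<mu>_not_one by (simp add: G_def)
    qed
    moreover have "H \<subseteq> commutant_image p Y"
    proof
      fix h assume "h \<in> H"
      then obtain q where q: "q \<in> generate G {\<mu>}" "h = conj_by G x q"
        using H_conj eq by (auto simp: conj_set_def)
      have "\<mu> \<in> commutant_image p M" using M_SL by (auto simp: commutant_image_def)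
      then have "generate G {\<mu>} \<subseteq> commutant_image p M"
        using G.generate_subgroup_incl commutant_image_subgroup[OF M_carrier] by (simp add: G_def)
      then obtain B where B: "B \<in> carrier (SL p)" "B * M = M * B" "q = to_PSL p B"
        using q(1) by (auto simp: commutant_image_def)
      have "P * B * N * Y = Y * (P * B * N)"
        unfolding Y_def
        using mat_conj_mult[OF SL_carrier_mat[OF N(1)] SL_carrier_mat[OF P(1)] N(3) SL_carrier_mat[OF B(1)] M_carrier]
          mat_conj_mult[OF SL_carrier_mat[OF N(1)] SL_carrier_mat[OF P(1)] N(3) M_carrier SL_carrier_mat[OF B(1)]] B(2)
        by (simp only:)
      moreover have "P * B * N \<in> carrier (SL p)" using P(1) N(1) B(1) SL_mult_closed by blast
      ultimately show "h \<in> commutant_image p Y"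
        using conj[OF B(1)] q(2) B(3) by (auto simp: commutant_image_def image_iff)
    qed
    ultimately show False using irreducible_not_in_commutant[OF irr Y] by blast
  qed
  have iso: "G\<lparr>carrier := Z\<rparr> \<cong> G\<lparr>carrier := Z1\<rparr>" unfolding Z_conj by (rule G.conj_set_iso[OF x Z1])
  have Z1g: "group (G\<lparr>carrier := Z1\<rparr>)" using subgroup.subgroup_is_group[OF Z1 G.group_axioms] .
  have Zg: "group (G\<lparr>carrier := Z\<rparr>)" using subgroup.subgroup_is_group[OF Zsub G.group_axioms] .
  note facts = H1[unfolded G_def] \<mu>_H1 cent_\<delta> Z1_comm[unfolded Z1_def G_def]
  have conj_intro: "conjugate_in G S L" if "S = conj_set G x L" for S L
    using that x by (auto simp: conjugate_in_def)
  show ?thesis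
  proof (cases "H1 \<inter> D_bar p = generate (PSL p) {\<delta>}")
    case True
    note c = PSL.self_centralizing_case[OF facts True]
    have Z1H1: "Z1 = H1" using c(1) by (simp add: Z1_def G_def)
    have "G\<lparr>carrier := Z1\<rparr> \<cong> ?ZZ" using c(4) Z1H1 by (simp add: G_def)
    then have ZI: "G\<lparr>carrier := Z\<rparr> \<cong> ?ZZ"
      using iso_trans[OF iso] by blast
    then have "\<not> G\<lparr>carrier := Z\<rparr> \<cong> integer_mod_group p"
      using integer_mod_group_not_iso_square[OF assms(3)] iso_trans[OF group.iso_sym[OF Zg]] by blast
    moreover have "internal_direct G (gen_D p \<xi>) (gen_M p)" using c(2) by (simp add: gens G_def)
    moreover have "conjugate_in G H (gen_D p \<xi> <#>\<^bsub>G\<^esub> gen_M p)"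
      using conj_intro H_conj c(3) by (simp add: gens G_def)
    moreover have "Z = H" using Z_conj H_conj Z1H1 by simp
    ultimately show ?thesis using ZI by blast
  next
    case False
    note c = PSL.cyclic_centralizer_case[OF facts False not_cyclic[unfolded G_def]]
    have Z1R: "Z1 = generate G {\<delta>}" using c(1) by (simp add: Z1_def G_def)
    have "G\<lparr>carrier := Z1\<rparr> \<cong> integer_mod_group p"
      unfolding Z1R using G.cyclic_subgroup_iso[OF closed[OF D_SL] assms(3)] \<delta>_pow \<delta>_not_one by (simp add: G_def)
    then have ZI: "G\<lparr>carrier := Z\<rparr> \<cong> integer_mod_group p" using iso_trans[OF iso] by blast
    then have "\<not> G\<lparr>carrier := Z\<rparr> \<cong> ?ZZ"
      using integer_mod_group_not_iso_square[OF assms(3)] iso_trans[OF group.iso_sym[OF Zg]] by blast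
    moreover have "conjugate_in G Z (gen_D p \<xi>)" using conj_intro Z_conj Z1R gens by simp
    moreover have "subgroup (H1 \<inter> D_bar p) G" using PSL.K_subgroup[OF facts] by (simp add: G_def)
    moreover have "conj_invariant G (gen_M p) (H1 \<inter> D_bar p)" using PSL.K_conj_invariant[OF facts] by (simp add: gens G_def)
    moreover have "internal_semidirect G (H1 \<inter> D_bar p) (gen_M p)" using PSL.K_semidirect[OF facts] by (simp add: gens G_def)
    moreover have "conjugate_in G H ((H1 \<inter> D_bar p) <#>\<^bsub>G\<^esub> gen_M p)"
      using conj_intro H_conj PSL.H_decomposition[OF facts] by (simp add: gens G_def)
    moreover have "H1 \<inter> D_bar p \<noteq> {\<one>\<^bsub>G\<^esub>}" using c(2) by (simp add: G_def)
    moreover have "H1 \<inter> D_bar p \<noteq> gen_D p \<xi>" using False by (simp add: gens G_def)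
    ultimately show ?thesis using ZI by blast
  qed
qed

end
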